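(* Let $G=Sp(2n,\mathbb{R})$ and let $k$ be a positive integer with $2k\le n$. For nonnegative integers $r,s$ with $r+s=2k$ and $\epsilon,\eta\in\{0,1\}$ (with $\epsilon=0$ if $r=0$, $\eta=0$ if $s=0$), let $X(r,s;\epsilon,\eta)$ be the irreducible unipotent representation described in the context. Then each of the following virtual $(\mathfrak{g},K)$-modules has zero Dirac index: (a) $\sum_{\epsilon+\eta\equiv\delta\ (\mathrm{mod}\ 2)}X(2j-1,2k+1-2j;\epsilon,\eta)$, for any $1\le j\le k-1$ and $\delta\in\{0,1\}$; (b) $\sum_{\epsilon}X(2k,0;\epsilon,0)+\sum_{\eta}X(0,2k;0,\eta)+\sum_{j=1}^{k-1}\sum_{\epsilon+\eta\equiv\delta\ (\mathrm{mod}\ 2)}X(2j,2k-2j;\epsilon,\eta)$, for $\delta\in\{0,1\}$. In each sum, $\epsilon$ and $\eta$ run over $\{0,1\}$.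
   Context: $K=U(n)$, with compact Cartan coordinates such that $\Delta^+(\mathfrak{k},\mathfrak{t})=\{e_i-e_j: i<j\}$ and $\Delta^+(\mathfrak{p},\mathfrak{t})=\{e_i+e_j: i<j\}\cup\{2e_i\}$. $X(r,s;\epsilon,\eta)$ is the irreducible unipotent representation of $Sp(2n,\mathbb{R})$ obtained by theta lifting from the character $\mathbb{C}_{\epsilon,\eta}$ of $O(r,s)$ (notation of Barbasch–Pandžić); its $K$-types, each of multiplicity one, have highest weights $(\frac{r-s}{2},\dots,\frac{r-s}{2})+(2a_1+\epsilon,\dots,2a_r+\epsilon,0,\dots,0,-2b_s-\eta,\dots,-2b_1-\eta)$ with integers $a_1\ge\dots\ge a_r\ge 0$, $b_1\ge\dots\ge b_s\ge0$, and its infinitesimal character is $(n-k,n-k-1,\dots,k+1,k,k-1,\dots,-k+1)$. The Dirac index of a $(\mathfrak{g},K)$-module $\pi$ is the virtual $\widetilde K$-module ${\rm DI}(\pi)=H_D^+(\pi)-H_D^-(\pi)=\pi\otimes{\rm Spin}_G^+-\pi\otimes{\rm Spin}_G^-$, where ${\rm Spin}_G^{\pm}=\bigwedge^{\rm even/odd}\mathfrak{p}^+\otimes\mathbb{C}_{-\rho_n}$, $\widetilde K$ is the spin double cover of $K$, and $H_D^\pm$ are the even/odd parts of Dirac cohomology $H_D(\pi)=\ker D/(\ker D\cap \operatorname{im} D)$ of the Dirac operator $D$; it is extended additively to virtual modules. *)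

theory Defs
  imports Complex_Main
begin

text \<open>Weights of the compact Cartan of U(n) (and of its spin double cover) are
  represented as lists of rationals of length n in the coordinates e_1,...,e_n
  (list index m stands for e_(m+1)).\<close>

type_synonym wt = "rat list"

text \<open>Dominant (highest) weights of irreducible representations of the double
  cover of U(n): nonincreasing, integral differences, half-integral entries.\<close>
definition dominant :: "nat \<Rightarrow> wt \<Rightarrow> bool" where
  "dominant n lam \<longleftrightarrow> length lam = n \<and> n > 0 \<and> 2 * (lam ! 0) \<in> \<int> \<and>
     (\<forall>i. Suc i < n \<longrightarrow> lam ! i - lam ! Suc i \<in> \<nat>)"

definition rowlen :: "nat \<Rightarrow> wt \<Rightarrow> nat \<Rightarrow> nat" where
  "rowlen n lam i = nat \<lfloor>lam ! i - lam ! (n - 1)\<rfloor>"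

definition diagram :: "nat \<Rightarrow> wt \<Rightarrow> (nat \<times> nat) set" where
  "diagram n lam = {(i, j). i < n \<and> j < rowlen n lam i}"

definition ssyt_count :: "nat \<Rightarrow> wt \<Rightarrow> wt \<Rightarrow> nat" where
  "ssyt_count n lam mu = card {T :: nat \<times> nat \<Rightarrow> nat.
      (\<forall>x. x \<notin> diagram n lam \<longrightarrow> T x = 0) \<and>
      (\<forall>x\<in>diagram n lam. T x < n) \<and>
      (\<forall>i j. (i, Suc j) \<in> diagram n lam \<longrightarrow> T (i, j) \<le> T (i, Suc j)) \<and>
      (\<forall>i j. (Suc i, j) \<in> diagram n lam \<longrightarrow> T (i, j) < T (Suc i, j)) \<and>
      (\<forall>a<n. of_nat (card {x\<in>diagram n lam. T x = a}) = mu ! a - lam ! (n - 1))}"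

text \<open>Weight multiplicity of mu in the irreducible module E_lam (Kostka number),
  i.e. the formal character of E_lam.\<close>
definition ch :: "nat \<Rightarrow> wt \<Rightarrow> wt \<Rightarrow> int" where
  "ch n lam mu = (if dominant n lam \<and> length mu = n then int (ssyt_count n lam mu) else 0)"

definition vadd :: "wt \<Rightarrow> wt \<Rightarrow> wt" where
  "vadd mu nu = map (\<lambda>(x, y). x + y) (zip mu nu)"

definition conv :: "(wt \<Rightarrow> int) \<Rightarrow> (wt \<Rightarrow> int) \<Rightarrow> wt \<Rightarrow> int" where
  "conv f g nu = (\<Sum>p\<in>{(mu, mu'). f mu \<noteq> 0 \<and> g mu' \<noteq> 0 \<and> length mu = length mu'
                                  \<and> vadd mu mu' = nu}. f (fst p) * g (snd p))"

definition irr_mult :: "nat \<Rightarrow> (wt \<Rightarrow> int) \<Rightarrow> wt \<Rightarrow> int" where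
  "irr_mult n chi tau = (THE c :: wt \<Rightarrow> int.
      finite {t. c t \<noteq> 0} \<and> (\<forall>t. c t \<noteq> 0 \<longrightarrow> dominant n t) \<and>
      chi = (\<lambda>mu. \<Sum>t\<in>{t. c t \<noteq> 0}. c t * ch n t mu)) tau"

text \<open>Positive noncompact roots: e_i+e_j (i<j) and 2e_i, indexed by pairs (i,j), i \<le> j.\<close>
definition pplus :: "nat \<Rightarrow> (nat \<times> nat) set" where
  "pplus n = {(i, j). i \<le> j \<and> j < n}"

definition rootsum :: "nat \<Rightarrow> (nat \<times> nat) set \<Rightarrow> wt" where
  "rootsum n S = map (\<lambda>m. \<Sum>(i, j)\<in>S. (if m = i then 1 else 0) + (if m = j then 1 else 0)) [0..<n]"

definition rho_n :: "nat \<Rightarrow> wt" where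
  "rho_n n = map (\<lambda>x. x / 2) (rootsum n (pplus n))"

text \<open>Characters of Spin^+ (even = True) and Spin^- (even = False):
  wedge^{even/odd} p^+ tensor C_{-rho_n}.\<close>
definition spin_char :: "nat \<Rightarrow> bool \<Rightarrow> wt \<Rightarrow> int" where
  "spin_char n ev nu = int (card {S. S \<subseteq> pplus n \<and> (even (card S) \<longleftrightarrow> ev) \<and>
       vadd (rootsum n S) (map uminus (rho_n n)) = nu})"

text \<open>A (virtual) (g,K)-module is recorded through its K-type multiplicities
  Kmult lam (multiplicity of E_lam). Multiplicity of the K~-type E_tau in
  pi tensor Spin^{+/-} (only finitely many lam contribute).\<close>
definition tensor_spin_mult :: "nat \<Rightarrow> bool \<Rightarrow> (wt \<Rightarrow> int) \<Rightarrow> wt \<Rightarrow> int" where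
  "tensor_spin_mult n ev Kmult tau =
     (\<Sum>lam\<in>{lam. Kmult lam \<noteq> 0 \<and> irr_mult n (conv (ch n lam) (spin_char n ev)) tau \<noteq> 0}.
        Kmult lam * irr_mult n (conv (ch n lam) (spin_char n ev)) tau)"

definition dirac_index :: "nat \<Rightarrow> (wt \<Rightarrow> int) \<Rightarrow> wt \<Rightarrow> int" where
  "dirac_index n Kmult tau = tensor_spin_mult n True Kmult tau - tensor_spin_mult n False Kmult tau"

definition Ktypes :: "nat \<Rightarrow> nat \<Rightarrow> nat \<Rightarrow> nat \<Rightarrow> nat \<Rightarrow> wt set" where
  "Ktypes n r s eps eta = {lam. \<exists>a b :: nat list.
      length a = r \<and> length b = s \<and> sorted (rev a) \<and> sorted (rev b) \<and>
      lam = map (\<lambda>m. (of_nat r - of_nat s) / 2 +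
               (if m < r then of_nat (2 * a ! m + eps)
                else if n - s \<le> m then - of_nat (2 * b ! (n - 1 - m) + eta)
                else 0)) [0..<n]}"

definition Xmod :: "nat \<Rightarrow> nat \<Rightarrow> nat \<Rightarrow> nat \<Rightarrow> nat \<Rightarrow> wt \<Rightarrow> int" where
  "Xmod n r s eps eta lam = (if lam \<in> Ktypes n r s eps eta then 1 else 0)"

end

theory Submission
  imports Defs "Jordan_Normal_Form.Determinant" "HOL-Library.Poly_Mapping"
begin

text \<open>
  By the Weyl character formula, the multiplicity of the type with highest weight \<open>\<tau>\<close> in
  \<open>E\<^sub>\<lambda> \<otimes> (Spin\<^sup>+ - Spin\<^sup>-)\<close> is a coefficient of the alternant of \<open>\<lambda> + \<rho>\<close> times the product of all
  \<open>1 - e\<^sup>\<beta>\<close>, \<open>\<beta>\<close> a positive noncompact root. Hence the Dirac index of a module vanishes if the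
  alternating function on \<open>\<int>\<^sup>n\<close> that records its types \<open>\<lambda> + \<rho>\<close> is annihilated by the product of the
  difference operators in the directions \<open>e\<^sub>i + e\<^sub>j\<close>, \<open>i \<le> j\<close>.

  For the representations with \<open>r + s = 2k\<close>, the sequence \<open>\<lambda> + \<rho>\<close> consists of \<open>r\<close> entries \<open>\<ge> n - k\<close>, the
  fixed block \<open>n - k - 1, \<dots>, k\<close>, and \<open>s\<close> entries \<open>< k\<close>. Colour an integer by its parity, reversed below
  \<open>k\<close> if \<open>n + \<delta>\<close> is odd. The two sign choices with \<open>\<epsilon> + \<eta> \<equiv> \<delta>\<close> then give exactly the
  sequences whose colours outside the block alternate, one choice for each colour of the first entry. Their generating function \<open>F\<close> satisfies the
  Pfaffian expansion \<open>2k F = Q \<and> F\<close> with \<open>Q(x, y) = sgn(x - y) [x and y have different colours]\<close>.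
  The form \<open>Q\<close> is annihilated by the difference operators \<open>2e\<^sub>1, 2e\<^sub>2, e\<^sub>1 + e\<^sub>2\<close>, and so is its part
  supported on pairs separated by \<open>k\<close>; so \<open>F\<close> is annihilated and, by induction on \<open>k\<close>, also the part of \<open>F\<close>
  with a fixed odd \<open>r\<close>. What remains is the part with even \<open>r\<close>.
\<close>

section \<open>Alternating functions on lists\<close>

text \<open>The product of the difference operators over all roots contains, as a factor, the
  product over the roots on any subset of the coordinates. So an exterior product is annihilated
  once one of its factors is annihilated in its own number of variables. This reduces everything to
  \<open>Q\<close> in two variables and \<open>F\<close> in \<open>2 * k\<close> variables; the
  block is put back by exterior multiplication with indicator one-forms, at the price of a sign. Why
  the argument fixes an odd \<open>r\<close> but only sums over the even ones: two large or two
  small entries fed to \<open>Q\<close> keep the parity of \<open>r\<close>, and the mixed terms are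
  annihilated through \<open>Q\<close> alone. The induction starts from the empty list, where
  \<open>r = 0\<close> and the value is nonzero; this is harmless for odd \<open>r\<close> only.
  Multiplicities are given by a definite description over tableau counts, so existence and
  uniqueness of the decomposition have to be proved along with the character formula. The latter
  comes from matching the branching rules of tableaux and of determinants, in any commutative ring
  and without dividing by the Vandermonde determinant.\<close>

definition sg :: "'a::linorder \<Rightarrow> 'a \<Rightarrow> int" where
  "sg x y = (if y < x then 1 else if x < y then - 1 else 0)"

fun vsgn :: "'a::linorder list \<Rightarrow> int" where
  "vsgn [] = 1"
| "vsgn (x # xs) = prod_list (map (sg x) xs) * vsgn xs"

definition alternating :: "('a list \<Rightarrow> int) \<Rightarrow> bool" where
  "alternating f \<longleftrightarrow> (\<forall>xs a b ys. f (xs @ a # b # ys) = - f (xs @ b # a # ys))"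

text \<open>The alternating function prescribed by \<open>g\<close> on strictly decreasing lists;
  \<open>vsgn\<close> vanishes as soon as an entry is repeated.\<close>

definition alt_ext :: "('a::linorder list \<Rightarrow> int) \<Rightarrow> 'a list \<Rightarrow> int" where
  "alt_ext g v = vsgn v * g (rev (sort v))"

lemma alternatingD: "alternating f \<Longrightarrow> f (xs @ a # b # ys) = - f (xs @ b # a # ys)"
  unfolding alternating_def by blast

lemma alternating_Cons: "alternating f \<Longrightarrow> alternating (\<lambda>l. f (x # l))"
  unfolding alternating_def by (metis append_Cons)

lemma vsgn_swap: "vsgn (xs @ a # b # ys) = - vsgn (xs @ b # a # ys)"
  by (induction xs) (auto simp: sg_def)

lemma alternating_alt_ext: "alternating (alt_ext g)"
proof -
  have "sort (xs @ a # b # ys) = sort (xs @ b # a # ys)" for xs ys :: "'a list" and a b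
    by (rule properties_for_sort) auto
  then show ?thesis
    unfolding alternating_def alt_ext_def by (metis mult_minus_left vsgn_swap)
qed

lemma vsgn_decr: "sorted_wrt (>) v \<Longrightarrow> vsgn v = 1"
proof (induction v)
  case (Cons x xs)
  then have "map (sg x) xs = map (\<lambda>_. 1) xs"
    by (auto simp: sg_def)
  then have "prod_list (map (sg x) xs) = 1"
    by (simp only:) (induction xs, auto)
  with Cons show ?case by simp
qed simp

lemma rev_sort_decr:
  assumes "sorted_wrt (>) (v :: 'a::linorder list)"
  shows "rev (sort v) = v"
proof -
  have "sorted (rev v)"
    using assms unfolding sorted_wrt_rev
    by (rule sorted_wrt_mono_rel[rotated]) auto
  then have "sort v = rev v"
    by (intro properties_for_sort) auto
  then show ?thesis by simp
qed

lemma alt_ext_decr: "sorted_wrt (>) v \<Longrightarrow> alt_ext g v = g v"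
  by (simp add: alt_ext_def vsgn_decr rev_sort_decr)

lemma alternating_move:
  assumes "alternating f"
  shows "f (us @ a # vs) = (- 1) ^ length us * f (a # us @ vs)"
  using assms
proof (induction us arbitrary: f)
  case (Cons u us)
  have "f ((u # us) @ a # vs) = (- 1) ^ length us * f (u # a # us @ vs)"
    using Cons.IH[OF alternating_Cons[OF Cons.prems, of u]] by simp
  also have "f (u # a # us @ vs) = - f (a # u # us @ vs)"
    using alternatingD[OF Cons.prems, of "[]" u a "us @ vs"] by simp
  finally show ?case by simp
qed simp

text \<open>The sign is chosen before \<open>f\<close>: it only records the moves that carry one
  list to the other. Two alternating functions can thus be compared through the same sign.\<close>

lemma alternating_mset:
  assumes "mset xs = mset ys"
  shows "\<exists>s. s \<in> {1, - 1} \<and> (\<forall>f. alternating f \<longrightarrow> f xs = s * f ys)"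
  using assms
proof (induction xs arbitrary: ys)
  case Nil
  then show ?case by (intro exI[of _ 1]) auto
next
  case (Cons a xs)
  from Cons.prems have "a \<in> set ys" by (metis list.set_intros(1) mset_eq_setD)
  then obtain us vs where ys: "ys = us @ a # vs" by (meson split_list)
  with Cons.prems have "mset xs = mset (us @ vs)" by simp
  from Cons.IH[OF this] obtain s :: int where s: "s \<in> {1, - 1}"
    "\<And>f. alternating f \<Longrightarrow> f xs = s * f (us @ vs)" by auto
  have "f (a # xs) = (s * (- 1) ^ length us) * f ys" if "alternating f" for f
  proof -
    have "f (a # us @ vs) = (- 1) ^ length us * f ys"
      using alternating_move[OF that, of us a vs] by (simp add: ys flip: mult.assoc power_add)
    with s(2)[OF alternating_Cons[OF that, of a]] show ?thesis by (simp add: mult.assoc)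
  qed
  moreover have "s * (- 1) ^ length us \<in> {1, - 1}"
    using s(1) by (cases "even (length us)") auto
  ultimately show ?case by blast
qed

text \<open>Sorting reduces to a weakly decreasing list. If that list is not strictly decreasing,
  two equal neighbours make each function equal to its own negative, hence zero.\<close>

lemma alternating_eqI:
  fixes f g :: "'a::linorder list \<Rightarrow> int"
  assumes "alternating f" "alternating g"
    and eq: "\<And>v. length v = n \<Longrightarrow> sorted_wrt (>) v \<Longrightarrow> f v = g v"
    and "length v = n"
  shows "f v = g v"
proof -
  define u where "u = rev (sort v)"
  obtain s where s: "\<And>f. alternating f \<Longrightarrow> f v = s * f u"
    using alternating_mset[of v u] unfolding u_def by auto
  have "f u = g u"
  proof (cases "sorted_wrt (>) u")
    case True
    then show ?thesis using eq assms(4) by (simp add: u_def)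
  next
    case False
    have le: "sorted_wrt (\<ge>) u"
      unfolding u_def sorted_wrt_rev by simp
    have "\<not> distinct u"
    proof
      assume "distinct u"
      then have "sorted_wrt (>) u" using le by (induction u) (auto simp: order.strict_iff_order)
      with False show False by simp
    qed
    then have "\<exists>xs a ys. u = xs @ a # a # ys"
      using le
    proof (induction u)
      case (Cons x l)
      show ?case
      proof (cases "x \<in> set l")
        case True
        then obtain y l' where l: "l = y # l'" by (cases l) auto
        with True Cons.prems have "y = x" by (auto intro: order.antisym)
        with l show ?thesis by (intro exI[of _ "[]"]) auto
      next
        case False
        with Cons obtain xs a ys where "l = xs @ a # a # ys" by auto
        then show ?thesis by (intro exI[of _ "x # xs"]) auto
      qed
    qed simp
    then obtain xs a ys where u: "u = xs @ a # a # ys" by auto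
    have "h u = 0" if "alternating h" for h :: "'a list \<Rightarrow> int"
      using alternatingD[OF that, of xs a a ys] u by simp
    from this[OF assms(1)] this[OF assms(2)] show ?thesis by simp
  qed
  with s[OF assms(1)] s[OF assms(2)] show ?thesis by simp
qed

text \<open>Exterior multiplication by a one-form and by a two-form, expanded over the positions of the
  arguments that are fed to the form.\<close>
fun wedge_one :: "('a \<Rightarrow> int) \<Rightarrow> ('a list \<Rightarrow> int) \<Rightarrow> 'a list \<Rightarrow> int" where
  "wedge_one \<phi> G [] = 0"
| "wedge_one \<phi> G (x # xs) = \<phi> x * G xs - wedge_one \<phi> (\<lambda>l. G (x # l)) xs"

fun wedge_two :: "('a \<Rightarrow> 'a \<Rightarrow> int) \<Rightarrow> ('a list \<Rightarrow> int) \<Rightarrow> 'a list \<Rightarrow> int" where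
  "wedge_two Q G [] = 0"
| "wedge_two Q G (x # xs) = wedge_one (Q x) G xs + wedge_two Q (\<lambda>l. G (x # l)) xs"

lemma wedge_one_uminus: "wedge_one \<phi> (\<lambda>l. - G l) v = - wedge_one \<phi> G v"
  by (induction v arbitrary: G) auto

lemma wedge_two_uminus: "wedge_two Q (\<lambda>l. - G l) v = - wedge_two Q G v"
  by (induction v arbitrary: G) (auto simp: wedge_one_uminus)

lemma wedge_one_add: "wedge_one \<phi> (\<lambda>l. G l + H l) v = wedge_one \<phi> G v + wedge_one \<phi> H v"
  by (induction v arbitrary: G H) (auto simp: algebra_simps)

lemma wedge_two_add: "wedge_two Q (\<lambda>l. G l + H l) v = wedge_two Q G v + wedge_two Q H v"
  by (induction v arbitrary: G H) (auto simp: wedge_one_add)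

lemma alternating_wedge_one:
  assumes "alternating G"
  shows "alternating (wedge_one \<phi> G)"
proof -
  have "wedge_one \<phi> G (xs @ a # b # ys) = - wedge_one \<phi> G (xs @ b # a # ys)" for xs a b ys
    using assms
  proof (induction xs arbitrary: G)
    case Nil
    have "(\<lambda>l. G (a # b # l)) = (\<lambda>l. - G (b # a # l))"
      using alternatingD[OF Nil, of "[]" a b] by auto
    then show ?case by (simp add: wedge_one_uminus)
  next
    case (Cons x xs)
    show ?case
      using Cons.IH[OF alternating_Cons[OF Cons.prems, of x]] alternatingD[OF Cons.prems, of xs a b ys]
      by simp
  qed
  then show ?thesis unfolding alternating_def by blast
qed

lemma alternating_wedge_two:
  assumes "alternating G" and Q: "\<And>x y. Q x y = - Q y x"
  shows "alternating (wedge_two Q G)"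
proof -
  have "wedge_two Q G (xs @ a # b # ys) = - wedge_two Q G (xs @ b # a # ys)" for xs a b ys
    using assms(1)
  proof (induction xs arbitrary: G)
    case Nil
    have "(\<lambda>l. G (a # b # l)) = (\<lambda>l. - G (b # a # l))"
      using alternatingD[OF Nil, of "[]" a b] by auto
    then show ?case using Q[of a b] by (simp add: wedge_two_uminus)
  next
    case (Cons x xs)
    show ?case
      using Cons.IH[OF alternating_Cons[OF Cons.prems, of x]]
        alternatingD[OF alternating_wedge_one[OF Cons.prems], of "Q x" xs a b ys]
      by simp
  qed
  then show ?thesis unfolding alternating_def by blast
qed

section \<open>Exterior products on words of alternating colours\<close>

fun alternates :: "bool \<Rightarrow> bool list \<Rightarrow> bool" where
  "alternates c [] = True"
| "alternates c (x # xs) = (x = c \<and> alternates (\<not> c) xs)"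

text \<open>Deleting a letter can leave an alternating word in two ways. Either the word has two
  equal neighbours, and their deletions give the same result with opposite signs; or the word
  alternates already and its first or last letter goes. The right side lists these end deletions by
  colour.\<close>

lemma wedge_one_alternates:
  "wedge_one (\<lambda>x. of_bool (x = d)) (\<lambda>l. of_bool (alternates c l)) s =
    (if d = c then of_bool (alternates c s \<and> odd (length s))
     else if s = [] then 0 else of_bool (alternates (\<not> c) s) - of_bool (even (length s) \<and> alternates c s))"
proof (induction s arbitrary: c)
  case (Cons x xs)
  have *: "wedge_one \<phi> (\<lambda>l. of_bool (x = c \<and> alternates (\<not> c) l)) xs =
      of_bool (x = c) * wedge_one \<phi> (\<lambda>l. of_bool (alternates (\<not> c) l)) xs" for \<phi> :: "bool \<Rightarrow> int"
  proof (cases "x = c")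
    case False
    have "wedge_one \<phi> (\<lambda>l. 0) xs = 0" by (induction xs) auto
    with False show ?thesis by simp
  qed simp
  show ?case
    unfolding wedge_one.simps alternates.simps * Cons.IH
    by (cases x; cases c; cases d; cases xs; auto)
qed simp

text \<open>In a word alternating from \<open>c\<close>, each of the \<open>length s - 1\<close>
  pairs of neighbours can be deleted, always with sign 1. In a word of even length alternating from
  the other colour, both ends can be deleted. All other contributions cancel. Over both choices of
  \<open>c\<close> these are the neighbouring pairs on a circle, which yields the factor
  \<open>length s\<close> for even length.\<close>

lemma wedge_two_alternates:
  assumes "s \<noteq> []"
  shows "wedge_two (\<lambda>x y. of_bool (x \<noteq> y)) (\<lambda>l. of_bool (alternates c l)) s =
    (int (length s) - 1) * of_bool (alternates c s) + of_bool (even (length s) \<and> alternates (\<not> c) s)"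
  using assms
proof (induction s arbitrary: c)
  case (Cons x xs)
  have *: "wedge_two Q (\<lambda>l. of_bool (x = c \<and> alternates (\<not> c) l)) xs =
      of_bool (x = c) * wedge_two Q (\<lambda>l. of_bool (alternates (\<not> c) l)) xs" for Q :: "bool \<Rightarrow> bool \<Rightarrow> int"
  proof (cases "x = c")
    case False
    have i: "wedge_one \<phi> (\<lambda>l. 0) ys = 0" for \<phi> :: "bool \<Rightarrow> int" and ys by (induction ys) auto
    have "wedge_two Q (\<lambda>l. 0) xs = 0" by (induction xs) (auto simp: i)
    with False show ?thesis by simp
  qed simp
  have **: "(\<lambda>y. of_bool (x \<noteq> y)) = (\<lambda>y. of_bool (y = (\<not> x)) :: int)"
    by auto
  show ?case
  proof (cases "xs = []")
    case False
    show ?thesis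
      unfolding wedge_two.simps alternates.simps * ** wedge_one_alternates Cons.IH[OF False]
      using False by (cases x; cases c; auto simp: algebra_simps)
  qed (auto simp: *)
qed simp

section \<open>Annihilation by the noncompact roots\<close>

definition sub_roots :: "nat \<Rightarrow> (nat \<times> nat) set \<Rightarrow> 'a::ring_1 list \<Rightarrow> 'a list" where
  "sub_roots n S u = map (\<lambda>m. u ! m - (\<Sum>(i, j)\<in>S. (if m = i then 1 else 0) + (if m = j then 1 else 0))) [0..<n]"

text \<open>Expanded form of the product of the operators 1 - (shift by beta) over the roots beta in
  \<open>pplus n\<close>.\<close>

definition annihilated :: "nat \<Rightarrow> (int list \<Rightarrow> int) \<Rightarrow> bool" where
  "annihilated n f \<longleftrightarrow> (\<forall>u. length u = n \<longrightarrow> (\<Sum>S\<in>Pow (pplus n). (- 1) ^ card S * f (sub_roots n S u)) = 0)"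

lemma length_sub_roots [simp]: "length (sub_roots n S u) = n"
  by (simp add: sub_roots_def)

lemma finite_pplus [simp]: "finite (pplus n)"
  by (rule finite_subset[of _ "{..<n} \<times> {..<n}"]) (auto simp: pplus_def)

lemma sub_roots_Un:
  assumes "finite S" "finite S'" "S \<inter> S' = {}"
  shows "sub_roots n (S \<union> S') u = sub_roots n S' (sub_roots n S u)"
  using assms by (auto simp: sub_roots_def sum.union_disjoint algebra_simps)

lemma sum_Pow_Un:
  assumes "B \<inter> C = {}"
  shows "(\<Sum>S\<in>Pow (B \<union> C). h S) = (\<Sum>S\<in>Pow B. \<Sum>S'\<in>Pow C. h (S \<union> S'))"
  unfolding sum.cartesian_product
  by (rule sum.reindex_bij_witness[where j = "\<lambda>S. (S \<inter> B, S \<inter> C)" and i = "\<lambda>(S, S'). S \<union> S'"])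
     (use assms in \<open>auto simp flip: Int_Un_distrib simp: Int_absorb2\<close>)

lemma sum_Pow_insert:
  assumes "x \<notin> A"
  shows "(\<Sum>S\<in>Pow (insert x A). h S) = (\<Sum>S\<in>Pow A. h S) + (\<Sum>S\<in>Pow A. h (insert x S))"
  using sum_Pow_Un[of "{x}" A h] assms by (simp add: Pow_insert add.commute)

text \<open>The roots on the coordinates in the image of \<open>e\<close> form a copy of
  \<open>pplus m\<close>, and shifts along them leave \<open>\<psi>\<close> fixed. Summing over
  these roots first gives zero for every fixed choice of the other roots.\<close>

lemma annihilated_embed:
  assumes mono: "strict_mono_on {..<m} e" and sub: "e ` {..<m} \<subseteq> {..<n}"
    and G: "annihilated m G"
    and \<psi>: "\<And>v v'. length v = n \<Longrightarrow> length v' = n \<Longrightarrow> (\<And>i. i < n \<Longrightarrow> i \<notin> e ` {..<m} \<Longrightarrow> v ! i = v' ! i) \<Longrightarrow> \<psi> v = \<psi> v'"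
  shows "annihilated n (\<lambda>v. \<psi> v * G (map (\<lambda>i. v ! e i) [0..<m]))"
  unfolding annihilated_def
proof (intro allI impI)
  fix u :: "int list" assume u: "length u = n"
  define E where "E = map_prod e e"
  define C where "C = E ` pplus m"
  define B where "B = pplus n - C"
  let ?h = "\<lambda>S. (- 1) ^ card S * (\<psi> (sub_roots n S u) * G (map (\<lambda>i. sub_roots n S u ! e i) [0..<m]))"
  have inj: "inj_on e {..<m}" using mono by (rule strict_mono_on_imp_inj_on)
  have injE: "inj_on E (pplus m)"
    using inj unfolding E_def pplus_def inj_on_def by auto
  \<comment> \<open>Roots are encoded as ordered pairs, so \<open>e\<close> has to be monotone for
    their images to be roots again.\<close>
  have C: "C \<subseteq> pplus n"
    unfolding C_def E_def pplus_def using sub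
    by (auto intro!: strict_mono_on_leD[OF mono])
  have fin: "finite S" if "S \<subseteq> B \<or> S \<subseteq> C" for S
    using that C finite_subset[OF _ finite_pplus] unfolding B_def by blast
  have "(\<Sum>S\<in>Pow (pplus n). ?h S) = (\<Sum>S\<in>Pow (B \<union> C). ?h S)"
    unfolding B_def using C by (simp add: Un_absorb2)
  also have "\<dots> = (\<Sum>S\<in>Pow B. \<Sum>S'\<in>Pow C. ?h (S \<union> S'))"
    by (rule sum_Pow_Un) (auto simp: B_def)
  also have "\<dots> = 0"
  proof (rule sum.neutral, rule ballI)
    fix S assume S: "S \<in> Pow B"
    define u' where "u' = sub_roots n S u"
    have "(\<Sum>S'\<in>Pow C. ?h (S \<union> S')) = (\<Sum>S'\<in>Pow (pplus m). ?h (S \<union> E ` S'))"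
      unfolding C_def
      by (rule sum.reindex_bij_betw[symmetric, OF bij_betw_Pow]) (use injE in \<open>simp add: bij_betw_def\<close>)
    also have "\<dots> = (\<Sum>S'\<in>Pow (pplus m). ((- 1) ^ card S * \<psi> u') *
        ((- 1) ^ card S' * G (sub_roots m S' (map (\<lambda>i. u' ! e i) [0..<m]))))"
    proof (rule sum.cong)
      fix S' assume S': "S' \<in> Pow (pplus m)"
      have inj': "inj_on E S'" using injE S' by (auto intro: inj_on_subset)
      have sub': "E ` S' \<subseteq> C" using S' by (auto simp: C_def)
      have disj: "S \<inter> E ` S' = {}" using S sub' by (auto simp: B_def)
      have v: "sub_roots n (S \<union> E ` S') u = sub_roots n (E ` S') u'"
        unfolding u'_def by (rule sub_roots_Un) (use S sub' disj fin in auto)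
      have c: "card (S \<union> E ` S') = card S + card S'"
        using card_Un_disjoint[OF _ _ disj] fin S sub' card_image[OF inj'] by auto
      have *: "sub_roots n (E ` S') u' ! i = u' ! i" if "i < n" "i \<notin> e ` {..<m}" for i
      proof -
        have "(\<Sum>(a, b)\<in>E ` S'. (if i = a then 1 else 0) + (if i = b then 1 else 0)) = (0 :: int)"
          using that S' by (intro sum.neutral) (force simp: E_def pplus_def)
        then show ?thesis using that by (simp add: sub_roots_def)
      qed
      have p: "\<psi> (sub_roots n (E ` S') u') = \<psi> u'"
        by (rule \<psi>) (simp_all add: * length_sub_roots[of n S u, folded u'_def])
      have "map (\<lambda>i. sub_roots n (E ` S') u' ! e i) [0..<m] = sub_roots m S' (map (\<lambda>i. u' ! e i) [0..<m])"
      proof (rule nth_equalityI)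
        fix i assume "i < length (map (\<lambda>i. sub_roots n (E ` S') u' ! e i) [0..<m])"
        then have i: "i < m" "e i < n" using sub by auto
        have "(\<Sum>(a, b)\<in>E ` S'. (if e i = a then 1 else 0) + (if e i = b then 1 else 0 :: int)) =
            (\<Sum>(a, b)\<in>S'. (if i = a then 1 else 0) + (if i = b then 1 else 0))"
          unfolding sum.reindex[OF inj'] 
        proof (rule sum.cong)
          fix x assume "x \<in> S'"
          then obtain a b where "x = (a, b)" "a < m" "b < m" using S' by (force simp: pplus_def)
          then show "((\<lambda>(a, b). (if e i = a then 1 else 0) + (if e i = b then 1 else 0)) \<circ> E) x =
            (case x of (a, b) \<Rightarrow> (if i = a then 1 else 0) + (if i = b then 1 else (0 :: int)))"
            using inj_on_eq_iff[OF inj, of i] i by (simp add: E_def)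
        qed simp
        then show "map (\<lambda>i. sub_roots n (E ` S') u' ! e i) [0..<m] ! i = sub_roots m S' (map (\<lambda>i. u' ! e i) [0..<m]) ! i"
          using i by (simp add: sub_roots_def)
      qed simp
      then show "?h (S \<union> E ` S') = ((- 1) ^ card S * \<psi> u') *
        ((- 1) ^ card S' * G (sub_roots m S' (map (\<lambda>i. u' ! e i) [0..<m])))"
        by (simp add: v p c power_add mult_ac)
    qed simp
    also have "\<dots> = 0"
      using G unfolding sum_distrib_left[symmetric] annihilated_def by simp
    finally show "(\<Sum>S'\<in>Pow C. ?h (S \<union> S')) = 0" .
  qed
  finally show "(\<Sum>S\<in>Pow (pplus n). ?h S) = 0" .
qed

section \<open>Closure of annihilation under linear combinations and exterior products\<close>

lemma annihilated_cong:
  assumes "\<And>v. length v = n \<Longrightarrow> f v = g v" "annihilated n g"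
  shows "annihilated n f"
  using assms by (simp add: annihilated_def)

lemma annihilated_sum:
  assumes "\<And>i. i \<in> I \<Longrightarrow> annihilated n (f i)"
  shows "annihilated n (\<lambda>v. \<Sum>i\<in>I. f i v)"
  using assms unfolding annihilated_def sum_distrib_left
  by (subst sum.swap) (auto intro: sum.neutral)

lemma annihilated_add: "annihilated n f \<Longrightarrow> annihilated n g \<Longrightarrow> annihilated n (\<lambda>v. f v + g v)"
  by (simp add: annihilated_def algebra_simps sum.distrib)

lemma annihilated_cmult: "annihilated n f \<Longrightarrow> annihilated n (\<lambda>v. c * f v)"
  unfolding annihilated_def by (simp add: mult.left_commute flip: sum_distrib_left)

lemma annihilated_cmult_iff: "c \<noteq> 0 \<Longrightarrow> annihilated n (\<lambda>v. c * f v) \<longleftrightarrow> annihilated n f"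
  unfolding annihilated_def by (simp add: mult.left_commute flip: sum_distrib_left)

lemma annihilated_diff: "annihilated n f \<Longrightarrow> annihilated n g \<Longrightarrow> annihilated n (\<lambda>v. f v - g v)"
  using annihilated_add[of n f "\<lambda>v. (- 1) * g v"] annihilated_cmult[of n g "- 1"] by simp

text \<open>Increasing enumeration of the indices other than \<open>c\<close>. For
  \<open>a < b\<close>, \<open>skip b (skip a i)\<close> enumerates the indices other than
  \<open>a\<close> and \<open>b\<close>; in the opposite order it would leave out \<open>a\<close>
  and \<open>b + 1\<close>.\<close>

definition skip :: "nat \<Rightarrow> nat \<Rightarrow> nat" where
  "skip c i = (if i < c then i else Suc i)"

lemma map_nth_Cons_skip_Suc:
  assumes "0 < n"
  shows "map (\<lambda>i. (x # xs) ! skip (Suc c) (f i)) [0..<n] =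
    (x # xs) ! skip (Suc c) (f 0) # map (\<lambda>i. (x # xs) ! skip (Suc c) (f (Suc i))) [0..<n - 1]"
  using assms by (cases n) (simp_all add: upt_conv_Cons map_Suc_upt[symmetric] del: upt_Suc)

text \<open>Turns the recursion into a sum over the deleted position, the form to which
  \<open>annihilated_embed\<close> applies.\<close>

lemma wedge_one_conv_sum:
  "wedge_one \<phi> G v = (\<Sum>c<length v. (- 1) ^ c * \<phi> (v ! c) * G (map (\<lambda>i. v ! skip c i) [0..<length v - 1]))"
proof (induction v arbitrary: G)
  case (Cons x xs)
  have "map (\<lambda>i. (x # xs) ! skip (Suc c) i) [0..<length xs] =
      x # map (\<lambda>i. xs ! skip c i) [0..<length xs - 1]" if "c < length xs" for c
    using that by (subst map_nth_Cons_skip_Suc) (auto simp: skip_def)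
  then show ?case
    unfolding wedge_one.simps Cons.IH
    by (simp add: sum.lessThan_Suc_shift skip_def map_nth sum_negf del: sum.lessThan_Suc)
qed simp

text \<open>The sign moves entry \<open>a\<close> to the front and entry \<open>b\<close> right
  behind it, in \<open>a + (b - 1)\<close> steps; the exponent \<open>a + b + 1\<close> has the same
  parity and avoids a subtraction.\<close>

lemma wedge_two_conv_sum:
  "wedge_two Q G v = (\<Sum>a<length v. \<Sum>b<length v. if a < b then (- 1) ^ (a + b + 1) * Q (v ! a) (v ! b) *
     G (map (\<lambda>i. v ! skip b (skip a i)) [0..<length v - 2]) else 0)"
proof (induction v arbitrary: G)
  case (Cons x xs)
  define T where "T = (\<lambda>a b. if a < b then (- 1) ^ (a + b + 1) * Q ((x # xs) ! a) ((x # xs) ! b) *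
     G (map (\<lambda>i. (x # xs) ! skip b (skip a i)) [0..<length (x # xs) - 2]) else 0)"
  have T0: "T a 0 = 0" for a by (simp add: T_def)
  have T1: "T 0 (Suc b) = (- 1) ^ b * Q x (xs ! b) * G (map (\<lambda>i. xs ! skip b i) [0..<length xs - 1])" for b
  proof -
    have "map (\<lambda>i. (x # xs) ! skip (Suc b) (skip 0 i)) [0..<length (x # xs) - 2] =
        map (\<lambda>i. xs ! skip b i) [0..<length xs - 1]"
      by (auto simp: skip_def)
    then show ?thesis unfolding T_def by (simp only:) simp
  qed
  have T2: "T (Suc a) (Suc b) = (if a < b then (- 1) ^ (a + b + 1) * Q (xs ! a) (xs ! b) *
     G (x # map (\<lambda>i. xs ! skip b (skip a i)) [0..<length xs - 2]) else 0)" if "b < length xs" for a b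
  proof (cases "a < b")
    case True
    have "map (\<lambda>i. (x # xs) ! skip (Suc b) (skip (Suc a) i)) [0..<length (x # xs) - 2] =
      x # map (\<lambda>i. xs ! skip b (skip a i)) [0..<length xs - 2]"
      using that True by (subst map_nth_Cons_skip_Suc) (auto simp: skip_def numeral_2_eq_2)
    with True show ?thesis by (simp add: T_def)
  qed (simp add: T_def)
  have "wedge_two Q G (x # xs) = (\<Sum>b<length xs. T 0 (Suc b)) + (\<Sum>a<length xs. \<Sum>b<length xs. T (Suc a) (Suc b))"
    by (simp add: Cons.IH wedge_one_conv_sum[of _ _ xs] T1 T2)
  also have "\<dots> = (\<Sum>a<length (x # xs). \<Sum>b<length (x # xs). T a b)"
    by (simp add: sum.lessThan_Suc_shift T0 del: sum.lessThan_Suc)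
  finally show ?case by (simp only: T_def)
qed simp

lemma annihilated_wedge_one:
  assumes "annihilated n G"
  shows "annihilated (Suc n) (wedge_one \<phi> G)"
proof (rule annihilated_cong)
  show "annihilated (Suc n) (\<lambda>v. \<Sum>c<Suc n. ((- 1) ^ c * \<phi> (v ! c)) * G (map (\<lambda>i. v ! skip c i) [0..<n]))"
  proof (rule annihilated_sum, rule annihilated_embed)
    fix c assume "c \<in> {..<Suc n}"
    then have c: "c < Suc n" "c \<notin> skip c ` {..<n}" by (auto simp: skip_def)
    fix v v' :: "int list"
    assume "\<And>i. i < Suc n \<Longrightarrow> i \<notin> skip c ` {..<n} \<Longrightarrow> v ! i = v' ! i"
    with c show "(- 1) ^ c * \<phi> (v ! c) = (- 1) ^ c * \<phi> (v' ! c)" by simp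
  qed (use assms in \<open>auto simp: skip_def strict_mono_on_def\<close>)
qed (simp add: wedge_one_conv_sum)

lemma annihilated_wedge_two:
  assumes "annihilated n G"
  shows "annihilated (n + 2) (wedge_two Q G)"
proof (rule annihilated_cong)
  show "wedge_two Q G v = (\<Sum>a<n + 2. \<Sum>b<n + 2. if a < b then (- 1) ^ (a + b + 1) * Q (v ! a) (v ! b) *
     G (map (\<lambda>i. v ! skip b (skip a i)) [0..<n]) else 0)" if "length v = n + 2" for v
    unfolding wedge_two_conv_sum that diff_add_inverse2 ..
  show "annihilated (n + 2) (\<lambda>v. \<Sum>a<n + 2. \<Sum>b<n + 2. if a < b then (- 1) ^ (a + b + 1) * Q (v ! a) (v ! b) *
     G (map (\<lambda>i. v ! skip b (skip a i)) [0..<n]) else 0)"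
  proof (intro annihilated_sum)
    fix a b assume ab: "a \<in> {..<n + 2}" "b \<in> {..<n + 2}"
    show "annihilated (n + 2) (\<lambda>v. if a < b then (- 1) ^ (a + b + 1) * Q (v ! a) (v ! b) *
       G (map (\<lambda>i. v ! skip b (skip a i)) [0..<n]) else 0)"
    proof (cases "a < b")
      case True
      have n: "a \<notin> (\<lambda>i. skip b (skip a i)) ` {..<n}" "b \<notin> (\<lambda>i. skip b (skip a i)) ` {..<n}"
        using True by (auto simp: skip_def split: if_splits)
      have "annihilated (n + 2) (\<lambda>v. ((- 1) ^ (a + b + 1) * Q (v ! a) (v ! b)) *
       G (map (\<lambda>i. v ! skip b (skip a i)) [0..<n]))"
      proof (rule annihilated_embed)
        fix v v' :: "int list"
        assume "\<And>i. i < n + 2 \<Longrightarrow> i \<notin> (\<lambda>i. skip b (skip a i)) ` {..<n} \<Longrightarrow> v ! i = v' ! i"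
        from this[of a] this[of b] n ab
        show "(- 1) ^ (a + b + 1) * Q (v ! a) (v ! b) = (- 1) ^ (a + b + 1) * Q (v' ! a) (v' ! b)"
          by simp
      qed (use assms True ab in \<open>auto simp: skip_def strict_mono_on_def\<close>)
      with True show ?thesis by simp
    qed (simp add: annihilated_def)
  qed
qed

text \<open>Here the two-form is the annihilated factor, embedded at the coordinates
  \<open>a\<close> and \<open>b\<close>; the arbitrary \<open>G\<close> of the remaining entries
  takes the role of \<open>\<psi>\<close> in \<open>annihilated_embed\<close>.\<close>

lemma annihilated_wedge_two_two:
  assumes "annihilated 2 (\<lambda>l. Q (l ! 0) (l ! 1))"
  shows "annihilated n (wedge_two Q G)"
proof (rule annihilated_cong)
  show "annihilated n (\<lambda>v. \<Sum>a<n. \<Sum>b<n. if a < b then (- 1) ^ (a + b + 1) * Q (v ! a) (v ! b) *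
     G (map (\<lambda>i. v ! skip b (skip a i)) [0..<n - 2]) else 0)"
  proof (intro annihilated_sum)
    fix a b assume ab: "a \<in> {..<n}" "b \<in> {..<n}"
    show "annihilated n (\<lambda>v. if a < b then (- 1) ^ (a + b + 1) * Q (v ! a) (v ! b) *
       G (map (\<lambda>i. v ! skip b (skip a i)) [0..<n - 2]) else 0)"
    proof (cases "a < b")
      case True
      define e where "e = (\<lambda>i::nat. if i = 0 then a else b)"
      have "{..<2::nat} = {0, 1}" by auto
      then have e: "e ` {..<2} = {a, b}" by (auto simp: e_def)
      have "annihilated n (\<lambda>v. ((- 1) ^ (a + b + 1) * G (map (\<lambda>i. v ! skip b (skip a i)) [0..<n - 2])) *
          (\<lambda>l. Q (l ! 0) (l ! 1)) (map (\<lambda>i. v ! e i) [0..<2]))"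
      proof (rule annihilated_embed)
        fix v v' :: "int list"
        assume *: "\<And>i. i < n \<Longrightarrow> i \<notin> e ` {..<2} \<Longrightarrow> v ! i = v' ! i"
        have "map (\<lambda>i. v ! skip b (skip a i)) [0..<n - 2] = map (\<lambda>i. v' ! skip b (skip a i)) [0..<n - 2]"
          using True ab by (auto simp: e_def skip_def intro!: * split: if_splits)
        then show "(- 1) ^ (a + b + 1) * G (map (\<lambda>i. v ! skip b (skip a i)) [0..<n - 2]) =
            (- 1) ^ (a + b + 1) * G (map (\<lambda>i. v' ! skip b (skip a i)) [0..<n - 2])"
          by (simp only:)
      qed (use assms True ab in \<open>auto simp: e_def strict_mono_on_def\<close>)
      with True show ?thesis by (simp add: e_def mult_ac)
    qed (simp add: annihilated_def)
  qed
qed (auto simp: wedge_two_conv_sum cong: if_cong)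

text \<open>The eight summands belong to the subsets of the three roots 2e_1, e_1 + e_2 and
  2e_2.\<close>

lemma annihilated_two_iff:
  "annihilated 2 (\<lambda>l. Q (l ! 0) (l ! 1)) \<longleftrightarrow>
    (\<forall>x y. Q x y - Q (x - 2) y - Q x (y - 2) - Q (x - 1) (y - 1)
       + Q (x - 2) (y - 2) + Q (x - 3) (y - 1) + Q (x - 1) (y - 3) - Q (x - 3) (y - 3) = 0)"
proof -
  have p: "pplus 2 = {(0, 0), (0, 1), (1, 1)}"
    by (auto simp: pplus_def less_2_cases_iff)
  have s: "(\<forall>u::int list. length u = 2 \<longrightarrow> P (u ! 0) (u ! 1)) \<longleftrightarrow> (\<forall>x y. P x y)" for P
    by (metis One_nat_def length_Cons list.size(3) nth_Cons_0 nth_Cons_Suc numeral_2_eq_2)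
  have v: "sub_roots 2 S u ! m = u ! m - (\<Sum>(i, j)\<in>S. (if m = i then 1 else 0) + (if m = j then 1 else 0))"
    if "m < 2" for S and u :: "int list" and m
    using that by (simp add: sub_roots_def)
  show ?thesis
    unfolding annihilated_def p
    by (subst s[symmetric]) (simp add: v sum_Pow_insert algebra_simps card_insert_if)
qed

section \<open>Chains of alternating colours\<close>

text \<open>The twist below the threshold absorbs the parity jump between large and small entries
  that the block and the two sign choices create; \<open>alternates_colours_iff\<close> shows why it
  is this one.\<close>

definition colour :: "int \<Rightarrow> bool \<Rightarrow> int \<Rightarrow> bool" where
  "colour K tw x \<longleftrightarrow> (if K \<le> x then even x else even x \<noteq> tw)"

definition colour_form :: "int \<Rightarrow> bool \<Rightarrow> int \<Rightarrow> int \<Rightarrow> int" where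
  "colour_form K tw x y = sg x y * of_bool (colour K tw x \<noteq> colour K tw y)"

text \<open>The value on the empty list is 2, which keeps the expansion \<open>wedge_two_chain\<close> valid in length 2.\<close>
definition chain :: "int \<Rightarrow> bool \<Rightarrow> int list \<Rightarrow> int" where
  "chain K tw = alt_ext (\<lambda>v. of_bool (alternates True (map (colour K tw) v)) + of_bool (alternates False (map (colour K tw) v)))"

definition nbig :: "int \<Rightarrow> int list \<Rightarrow> int" where
  "nbig K v = int (length (filter (\<lambda>x. K \<le> x) v))"

lemma nbig_simps [simp]:
  "nbig K [] = 0" "nbig K (x # xs) = of_bool (K \<le> x) + nbig K xs"
  by (auto simp: nbig_def)

text \<open>On strictly decreasing lists the forms in question see the entries only through
  \<open>c\<close>, so the sum over deleted positions can be computed on words of colours.\<close>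

lemma wedge_one_map:
  assumes "sorted_wrt (>) v"
    and "\<And>x. x \<in> set v \<Longrightarrow> \<phi> x = \<phi>' (c x)"
    and "\<And>l. sorted_wrt (>) l \<Longrightarrow> set l \<subseteq> set v \<Longrightarrow> G l = G' (map c l)"
  shows "wedge_one \<phi> G v = wedge_one \<phi>' G' (map c v)"
  using assms
proof (induction v arbitrary: G G')
  case (Cons x xs)
  have "wedge_one \<phi> (\<lambda>l. G (x # l)) xs = wedge_one \<phi>' (\<lambda>l. G' (c x # l)) (map c xs)"
  proof (rule Cons.IH)
    fix l assume l: "sorted_wrt (>) l" "set l \<subseteq> set xs"
    with Cons.prems(1) have "sorted_wrt (>) (x # l)" by auto
    then show "G (x # l) = G' (c x # map c l)"
      using Cons.prems(3)[of "x # l"] l by (simp add: subset_insertI2)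
  qed (use Cons.prems in auto)
  with Cons.prems show ?case by auto
qed simp

lemma wedge_two_map:
  assumes "sorted_wrt (>) v"
    and "\<And>x y. x > y \<Longrightarrow> Q x y = Q' (c x) (c y)"
    and "\<And>l. sorted_wrt (>) l \<Longrightarrow> set l \<subseteq> set v \<Longrightarrow> G l = G' (map c l)"
  shows "wedge_two Q G v = wedge_two Q' G' (map c v)"
  using assms
proof (induction v arbitrary: G G')
  case (Cons x xs)
  have "wedge_two Q (\<lambda>l. G (x # l)) xs = wedge_two Q' (\<lambda>l. G' (c x # l)) (map c xs)"
  proof (rule Cons.IH)
    fix l assume l: "sorted_wrt (>) l" "set l \<subseteq> set xs"
    with Cons.prems(1) have "sorted_wrt (>) (x # l)" by auto
    then show "G (x # l) = G' (c x # map c l)"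
      using Cons.prems(3)[of "x # l"] l by (simp add: subset_insertI2)
  qed (use Cons.prems in auto)
  moreover have "wedge_one (Q x) G xs = wedge_one (Q' (c x)) G' (map c xs)"
    by (rule wedge_one_map) (use Cons.prems in \<open>auto simp: subset_insertI2\<close>)
  ultimately show ?case by simp
qed simp

lemma chain_decr:
  "sorted_wrt (>) v \<Longrightarrow>
    chain K tw v = of_bool (alternates True (map (colour K tw) v)) + of_bool (alternates False (map (colour K tw) v))"
  by (simp add: chain_def alt_ext_decr)

lemma alternating_cmult:
  assumes "alternating f"
  shows "alternating (\<lambda>v. c * f v)"
  unfolding alternating_def
proof (intro allI)
  fix xs a b ys
  show "c * f (xs @ a # b # ys) = - (c * f (xs @ b # a # ys))"
    using alternatingD[OF assms, of xs a b ys] by simp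
qed

text \<open>Both sides alternate, so strictly decreasing lists suffice. There every occurring value
  of \<open>sg\<close> is 1, and the claim is the count of \<open>wedge_two_alternates\<close> added
  up over both first colours.\<close>

lemma wedge_two_chain:
  assumes "even (length v)" "v \<noteq> []"
  shows "wedge_two (colour_form K tw) (chain K tw) v = int (length v) * chain K tw v"
proof -
  have "wedge_two (colour_form K tw) (chain K tw) v = (\<lambda>u. int (length v) * chain K tw u) v"
  proof (rule alternating_eqI[where n = "length v" and f = "wedge_two (colour_form K tw) (chain K tw)"
        and g = "\<lambda>u. int (length v) * chain K tw u"])
    show "alternating (wedge_two (colour_form K tw) (chain K tw))"
      by (rule alternating_wedge_two) (auto simp: chain_def alternating_alt_ext colour_form_def sg_def)
    show "alternating (\<lambda>u. int (length v) * chain K tw u)"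
      unfolding chain_def by (intro alternating_cmult alternating_alt_ext)
  next
    fix u :: "int list" assume u: "length u = length v" "sorted_wrt (>) u"
    let ?s = "map (colour K tw) u"
    have "wedge_two (colour_form K tw) (chain K tw) u =
        wedge_two (\<lambda>x y. of_bool (x \<noteq> y)) (\<lambda>l. of_bool (alternates True l) + of_bool (alternates False l)) ?s"
      by (rule wedge_two_map) (use u in \<open>auto simp: colour_form_def sg_def chain_decr\<close>)
    also have "\<dots> = int (length v) * (of_bool (alternates True ?s) + of_bool (alternates False ?s))"
      using assms u(1) unfolding wedge_two_add
      by (subst (1 2) wedge_two_alternates) (auto simp: algebra_simps)
    finally show "wedge_two (colour_form K tw) (chain K tw) u = int (length v) * chain K tw u"
      using u(2) by (simp add: chain_decr)
  qed simp
  then show ?thesis .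
qed

lemma wedge_one_nbig:
  "of_bool (nbig K v = r) * wedge_one \<phi> G v =
    wedge_one (\<lambda>x. of_bool (K \<le> x) * \<phi> x) (\<lambda>l. of_bool (nbig K l = r - 1) * G l) v
    + wedge_one (\<lambda>x. of_bool (x < K) * \<phi> x) (\<lambda>l. of_bool (nbig K l = r) * G l) v"
proof (induction v arbitrary: G r)
  case (Cons x xs)
  show ?case
    using Cons.IH[of "r - of_bool (K \<le> x)" "\<lambda>l. G (x # l)"]
    by (cases "K \<le> x") (auto simp: algebra_simps of_bool_def)
qed simp

text \<open>Sorts the terms by the pair fed to the form: two large entries, two small ones, or a
  mixed pair. This fixes how many large entries are left for \<open>G\<close>.\<close>

lemma wedge_two_nbig:
  "of_bool (nbig K v = r) * wedge_two Q G v =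
    wedge_two (\<lambda>x y. of_bool (K \<le> x \<and> K \<le> y) * Q x y) (\<lambda>l. of_bool (nbig K l = r - 2) * G l) v
    + wedge_two (\<lambda>x y. of_bool (x < K \<and> y < K) * Q x y) (\<lambda>l. of_bool (nbig K l = r) * G l) v
    + wedge_two (\<lambda>x y. of_bool ((K \<le> x) \<noteq> (K \<le> y)) * Q x y) (\<lambda>l. of_bool (nbig K l = r - 1) * G l) v"
proof (induction v arbitrary: G r)
  case (Cons x xs)
  have z: "wedge_one (\<lambda>_. 0) H ys = 0" for H :: "int list \<Rightarrow> int" and ys
    by (induction ys arbitrary: H) auto
  show ?case
  proof (cases "K \<le> x")
    case True
    have e: "nbig K xs = r - 1 \<longleftrightarrow> 1 + nbig K xs = r" by auto
    have e': "1 + nbig K l = r \<longleftrightarrow> nbig K l = r - 1" "1 + nbig K l = r - 1 \<longleftrightarrow> nbig K l = r - 1 - 1"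
       "1 + nbig K l = r - 2 \<longleftrightarrow> nbig K l = r - 1 - 2" for l by auto
    show ?thesis
      using Cons.IH[of "r - 1" "\<lambda>l. G (x # l)"] wedge_one_nbig[of K xs "r - 1" "Q x" G] True
      by (simp add: distrib_left z e' flip: e) (simp add: not_le)
  next
    case False
    show ?thesis
      using Cons.IH[of r "\<lambda>l. G (x # l)"] wedge_one_nbig[of K xs r "Q x" G] False
      by (simp add: distrib_left z)
  qed
qed simp

text \<open>All three roots keep the parity of \<open>x - y\<close>, so the parity factor passes
  through the difference operators. What remains is a function of \<open>x\<close> alone minus a
  function of \<open>y\<close> alone; the operator of 2e_2 kills the first and that of 2e_1 the
  second.\<close>

lemma annihilated_colour_form_mixed:
  "annihilated 2 (\<lambda>l. of_bool ((K \<le> l ! 0) \<noteq> (K \<le> l ! 1)) * colour_form K tw (l ! 0) (l ! 1))"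
proof -
  let ?M = "\<lambda>x y. of_bool (even (x - y) = tw) * (of_bool (K \<le> x) - of_bool (K \<le> y))"
  have "of_bool ((K \<le> x) \<noteq> (K \<le> y)) * colour_form K tw x y = ?M x y" for x y
    by (auto simp: colour_form_def sg_def colour_def)
  moreover have "annihilated 2 (\<lambda>l. ?M (l ! 0) (l ! 1))"
    unfolding annihilated_two_iff[of ?M] by (auto simp: algebra_simps)
  ultimately show ?thesis by simp
qed

text \<open>Untwisted, the form depends on the difference of its arguments only; the twist changes it
  by forms that live on pairs separated by the threshold.\<close>
lemma annihilated_colour_form: "annihilated 2 (\<lambda>l. colour_form K tw (l ! 0) (l ! 1))"
proof -
  let ?M = "\<lambda>tw x y. of_bool ((K \<le> x) \<noteq> (K \<le> y)) * colour_form K tw x y"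
  let ?U = "\<lambda>x y. sg x y * of_bool (odd (x - y))"
  have U: "annihilated 2 (\<lambda>l. ?U (l ! 0) (l ! 1))"
    unfolding annihilated_two_iff[of ?U] by (auto simp: sg_def)
  have "colour_form K tw x y = ?U x y + ?M tw x y - ?M False x y" for x y
    by (auto simp: colour_form_def colour_def)
  then show ?thesis
    by (intro annihilated_cong[OF _ annihilated_diff[OF annihilated_add[OF U annihilated_colour_form_mixed[of K tw]]
          annihilated_colour_form_mixed[of K False]]])
qed

text \<open>By \<open>wedge_two_chain\<close>, \<open>n\<close> times the function is an exterior
  multiple of the annihilated form, and the nonzero integer \<open>n\<close> can be
  cancelled.\<close>

lemma annihilated_chain:
  assumes "even n" "0 < n"
  shows "annihilated n (chain K tw)"
proof -
  have "annihilated n (\<lambda>v. int n * chain K tw v)"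
    by (rule annihilated_cong[OF _ annihilated_wedge_two_two[OF annihilated_colour_form[of K tw], of n "chain K tw"]])
       (use assms wedge_two_chain in auto)
  with assms show ?thesis by (simp add: annihilated_cmult_iff)
qed

text \<open>Restrict the expansion of \<open>wedge_two_chain\<close> to lists with \<open>r\<close>
  large entries. A pair on one side of \<open>K\<close> leaves \<open>r - 2\<close> or
  \<open>r\<close> large entries, again an odd number, so the induction hypothesis applies to the
  cofactor. For mixed pairs the form itself is annihilated, whatever the cofactor.\<close>

lemma annihilated_chain_odd:
  assumes "odd r"
  shows "annihilated (2 * j) (\<lambda>v. of_bool (nbig K v = r) * chain K tw v)"
  using assms
proof (induction j arbitrary: r)
  case 0
  \<comment> \<open>The empty list has no large entry, so an odd \<open>r\<close> gives the zero
    function here, although \<open>chain\<close> is 2.\<close>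
  then show ?case by (auto simp: annihilated_def sub_roots_def)
next
  case (Suc j)
  have "annihilated (2 * Suc j) (\<lambda>v. int (2 * Suc j) * (of_bool (nbig K v = r) * chain K tw v))"
  proof (rule annihilated_cong)
    let ?Q = "colour_form K tw" and ?F = "\<lambda>r v. of_bool (nbig K v = r) * chain K tw v"
    let ?W = "\<lambda>v. wedge_two (\<lambda>x y. of_bool (K \<le> x \<and> K \<le> y) * ?Q x y) (?F (r - 2)) v
      + wedge_two (\<lambda>x y. of_bool (x < K \<and> y < K) * ?Q x y) (?F r) v
      + wedge_two (\<lambda>x y. of_bool ((K \<le> x) \<noteq> (K \<le> y)) * ?Q x y) (?F (r - 1)) v"
    show "annihilated (2 * Suc j) ?W"
      using annihilated_wedge_two[OF Suc.IH[of "r - 2"]] annihilated_wedge_two[OF Suc.IH[of r]] Suc.prems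
      by (intro annihilated_add annihilated_wedge_two_two[OF annihilated_colour_form_mixed]) auto
    show "int (2 * Suc j) * (of_bool (nbig K v = r) * chain K tw v) = ?W v" if "length v = 2 * Suc j" for v
    proof -
      have "v \<noteq> []" using that by auto
      then show ?thesis
        unfolding wedge_two_nbig[symmetric] using wedge_two_chain[of v K tw] that by (simp add: algebra_simps)
    qed
  qed
  then show ?case by (subst (asm) annihilated_cmult_iff) auto
qed

lemma annihilated_chain_even:
  assumes "even n" "0 < n"
  shows "annihilated n (\<lambda>v. of_bool (even (nbig K v)) * chain K tw v)"
proof (rule annihilated_cong)
  obtain j where j: "n = 2 * j" using assms by auto
  show "annihilated n (\<lambda>v. chain K tw v - (\<Sum>r\<in>{r. odd r \<and> 0 \<le> r \<and> r \<le> int n}. of_bool (nbig K v = r) * chain K tw v))"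
    by (intro annihilated_diff annihilated_sum annihilated_chain assms) (use annihilated_chain_odd j in auto)
  fix v :: "int list" assume "length v = n"
  then have "nbig K v \<in> {0..int n}"
    unfolding nbig_def using length_filter_le[of "\<lambda>x. K \<le> x" v] by simp
  moreover have "finite {r::int. odd r \<and> 0 \<le> r \<and> r \<le> int n}"
    by (rule finite_subset[of _ "{0..int n}"]) auto
  ultimately show "of_bool (even (nbig K v)) * chain K tw v =
    chain K tw v - (\<Sum>r\<in>{r. odd r \<and> 0 \<le> r \<and> r \<le> int n}. of_bool (nbig K v = r) * chain K tw v)"
    by (simp add: of_bool_def if_distrib[of "\<lambda>x. x * _"] cong: if_cong)
qed

text \<open>Inserts the entries from \<open>K\<close> to \<open>K + i - 1\<close> by one-forms that
  are indicators of single integers, so that \<open>annihilated_wedge_one\<close> carries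
  annihilation over to \<open>i\<close> more variables.\<close>

fun wedge_block :: "int \<Rightarrow> nat \<Rightarrow> (int list \<Rightarrow> int) \<Rightarrow> int list \<Rightarrow> int" where
  "wedge_block K 0 F = F"
| "wedge_block K (Suc i) F = wedge_one (\<lambda>x. of_bool (x = K + int i)) (wedge_block K i F)"

lemma alternating_wedge_block: "alternating F \<Longrightarrow> alternating (wedge_block K i F)"
  by (induction i) (auto intro: alternating_wedge_one)

lemma annihilated_wedge_block: "annihilated n F \<Longrightarrow> annihilated (n + i) (wedge_block K i F)"
  by (induction i) (auto intro: annihilated_wedge_one)

lemma wedge_one_delta_decr:
  fixes a :: int
  assumes "sorted_wrt (>) v"
  shows "wedge_one (\<lambda>x. of_bool (x = a)) G v =
    (if a \<in> set v then (- 1) ^ length (filter (\<lambda>x. a < x) v) * G (filter (\<lambda>x. x \<noteq> a) v) else 0)"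
  using assms
proof (induction v arbitrary: G)
  case (Cons x xs)
  then have *: "\<forall>y\<in>set xs. y < x" by simp
  then have "filter (\<lambda>x. a < x) xs = [] \<and> filter (\<lambda>x. x \<noteq> a) xs = xs" if "x = a"
    using that by (auto simp: filter_empty_conv filter_id_conv)
  with Cons * show ?case by auto
qed simp

text \<open>The block entries are removed from the largest down. At its removal, each has exactly
  the entries beyond the block in front of it, whence the sign.\<close>

lemma wedge_block_decr:
  assumes "sorted_wrt (>) v"
  shows "wedge_block K i F v = (if {K..<K + int i} \<subseteq> set v
     then (- 1) ^ (i * length (filter (\<lambda>x. K + int i \<le> x) v)) * F (filter (\<lambda>x. x \<notin> {K..<K + int i}) v) else 0)"
  using assms
proof (induction i arbitrary: v)
  case (Suc i)
  let ?a = "K + int i"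
  define w where "w = filter (\<lambda>x. x \<noteq> ?a) v"
  have w: "sorted_wrt (>) w" unfolding w_def using Suc.prems by (rule sorted_wrt_filter)
  have 1: "{K..<K + int (Suc i)} \<subseteq> set v \<longleftrightarrow> ?a \<in> set v \<and> {K..<K + int i} \<subseteq> set w"
  proof -
    have "{K..<K + int (Suc i)} = insert ?a {K..<K + int i}" by auto
    then show ?thesis unfolding w_def by auto
  qed
  have 2: "filter (\<lambda>x. x \<notin> {K..<K + int i}) w = filter (\<lambda>x. x \<notin> {K..<K + int (Suc i)}) v"
    unfolding w_def filter_filter by (rule filter_cong) auto
  have 3: "filter (\<lambda>x. K + int i \<le> x) w = filter (\<lambda>x. ?a < x) v"
    unfolding w_def filter_filter by (rule filter_cong) auto
  have 4: "filter (\<lambda>x. K + int (Suc i) \<le> x) v = filter (\<lambda>x. ?a < x) v"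
    by (rule filter_cong) auto
  show ?case
    unfolding wedge_block.simps wedge_one_delta_decr[OF Suc.prems] w_def[symmetric] Suc.IH[OF w] 1 2 3 4
    by (simp add: power_add)
qed simp

section \<open>The Weyl character formula for tableaux\<close>

text \<open>The numerator of the bialternant formula in the variables \<open>X\<close>; for the
  exponents \<open>m - 1 - i\<close> it is the Vandermonde determinant.\<close>

definition adet :: "nat \<Rightarrow> (nat \<Rightarrow> nat) \<Rightarrow> (nat \<Rightarrow> 'a::comm_ring_1) \<Rightarrow> 'a" where
  "adet m l X = det (mat m m (\<lambda>(i, j). X j ^ l i))"

lemma adet_conv_sum:
  "adet m l X = (\<Sum>p | p permutes {0..<m}. signof p * (\<Prod>i=0..<m. X (p i) ^ l i))"
proof -
  have "(\<Prod>i=0..<m. mat m m (\<lambda>(i, j). X j ^ l i) $$ (i, p i)) = (\<Prod>i=0..<m. X (p i) ^ l i)"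
    if "p permutes {0..<m}" for p
    by (rule prod.cong) (use permutes_in_image[OF that] in auto)
  then show ?thesis
    unfolding adet_def by (subst det_def'[of _ m]) auto
qed

text \<open>The summation range from \<open>b\<close> to \<open>a\<close> will be the range of one
  row length in an interlacing shape.\<close>

lemma geometric_sum_shifted:
  fixes x y :: "'a::comm_ring_1"
  assumes "b \<le> a"
  shows "(x - y) * (\<Sum>k=b..a. y ^ (a - k) * x ^ (k + c)) = x ^ (a + 1 + c) - y ^ (a + 1 - b) * x ^ (b + c)"
  using assms
proof (induction a rule: dec_induct)
  case base
  then show ?case by (simp add: algebra_simps)
next
  case (step a)
  have "(\<Sum>k=b..a. y ^ (Suc a - k) * x ^ (k + c)) = y * (\<Sum>k=b..a. y ^ (a - k) * x ^ (k + c))"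
    unfolding sum_distrib_left by (rule sum.cong) (auto simp: Suc_diff_le)
  then have e: "(x - y) * (\<Sum>k=b..Suc a. y ^ (Suc a - k) * x ^ (k + c)) =
      y * ((x - y) * (\<Sum>k=b..a. y ^ (a - k) * x ^ (k + c))) + (x - y) * x ^ (Suc a + c)"
    using step.hyps by (simp add: distrib_left mult.left_commute)
  show ?case
    unfolding e step.IH using step.hyps by (simp add: Suc_diff_le algebra_simps)
qed

text \<open>From each row subtract the multiple of the next one that clears its entry in the last
  column. Only \<open>X m ^ l m\<close> in the corner is left there; the matrix \<open>U\<close> of
  these operations has determinant 1.\<close>

lemma adet_row_reduce:
  fixes X :: "nat \<Rightarrow> 'a::comm_ring_1"
  assumes "\<And>i. i < m \<Longrightarrow> l (Suc i) \<le> l i"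
  shows "adet (Suc m) l X =
    det (mat m m (\<lambda>(i, j). X j ^ l i - X m ^ (l i - l (Suc i)) * X j ^ l (Suc i))) * X m ^ l m"
proof -
  define M where "M = mat (Suc m) (Suc m) (\<lambda>(i, j). X j ^ l i)"
  define U where "U = mat (Suc m) (Suc m)
    (\<lambda>(i, j). if i = j then 1 else if j = Suc i then - (X m ^ (l i - l (Suc i))) else 0)"
  define A1 where "A1 = mat m m (\<lambda>(i, j). X j ^ l i - X m ^ (l i - l (Suc i)) * X j ^ l (Suc i))"
  define A3 where "A3 = mat 1 m (\<lambda>(i, j). X j ^ l m)"
  define A4 where "A4 = mat 1 1 (\<lambda>(i, j). X m ^ l m)"
  have carr: "M \<in> carrier_mat (Suc m) (Suc m)" "U \<in> carrier_mat (Suc m) (Suc m)"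
    "A1 \<in> carrier_mat m m" "A3 \<in> carrier_mat 1 m" "A4 \<in> carrier_mat 1 1"
    by (simp_all add: M_def U_def A1_def A3_def A4_def)
  have "det U = 1"
  proof -
    have "det U = prod_list (diag_mat U)"
      by (rule det_upper_triangular) (auto simp: U_def)
    also have "diag_mat U = replicate (Suc m) 1"
      by (rule nth_equalityI) (auto simp: diag_mat_def U_def simp del: upt_Suc replicate_Suc)
    finally show ?thesis by simp
  qed
  have UM: "(U * M) $$ (i, j) = X j ^ l i - (if i < m then X m ^ (l i - l (Suc i)) * X j ^ l (Suc i) else 0)"
    if ij: "i < Suc m" "j < Suc m" for i j
  proof -
    have "(U * M) $$ (i, j) = (\<Sum>k=0..<Suc m. U $$ (i, k) * M $$ (k, j))"
      using ij by (simp add: M_def U_def scalar_prod_def)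
    also have "\<dots> = (\<Sum>k=0..<Suc m. (if k = i then X j ^ l i else 0) +
        (if k = Suc i then - (X m ^ (l i - l (Suc i)) * X j ^ l (Suc i)) else 0))"
      using ij by (intro sum.cong) (auto simp: U_def M_def)
    also have "\<dots> = X j ^ l i - (if i < m then X m ^ (l i - l (Suc i)) * X j ^ l (Suc i) else 0)"
      using ij by (simp add: sum.distrib del: sum.op_ivl_Suc)
    finally show ?thesis .
  qed
  have "U * M = four_block_mat A1 (0\<^sub>m m 1) A3 A4"
  proof (rule eq_matI)
    fix i j
    assume "i < dim_row (four_block_mat A1 (0\<^sub>m m 1) A3 A4)" "j < dim_col (four_block_mat A1 (0\<^sub>m m 1) A3 A4)"
    then have ij: "i < Suc m" "j < Suc m" by (auto simp: A1_def A3_def A4_def)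
    then have "X m ^ (l i - l (Suc i)) * X m ^ l (Suc i) = X m ^ l i" if "i < m"
      using assms[OF that] by (simp flip: power_add)
    with ij show "(U * M) $$ (i, j) = four_block_mat A1 (0\<^sub>m m 1) A3 A4 $$ (i, j)"
      unfolding UM[OF ij]
      by (cases "i < m"; cases "j < m") (auto simp: A1_def A3_def A4_def less_Suc_eq)
  qed (auto simp: M_def U_def A1_def A3_def A4_def)
  then have "det (U * M) = det A1 * det A4"
    by (simp only:) (rule det_four_block_mat_upper_right_zero_col[OF carr(3) refl carr(4,5)])
  moreover have "det (U * M) = adet (Suc m) l X"
    using \<open>det U = 1\<close> by (simp add: det_mult[OF carr(2,1)]) (simp add: adet_def M_def)
  ultimately show ?thesis
    by (simp add: A4_def A1_def det_single)
qed

text \<open>After the row reduction \<open>X j - X m\<close> splits off from column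
  \<open>j\<close>, and the entries become geometric sums. Expanding the rows gives one smaller
  determinant for each \<open>\<mu>\<close> that interlaces \<open>sh\<close>: the recursion that
  tableaux satisfy as well.\<close>

lemma adet_branch:
  fixes X :: "nat \<Rightarrow> 'a::comm_ring_1"
  assumes anti: "\<And>i. i < m \<Longrightarrow> sh (Suc i) \<le> sh i"
  shows "adet (Suc m) (\<lambda>i. sh i + (m - i)) X = (\<Prod>j=0..<m. X j - X m) * (X m ^ sh m *
    (\<Sum>\<mu>\<in>PiE {0..<m} (\<lambda>i. {sh (Suc i)..sh i}). (\<Prod>i=0..<m. X m ^ (sh i - \<mu> i)) *
       adet m (\<lambda>i. \<mu> i + (m - 1 - i)) X))"
proof -
  define l where "l = (\<lambda>i. sh i + (m - i))"
  let ?P = "PiE {0..<m} (\<lambda>i. {sh (Suc i)..sh i})"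
  let ?S = "\<lambda>i x. \<Sum>k=sh (Suc i)..sh i. X m ^ (sh i - k) * x ^ (k + (m - 1 - i))"
  let ?A = "mat m m (\<lambda>(i, j). X j ^ l i - X m ^ (l i - l (Suc i)) * X j ^ l (Suc i))"
  have l: "l (Suc i) \<le> l i" if "i < m" for i
    using anti[OF that] by (simp add: l_def)
  have entry: "X j ^ l i - X m ^ (l i - l (Suc i)) * X j ^ l (Suc i) = (X j - X m) * ?S i (X j)"
    if "i < m" for i j
  proof -
    have e: "l i = sh i + 1 + (m - 1 - i)" "l i - l (Suc i) = sh i + 1 - sh (Suc i)"
      "l (Suc i) = sh (Suc i) + (m - 1 - i)"
      using that anti[OF that] by (auto simp: l_def)
    show ?thesis
      unfolding geometric_sum_shifted[OF anti[OF that]] e(2) by (simp only: e(1,3))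
  qed
  have "det ?A = (\<Sum>p | p permutes {0..<m}. signof p * (\<Prod>i=0..<m. (X (p i) - X m) * ?S i (X (p i))))"
    unfolding det_def'[OF mat_carrier[of m m]]
  proof (rule sum.cong, goal_cases)
    case (2 p)
    then have p: "p permutes {0..<m}" by simp
    have "(\<Prod>i=0..<m. ?A $$ (i, p i)) = (\<Prod>i=0..<m. (X (p i) - X m) * ?S i (X (p i)))"
      by (rule prod.cong) (use permutes_in_image[OF p] entry in auto)
    then show ?case by (rule arg_cong)
  qed simp
  also have "\<dots> = (\<Sum>p | p permutes {0..<m}. signof p * ((\<Prod>j=0..<m. X j - X m) *
      (\<Sum>\<mu>\<in>?P. (\<Prod>i=0..<m. X m ^ (sh i - \<mu> i)) * (\<Prod>i=0..<m. X (p i) ^ (\<mu> i + (m - 1 - i))))))"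
  proof (rule sum.cong, goal_cases)
    case (2 p)
    then have p: "p permutes {0..<m}" by simp
    have 1: "(\<Prod>i=0..<m. X (p i) - X m) = (\<Prod>j=0..<m. X j - X m)"
      using prod.permute[OF p, of "\<lambda>j. X j - X m"] by (simp add: o_def)
    have 2: "(\<Prod>i=0..<m. ?S i (X (p i))) =
      (\<Sum>\<mu>\<in>?P. \<Prod>i=0..<m. X m ^ (sh i - \<mu> i) * X (p i) ^ (\<mu> i + (m - 1 - i)))"
      by (rule prod_sum_PiE) auto
    show ?case by (simp only: prod.distrib 1 2)
  qed simp
  also have "\<dots> = (\<Prod>j=0..<m. X j - X m) * (\<Sum>\<mu>\<in>?P. (\<Prod>i=0..<m. X m ^ (sh i - \<mu> i)) *
       adet m (\<lambda>i. \<mu> i + (m - 1 - i)) X)"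
    unfolding adet_conv_sum sum_distrib_left
    by (subst sum.swap) (simp add: mult_ac)
  finally have "det ?A = \<dots>" .
  moreover have "adet (Suc m) l X = det ?A * X m ^ l m"
    by (rule adet_row_reduce) (rule l)
  moreover have "l m = sh m" by (simp add: l_def)
  ultimately show ?thesis
    unfolding l_def[symmetric] by (simp only:) (simp only: mult_ac)
qed

section \<open>Semistandard tableaux and the removal of the largest letter\<close>

definition shape :: "nat \<Rightarrow> (nat \<Rightarrow> nat) \<Rightarrow> (nat \<times> nat) set" where
  "shape m sh = {(i, j). i < m \<and> j < sh i}"

definition tableaux :: "nat \<Rightarrow> (nat \<Rightarrow> nat) \<Rightarrow> (nat \<times> nat \<Rightarrow> nat) set" where
  "tableaux m sh = {T. (\<forall>x. x \<notin> shape m sh \<longrightarrow> T x = 0) \<and> (\<forall>x\<in>shape m sh. T x < m) \<and>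
      (\<forall>i j. (i, Suc j) \<in> shape m sh \<longrightarrow> T (i, j) \<le> T (i, Suc j)) \<and>
      (\<forall>i j. (Suc i, j) \<in> shape m sh \<longrightarrow> T (i, j) < T (Suc i, j))}"

definition schur :: "nat \<Rightarrow> (nat \<Rightarrow> nat) \<Rightarrow> (nat \<Rightarrow> 'a::comm_ring_1) \<Rightarrow> 'a" where
  "schur m sh X = (\<Sum>T\<in>tableaux m sh. \<Prod>x\<in>shape m sh. X (T x))"

lemma shape_eq_Sigma: "shape m sh = Sigma {0..<m} (\<lambda>i. {0..<sh i})"
  by (auto simp: shape_def)

lemma finite_shape [simp]: "finite (shape m sh)"
  by (simp add: shape_eq_Sigma)

lemma card_shape: "card (shape m sh) = (\<Sum>i=0..<m. sh i)"
  by (simp add: shape_eq_Sigma)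

lemma finite_tableaux: "finite (tableaux m sh)"
proof (rule finite_subset)
  show "tableaux m sh \<subseteq> {T. \<forall>x. (x \<in> shape m sh \<longrightarrow> T x \<in> {..<m}) \<and> (x \<notin> shape m sh \<longrightarrow> T x = 0)}"
    by (auto simp: tableaux_def)
  show "finite {T. \<forall>x. (x \<in> shape m sh \<longrightarrow> T x \<in> {..<m}) \<and> (x \<notin> shape m sh \<longrightarrow> T x = 0)}"
    by (rule finite_set_of_finite_funs) auto
qed

lemma downward_closed_eq_lessThan:
  fixes A :: "nat set"
  assumes "finite A" "\<And>x y. x \<in> A \<Longrightarrow> y \<le> x \<Longrightarrow> y \<in> A"
  shows "A = {..<card A}"
proof (cases "A = {}")
  case False
  have "x \<in> A \<longleftrightarrow> x < Suc (Max A)" for x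
    using assms(2)[OF Max_in[OF assms(1) False], of x] Max_ge[OF assms(1), of x] by (auto simp: less_Suc_eq_le)
  then obtain n where "A = {..<n}" by (metis lessThan_iff subsetI subset_antisym)
  then show ?thesis by simp
qed simp

definition glue :: "nat \<Rightarrow> (nat \<Rightarrow> nat) \<Rightarrow> (nat \<Rightarrow> nat) \<Rightarrow> (nat \<times> nat \<Rightarrow> nat) \<Rightarrow> nat \<times> nat \<Rightarrow> nat" where
  "glue m sh \<mu> T x = (if x \<in> shape m \<mu> then T x else if x \<in> shape (Suc m) sh then m else 0)"

text \<open>Restricted to \<open>{0..<m}\<close> so that it is an element of the \<open>PiE\<close>
  over which the branching sum runs.\<close>

definition inner_shape :: "nat \<Rightarrow> (nat \<Rightarrow> nat) \<Rightarrow> (nat \<times> nat \<Rightarrow> nat) \<Rightarrow> nat \<Rightarrow> nat" where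
  "inner_shape m sh T = (\<lambda>i\<in>{0..<m}. card {j. j < sh i \<and> T (i, j) < m})"

definition inner_tab :: "nat \<Rightarrow> (nat \<times> nat \<Rightarrow> nat) \<Rightarrow> nat \<times> nat \<Rightarrow> nat" where
  "inner_tab m T x = (if T x < m then T x else 0)"

lemma tableaux_outside: "T \<in> tableaux m sh \<Longrightarrow> x \<notin> shape m sh \<Longrightarrow> T x = 0"
  unfolding tableaux_def by blast

lemma tableaux_less: "T \<in> tableaux m sh \<Longrightarrow> x \<in> shape m sh \<Longrightarrow> T x < m"
  unfolding tableaux_def by blast

text \<open>Columns increase strictly from a first entry at least 0. With letters up to
  \<open>m\<close>, row \<open>m\<close> therefore contains only the letter \<open>m\<close> and
  disappears with it.\<close>

lemma tableaux_ge_row: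
  assumes "T \<in> tableaux m sh" "\<And>i. Suc i < m \<Longrightarrow> sh (Suc i) \<le> sh i" "(i, j) \<in> shape m sh"
  shows "i \<le> T (i, j)"
  using assms(3)
proof (induction i)
  case (Suc i)
  then have "(i, j) \<in> shape m sh" using assms(2)[of i] by (auto simp: shape_def)
  with Suc assms(1) show ?case by (fastforce simp: tableaux_def)
qed simp

lemma tableaux_row_mono:
  assumes "T \<in> tableaux m sh" "j \<le> j'" "(i, j') \<in> shape m sh"
  shows "T (i, j) \<le> T (i, j')"
  using assms(2,3)
proof (induction j' rule: dec_induct)
  case (step k)
  then have "(i, k) \<in> shape m sh" by (auto simp: shape_def)
  with step assms(1) have "T (i, j) \<le> T (i, k)" "T (i, k) \<le> T (i, Suc k)" by (auto simp: tableaux_def)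
  then show ?case by simp
qed simp

context
  fixes m :: nat and sh :: "nat \<Rightarrow> nat"
  assumes anti: "\<And>i. i < m \<Longrightarrow> sh (Suc i) \<le> sh i"
begin

text \<open>Rows increase weakly, so the letters below \<open>m\<close> fill an initial segment of
  each row, and their number determines their cells.\<close>

lemma less_inner_shape_iff:
  assumes T: "T \<in> tableaux (Suc m) sh" and i: "i < m"
  shows "j < inner_shape m sh T i \<longleftrightarrow> j < sh i \<and> T (i, j) < m"
proof -
  let ?A = "{j. j < sh i \<and> T (i, j) < m}"
  have "?A = {..<card ?A}"
  proof (rule downward_closed_eq_lessThan)
    fix x y assume x: "x \<in> ?A" "y \<le> x"
    then have "T (i, y) \<le> T (i, x)"
      by (intro tableaux_row_mono[OF T]) (use i in \<open>auto simp: shape_def\<close>)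
    with x show "y \<in> ?A" by auto
  qed auto
  then have "j \<in> ?A \<longleftrightarrow> j < card ?A" by auto
  with i show ?thesis by (simp add: inner_shape_def)
qed

text \<open>The cells with letter \<open>m\<close> form a horizontal strip: a cell with another one
  beneath it carries a smaller letter, which gives the lower bound
  \<open>sh (Suc i)\<close>.\<close>

lemma inner_shape_in_PiE:
  assumes T: "T \<in> tableaux (Suc m) sh"
  shows "inner_shape m sh T \<in> PiE {0..<m} (\<lambda>i. {sh (Suc i)..sh i})"
proof (rule PiE_I)
  fix i assume "i \<in> {0..<m}"
  then have i: "i < m" by simp
  have "j < inner_shape m sh T i" if j: "j < sh (Suc i)" for j
  proof -
    have "(Suc i, j) \<in> shape (Suc m) sh" using i j by (auto simp: shape_def)
    with T have "T (i, j) < T (Suc i, j)" "T (Suc i, j) < Suc m" by (auto simp: tableaux_def)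
    then show ?thesis using less_inner_shape_iff[OF T i] j anti[OF i] by auto
  qed
  then have "sh (Suc i) \<le> inner_shape m sh T i" by (meson leI order.irrefl)
  moreover have "inner_shape m sh T i \<le> sh i"
    using less_inner_shape_iff[OF T i, of "sh i"] by auto
  ultimately show "inner_shape m sh T i \<in> {sh (Suc i)..sh i}" by simp
qed (simp add: inner_shape_def)

lemma shape_inner_shape_iff:
  assumes T: "T \<in> tableaux (Suc m) sh"
  shows "x \<in> shape m (inner_shape m sh T) \<longleftrightarrow> x \<in> shape (Suc m) sh \<and> T x < m"
proof (cases x)
  case (Pair i j)
  show ?thesis
  proof (cases "i < m")
    case True
    then show ?thesis using Pair less_inner_shape_iff[OF T True] by (auto simp: shape_def)
  next
    case False
    have "i \<le> T (i, j)" if "(i, j) \<in> shape (Suc m) sh"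
      by (rule tableaux_ge_row[OF T _ that]) (use anti in auto)
    with False Pair show ?thesis by (auto simp: shape_def)
  qed
qed

lemma inner_tab_in_tableaux:
  assumes T: "T \<in> tableaux (Suc m) sh"
  shows "inner_tab m T \<in> tableaux m (inner_shape m sh T)"
proof -
  note iff = shape_inner_shape_iff[OF T]
  have 1: "inner_tab m T x = 0" if "x \<notin> shape m (inner_shape m sh T)" for x
    using that tableaux_outside[OF T, of x] unfolding iff by (auto simp: inner_tab_def)
  have 2: "inner_tab m T x < m" if "x \<in> shape m (inner_shape m sh T)" for x
    using that unfolding iff by (auto simp: inner_tab_def)
  have 3: "inner_tab m T (i, j) \<le> inner_tab m T (i, Suc j)" if "(i, Suc j) \<in> shape m (inner_shape m sh T)" for i j
    using that T unfolding iff by (auto simp: inner_tab_def tableaux_def)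
  have 4: "inner_tab m T (i, j) < inner_tab m T (Suc i, j)" if "(Suc i, j) \<in> shape m (inner_shape m sh T)" for i j
  proof -
    have "T (i, j) < T (Suc i, j)" "T (Suc i, j) < m"
      using that T unfolding iff by (auto simp: tableaux_def)
    then show ?thesis by (auto simp: inner_tab_def)
  qed
  show ?thesis unfolding tableaux_def using 1 2 3 4 by blast
qed

lemma glue_inner:
  assumes T: "T \<in> tableaux (Suc m) sh"
  shows "glue m sh (inner_shape m sh T) (inner_tab m T) = T"
proof
  fix x
  show "glue m sh (inner_shape m sh T) (inner_tab m T) x = T x"
    using tableaux_less[OF T, of x] tableaux_outside[OF T, of x]
    unfolding glue_def shape_inner_shape_iff[OF T] by (auto simp: inner_tab_def)
qed

context
  fixes \<mu> T
  assumes \<mu>: "\<mu> \<in> PiE {0..<m} (\<lambda>i. {sh (Suc i)..sh i})" and T: "T \<in> tableaux m \<mu>"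
begin

lemma shape_inner_subset: "shape m \<mu> \<subseteq> shape (Suc m) sh"
proof -
  have "\<mu> i \<le> sh i" if "i < m" for i using \<mu> that by (auto simp: PiE_iff)
  then show ?thesis by (fastforce simp: shape_def)
qed

lemma glue_in_tableaux: "glue m sh \<mu> T \<in> tableaux (Suc m) sh"
proof -
  have 1: "glue m sh \<mu> T x = 0" if "x \<notin> shape (Suc m) sh" for x
    using that shape_inner_subset by (auto simp: glue_def)
  have lt: "T x < m" if "x \<in> shape m \<mu>" for x
    using T that by (auto simp: tableaux_def)
  have 2: "glue m sh \<mu> T x < Suc m" for x
    using lt[of x] by (auto simp: glue_def)
  have 3: "glue m sh \<mu> T (i, j) \<le> glue m sh \<mu> T (i, Suc j)" if "(i, Suc j) \<in> shape (Suc m) sh" for i j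
  proof (cases "(i, Suc j) \<in> shape m \<mu>")
    case True
    then have "(i, j) \<in> shape m \<mu>" by (auto simp: shape_def)
    with True T show ?thesis by (auto simp: glue_def tableaux_def)
  next
    case False
    with that 2[of "(i, j)"] show ?thesis by (simp add: glue_def[of _ _ _ _ "(i, Suc j)"])
  qed
  have 4: "glue m sh \<mu> T (i, j) < glue m sh \<mu> T (Suc i, j)" if "(Suc i, j) \<in> shape (Suc m) sh" for i j
  proof -
    have i: "i < m" "j < sh (Suc i)" using that by (auto simp: shape_def)
    with \<mu> have "sh (Suc i) \<le> \<mu> i" by (auto simp: PiE_iff)
    with i have *: "(i, j) \<in> shape m \<mu>" by (auto simp: shape_def)
    show ?thesis
    proof (cases "(Suc i, j) \<in> shape m \<mu>")
      case True
      with * T show ?thesis by (auto simp: glue_def tableaux_def)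
    next
      case False
      with * that lt[OF *] show ?thesis by (auto simp: glue_def)
    qed
  qed
  show ?thesis unfolding tableaux_def using 1 2 3 4 by blast
qed

lemma glue_less_iff: "x \<in> shape (Suc m) sh \<Longrightarrow> glue m sh \<mu> T x < m \<longleftrightarrow> x \<in> shape m \<mu>"
  using T by (auto simp: glue_def tableaux_def)

lemma inner_shape_glue: "inner_shape m sh (glue m sh \<mu> T) = \<mu>"
proof
  fix i
  show "inner_shape m sh (glue m sh \<mu> T) i = \<mu> i"
  proof (cases "i < m")
    case True
    have "\<mu> i \<le> sh i" using \<mu> True by (auto simp: PiE_iff)
    then have "{j. j < sh i \<and> glue m sh \<mu> T (i, j) < m} = {..<\<mu> i}"
      using glue_less_iff[of "(i, _)"] True by (auto simp: shape_def)
    with True show ?thesis by (simp add: inner_shape_def)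
  next
    case False
    then show ?thesis using \<mu> by (auto simp: inner_shape_def PiE_iff extensional_def)
  qed
qed

lemma inner_tab_glue: "inner_tab m (glue m sh \<mu> T) = T"
proof
  fix x
  show "inner_tab m (glue m sh \<mu> T) x = T x"
    using tableaux_less[OF T, of x] tableaux_outside[OF T, of x] by (auto simp: inner_tab_def glue_def)
qed

text \<open>The factor \<open>X m ^ sh m\<close> comes from row \<open>m\<close>, which lies outside
  \<open>\<mu>\<close>; the other powers of \<open>X m\<close> come from the ends of the rows
  above.\<close>

lemma prod_glue:
  fixes X :: "nat \<Rightarrow> 'a::comm_ring_1"
  shows "(\<Prod>x\<in>shape (Suc m) sh. X (glue m sh \<mu> T x)) =
    X m ^ sh m * ((\<Prod>i=0..<m. X m ^ (sh i - \<mu> i)) * (\<Prod>x\<in>shape m \<mu>. X (T x)))"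
proof -
  have le: "\<mu> i \<le> sh i" if "i < m" for i using \<mu> that by (auto simp: PiE_iff)
  have "(\<Prod>x\<in>shape (Suc m) sh. X (glue m sh \<mu> T x)) =
      (\<Prod>x\<in>shape (Suc m) sh - shape m \<mu>. X (glue m sh \<mu> T x)) * (\<Prod>x\<in>shape m \<mu>. X (glue m sh \<mu> T x))"
    by (rule prod.subset_diff[OF shape_inner_subset]) simp
  also have "(\<Prod>x\<in>shape m \<mu>. X (glue m sh \<mu> T x)) = (\<Prod>x\<in>shape m \<mu>. X (T x))"
    by (rule prod.cong) (auto simp: glue_def)
  also have "(\<Prod>x\<in>shape (Suc m) sh - shape m \<mu>. X (glue m sh \<mu> T x)) =
      (\<Prod>x\<in>shape (Suc m) sh - shape m \<mu>. X m)"
    by (rule prod.cong) (auto simp: glue_def)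
  also have "\<dots> = X m ^ (card (shape (Suc m) sh) - card (shape m \<mu>))"
    using shape_inner_subset by (simp add: card_Diff_subset)
  also have "card (shape (Suc m) sh) - card (shape m \<mu>) = sh m + (\<Sum>i=0..<m. sh i - \<mu> i)"
  proof -
    have "(\<Sum>i=0..<m. sh i - \<mu> i) = (\<Sum>i=0..<m. sh i) - (\<Sum>i=0..<m. \<mu> i)"
      by (rule sum_subtractf_nat) (use le in auto)
    moreover have "(\<Sum>i=0..<m. \<mu> i) \<le> (\<Sum>i=0..<m. sh i)"
      by (rule sum_mono) (use le in auto)
    ultimately show ?thesis by (simp add: card_shape)
  qed
  finally show ?thesis by (simp add: power_add power_sum mult.assoc)
qed

end

text \<open>Deleting the largest letter is a bijection onto pairs of an interlacing shape and a
  tableau of that shape. The result is the recursion of \<open>adet_branch\<close> without the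
  factors \<open>X j - X m\<close>.\<close>

lemma schur_branch:
  fixes X :: "nat \<Rightarrow> 'a::comm_ring_1"
  shows "schur (Suc m) sh X = X m ^ sh m *
    (\<Sum>\<mu>\<in>PiE {0..<m} (\<lambda>i. {sh (Suc i)..sh i}). (\<Prod>i=0..<m. X m ^ (sh i - \<mu> i)) * schur m \<mu> X)"
proof -
  let ?P = "PiE {0..<m} (\<lambda>i. {sh (Suc i)..sh i})"
  have "schur (Suc m) sh X = (\<Sum>(\<mu>, T)\<in>Sigma ?P (tableaux m).
      X m ^ sh m * ((\<Prod>i=0..<m. X m ^ (sh i - \<mu> i)) * (\<Prod>x\<in>shape m \<mu>. X (T x))))"
    unfolding schur_def
  proof (rule sum.reindex_bij_witness[where j = "\<lambda>T. (inner_shape m sh T, inner_tab m T)"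
        and i = "\<lambda>(\<mu>, T). glue m sh \<mu> T"], goal_cases)
    case (5 T)
    then show ?case
      using prod_glue[OF inner_shape_in_PiE[OF 5] inner_tab_in_tableaux[OF 5], of X] by (simp add: glue_inner)
  qed (auto simp: glue_inner inner_shape_in_PiE inner_tab_in_tableaux inner_shape_glue inner_tab_glue glue_in_tableaux)
  also have "\<dots> = (\<Sum>\<mu>\<in>?P. \<Sum>T\<in>tableaux m \<mu>.
      X m ^ sh m * ((\<Prod>i=0..<m. X m ^ (sh i - \<mu> i)) * (\<Prod>x\<in>shape m \<mu>. X (T x))))"
    by (rule sum.Sigma[symmetric]) (auto intro!: finite_PiE finite_tableaux)
  finally show ?thesis
    by (simp add: schur_def sum_distrib_left)
qed

end

text \<open>The two branching rules differ by the product of the \<open>X j - X m\<close>, which is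
  also the quotient of consecutive Vandermonde determinants; so both sides satisfy the same
  recursion.\<close>

theorem schur_times_vandermonde:
  fixes X :: "nat \<Rightarrow> 'a::comm_ring_1"
  assumes "\<And>i. Suc i < m \<Longrightarrow> sh (Suc i) \<le> sh i"
  shows "schur m sh X * adet m (\<lambda>i. m - 1 - i) X = adet m (\<lambda>i. sh i + (m - 1 - i)) X"
  using assms
proof (induction m arbitrary: sh)
  case 0
  have "tableaux 0 sh = {\<lambda>_. 0}" by (auto simp: tableaux_def shape_def)
  then show ?case by (simp add: schur_def shape_def adet_conv_sum)
next
  case (Suc m)
  let ?P = "PiE {0..<m} (\<lambda>i. {sh (Suc i)..sh i})"
  let ?V = "\<Prod>j=0..<m. X j - X m"
  have anti: "sh (Suc i) \<le> sh i" if "i < m" for i using Suc.prems that by auto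
  \<comment> \<open>The Vandermonde determinant is the case of the zero shape, where zero is the
    only interlacing \<open>\<mu>\<close>.\<close>
  have V: "adet (Suc m) (\<lambda>i. Suc m - 1 - i) X = ?V * adet m (\<lambda>i. m - 1 - i) X"
  proof -
    have "adet m (\<lambda>i. (\<lambda>i\<in>{0..<m}. 0) i + (m - 1 - i)) X = adet m (\<lambda>i. m - 1 - i) X"
      unfolding adet_conv_sum by (intro sum.cong prod.cong arg_cong2[of _ _ _ _ times]) auto
    moreover have "PiE {0..<m} (\<lambda>i. {0..0::nat}) = {\<lambda>i\<in>{0..<m}. 0}"
      by (auto simp: PiE_iff extensional_def fun_eq_iff)
    ultimately show ?thesis
      using adet_branch[of m "\<lambda>_. 0" X] by simp
  qed
  have IH: "schur m \<mu> X * adet m (\<lambda>i. m - 1 - i) X = adet m (\<lambda>i. \<mu> i + (m - 1 - i)) X"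
    if "\<mu> \<in> ?P" for \<mu>
  proof (rule Suc.IH)
    fix i assume "Suc i < m"
    with that have "\<mu> (Suc i) \<le> sh (Suc i)" "sh (Suc i) \<le> \<mu> i" by (auto simp: PiE_iff)
    then show "\<mu> (Suc i) \<le> \<mu> i" by simp
  qed
  have sb: "schur (Suc m) sh X = X m ^ sh m *
    (\<Sum>\<mu>\<in>?P. (\<Prod>i=0..<m. X m ^ (sh i - \<mu> i)) * schur m \<mu> X)"
    by (rule schur_branch) (rule anti)
  have "schur (Suc m) sh X * adet (Suc m) (\<lambda>i. Suc m - 1 - i) X = ?V * (X m ^ sh m *
      (\<Sum>\<mu>\<in>?P. (\<Prod>i=0..<m. X m ^ (sh i - \<mu> i)) * (schur m \<mu> X * adet m (\<lambda>i. m - 1 - i) X)))"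
    unfolding V sb by (simp only: sum_distrib_right sum_distrib_left mult_ac)
  also have "\<dots> = adet (Suc m) (\<lambda>i. sh i + (m - i)) X"
  proof -
    have "(\<Sum>\<mu>\<in>?P. (\<Prod>i=0..<m. X m ^ (sh i - \<mu> i)) * (schur m \<mu> X * adet m (\<lambda>i. m - 1 - i) X)) =
      (\<Sum>\<mu>\<in>?P. (\<Prod>i=0..<m. X m ^ (sh i - \<mu> i)) * adet m (\<lambda>i. \<mu> i + (m - 1 - i)) X)"
      by (rule sum.cong) (simp_all only: IH)
    moreover have "adet (Suc m) (\<lambda>i. sh i + (m - i)) X = ?V * (X m ^ sh m *
      (\<Sum>\<mu>\<in>?P. (\<Prod>i=0..<m. X m ^ (sh i - \<mu> i)) * adet m (\<lambda>i. \<mu> i + (m - 1 - i)) X))"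
      by (rule adet_branch) (rule anti)
    ultimately show ?thesis by (simp only:)
  qed
  finally show ?case by simp
qed

section \<open>Weyl denominators and irreducible characters\<close>

text \<open>Polynomials as finitely supported functions on exponent vectors, so that
  \<open>lookup\<close> reads off coefficients.\<close>

type_synonym mono_ring = "(nat \<Rightarrow>\<^sub>0 nat) \<Rightarrow>\<^sub>0 int"

definition pvar :: "nat \<Rightarrow> mono_ring" where
  "pvar i = Poly_Mapping.single (Poly_Mapping.single i 1) 1"

lemma pvar_power: "pvar i ^ k = Poly_Mapping.single (Poly_Mapping.single i k) 1"
  by (induction k) (simp_all add: pvar_def mult_single flip: single_add single_one)

lemma prod_single:
  "finite A \<Longrightarrow> (\<Prod>x\<in>A. Poly_Mapping.single (f x) (1::int)) = Poly_Mapping.single (\<Sum>x\<in>A. f x :: nat \<Rightarrow>\<^sub>0 nat) 1"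
  by (induction A rule: finite_induct) (simp_all add: mult_single flip: single_one)

lemma lookup_signof_mult:
  "Poly_Mapping.lookup (signof p * q :: mono_ring) b = sign p * Poly_Mapping.lookup q b"
  by (cases "evenperm p") (simp_all add: sign_def)

lemma lookup_sum_single:
  "finite A \<Longrightarrow> Poly_Mapping.lookup (\<Sum>x\<in>A. Poly_Mapping.single (f x) (g x)) a = (\<Sum>x\<in>A. if f x = a then g x else (0::nat))"
  by (simp add: lookup_sum lookup_single when_def)

text \<open>Compares the coefficients of the monomial with exponents \<open>\<beta>\<close> on both
  sides of \<open>schur_times_vandermonde\<close>, taken at the variables
  \<open>pvar\<close>.\<close>

lemma schur_coefficients:
  assumes "\<And>i. Suc i < m \<Longrightarrow> sh (Suc i) \<le> sh i"
  shows "(\<Sum>p | p permutes {0..<m}. sign p *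
       int (card {T \<in> tableaux m sh. \<forall>a<m. card {x \<in> shape m sh. T x = a} + (m - 1 - p a) = \<beta> a})) =
     (\<Sum>p | p permutes {0..<m}. sign p * of_bool (\<forall>a<m. sh (p a) + (m - 1 - p a) = \<beta> a))"
proof -
  define b where "b = (\<Sum>a\<in>{0..<m}. Poly_Mapping.single a (\<beta> a))"
  define c where "c = (\<lambda>T. \<Sum>x\<in>shape m sh. Poly_Mapping.single (T x :: nat) (1::nat))"
  define d where "d = (\<lambda>l p. \<Sum>i\<in>{0..<m}. Poly_Mapping.single (p i :: nat) (l i :: nat))"
  let ?P = "{p. p permutes {0..<m}}"
  have b: "Poly_Mapping.lookup b a = (if a < m then \<beta> a else 0)" for a
    by (simp add: b_def lookup_sum_single)
  have c: "Poly_Mapping.lookup (c T) a = card {x \<in> shape m sh. T x = a}" for T a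
    by (simp add: c_def lookup_sum_single flip: sum.inter_filter)
  have c0: "Poly_Mapping.lookup (c T) a = 0" if "T \<in> tableaux m sh" "\<not> a < m" for T a
    using tableaux_less[OF that(1)] that(2) unfolding c by auto
  have d: "Poly_Mapping.lookup (d l p) a = (if a < m then l (inv_into UNIV p a) else 0)" if p: "p permutes {0..<m}" for l p a
  proof -
    have "p i = a \<longleftrightarrow> i = inv_into UNIV p a" for i
      using permutes_inverses[OF p] by auto
    then show ?thesis
      using permutes_in_image[OF permutes_inv[OF p], of a] by (auto simp: d_def lookup_sum_single)
  qed
  have adet: "adet m l pvar = (\<Sum>p\<in>?P. signof p * Poly_Mapping.single (d l p) 1)" for l
    unfolding adet_conv_sum d_def by (simp add: pvar_power prod_single)
  have schur: "schur m sh pvar = (\<Sum>T\<in>tableaux m sh. Poly_Mapping.single (c T) 1)"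
    unfolding schur_def c_def by (simp add: pvar_def prod_single)
  have 1: "Poly_Mapping.lookup (adet m (\<lambda>i. sh i + (m - 1 - i)) pvar) b =
      (\<Sum>p\<in>?P. sign p * of_bool (\<forall>a<m. sh (inv_into UNIV p a) + (m - 1 - inv_into UNIV p a) = \<beta> a))"
    unfolding adet lookup_sum lookup_signof_mult lookup_single when_def
    by (intro sum.cong refl arg_cong2[of _ _ _ _ times])
       (auto simp: poly_mapping_eq_iff fun_eq_iff d b split: if_splits)
  have "Poly_Mapping.lookup (schur m sh pvar * adet m (\<lambda>i. m - 1 - i) pvar) b =
      (\<Sum>T\<in>tableaux m sh. \<Sum>p\<in>?P. sign p * of_bool (c T + d (\<lambda>i. m - 1 - i) p = b))"
    unfolding schur adet sum_product mult.left_commute[of _ "signof _"] mult_single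
      lookup_sum lookup_signof_mult lookup_single when_def by (simp only: of_bool_def mult_1)
  also have "\<dots> = (\<Sum>p\<in>?P. sign p * (\<Sum>T\<in>tableaux m sh. of_bool (c T + d (\<lambda>i. m - 1 - i) p = b)))"
    unfolding sum_distrib_left by (rule sum.swap)
  also have "\<dots> = (\<Sum>p\<in>?P. sign p *
       int (card {T \<in> tableaux m sh. \<forall>a<m. card {x \<in> shape m sh. T x = a} + (m - 1 - inv_into UNIV p a) = \<beta> a}))"
  proof (intro sum.cong refl arg_cong2[of _ _ _ _ times])
    fix p assume "p \<in> ?P"
    then have p: "p permutes {0..<m}" by simp
    have "(\<Sum>T\<in>tableaux m sh. of_bool (c T + d (\<lambda>i. m - 1 - i) p = b)) =
        int (card {T \<in> tableaux m sh. c T + d (\<lambda>i. m - 1 - i) p = b})"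
      by (simp add: of_bool_def finite_tableaux flip: sum.inter_filter)
    also have "{T \<in> tableaux m sh. c T + d (\<lambda>i. m - 1 - i) p = b} =
       {T \<in> tableaux m sh. \<forall>a<m. card {x \<in> shape m sh. T x = a} + (m - 1 - inv_into UNIV p a) = \<beta> a}"
      using c0 by (auto simp: poly_mapping_eq_iff fun_eq_iff lookup_add d[OF p] b c split: if_splits)
    finally show "(\<Sum>T\<in>tableaux m sh. of_bool (c T + d (\<lambda>i. m - 1 - i) p = b)) =
      int (card {T \<in> tableaux m sh. \<forall>a<m. card {x \<in> shape m sh. T x = a} + (m - 1 - inv_into UNIV p a) = \<beta> a})" .
  qed
  finally have 2: "Poly_Mapping.lookup (schur m sh pvar * adet m (\<lambda>i. m - 1 - i) pvar) b = \<dots>" .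
  \<comment> \<open>A term of the determinant puts the exponent of row \<open>i\<close> on the
    variable \<open>p i\<close>, so exponents appear through the inverse of \<open>p\<close>, which
    has the same sign.\<close>
  have inv: "(\<Sum>p\<in>?P. sign p * F (inv_into UNIV p)) = (\<Sum>p\<in>?P. sign p * F p)" for F :: "(nat \<Rightarrow> nat) \<Rightarrow> int"
  proof -
    have "(\<Sum>p\<in>?P. sign p * F p) = (\<Sum>p\<in>?P. sign (inv_into UNIV p) * F (inv_into UNIV p))"
      by (rule sum_permutations_inverse)
    also have "\<dots> = (\<Sum>p\<in>?P. sign p * F (inv_into UNIV p))"
      by (intro sum.cong refl) (auto simp: sign_inverse permutes_imp_permutation[of "{0..<m}"])
    finally show ?thesis ..
  qed
  show ?thesis
    using 1 2 schur_times_vandermonde[of m sh pvar, OF assms]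
      inv[of "\<lambda>p. int (card {T \<in> tableaux m sh. \<forall>a<m. card {x \<in> shape m sh. T x = a} + (m - 1 - p a) = \<beta> a})"]
      inv[of "\<lambda>p. of_bool (\<forall>a<m. sh (p a) + (m - 1 - p a) = \<beta> a)"]
    by simp
qed

text \<open>The half sum of the positive compact roots, shifted by a multiple of \<open>(1, \<dots>, 1)\<close> to be integral.\<close>
definition rho :: "nat \<Rightarrow> nat \<Rightarrow> rat" where
  "rho n a = of_nat (n - 1 - a)"

definition add_rho :: "nat \<Rightarrow> wt \<Rightarrow> wt" where
  "add_rho n t = map (\<lambda>a. t ! a + rho n a) [0..<n]"

definition sub_rho :: "nat \<Rightarrow> wt \<Rightarrow> wt" where
  "sub_rho n t = map (\<lambda>a. t ! a - rho n a) [0..<n]"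

text \<open>Coefficient at \<open>v\<close> of the formal character \<open>f\<close> times the Weyl
  denominator, the signed sum of the exponentials of the permuted \<open>rho\<close>.\<close>

definition denom_conv :: "nat \<Rightarrow> (wt \<Rightarrow> int) \<Rightarrow> wt \<Rightarrow> int" where
  "denom_conv n f v = (\<Sum>p | p permutes {0..<n}. sign p * f (map (\<lambda>a. v ! a - rho n (p a)) [0..<n]))"

text \<open>Coefficient at \<open>v\<close> of the numerator in the Weyl character formula, the
  signed sum of the exponentials of the permuted \<open>u\<close>.\<close>

definition alternant :: "nat \<Rightarrow> wt \<Rightarrow> wt \<Rightarrow> int" where
  "alternant n u v = (if length v = n
     then \<Sum>p | p permutes {0..<n}. sign p * of_bool (\<forall>a<n. v ! a = u ! p a) else 0)"

lemma length_add_rho [simp]: "length (add_rho n t) = n" by (simp add: add_rho_def)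
lemma length_sub_rho [simp]: "length (sub_rho n t) = n" by (simp add: sub_rho_def)

lemma add_sub_rho [simp]: "length t = n \<Longrightarrow> add_rho n (sub_rho n t) = t"
  by (auto simp: add_rho_def sub_rho_def intro: nth_equalityI)

lemma sub_add_rho [simp]: "length t = n \<Longrightarrow> sub_rho n (add_rho n t) = t"
  by (auto simp: add_rho_def sub_rho_def intro: nth_equalityI)

lemma dominant_length: "dominant n lam \<Longrightarrow> length lam = n"
  by (simp add: dominant_def)

lemma dominant_rowlen:
  assumes "dominant n lam" "i < n"
  shows "lam ! i = lam ! (n - 1) + of_nat (rowlen n lam i)"
proof -
  have "lam ! i - lam ! (n - 1) \<in> \<nat>"
  proof -
    have "lam ! i - lam ! j \<in> \<nat>" if "i \<le> j" "j < n" for j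
      using that
    proof (induction j rule: dec_induct)
      case (step j)
      have "lam ! i - lam ! j \<in> \<nat>" "lam ! j - lam ! Suc j \<in> \<nat>"
        using step assms(1) by (auto simp: dominant_def)
      from Nats_add[OF this] show ?case by simp
    qed simp
    then show ?thesis using assms by auto
  qed
  then obtain k where "lam ! i - lam ! (n - 1) = of_nat k" by (auto elim: Nats_cases)
  then show ?thesis by (simp add: rowlen_def algebra_simps)
qed

lemma dominant_rowlen_mono:
  assumes "dominant n lam" "Suc i < n"
  shows "rowlen n lam (Suc i) \<le> rowlen n lam i"
proof -
  have "lam ! i - lam ! Suc i \<in> \<nat>" using assms by (auto simp: dominant_def)
  then have "lam ! Suc i \<le> lam ! i" by (auto elim!: Nats_cases)
  then show ?thesis unfolding rowlen_def by (intro nat_mono floor_mono) simp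
qed

lemma add_rho_dominant_decr:
  assumes "dominant n lam"
  shows "sorted_wrt (>) (add_rho n lam)"
proof -
  have "add_rho n lam ! j < add_rho n lam ! i" if "i < j" "j < n" for i j
    using that
  proof (induction j)
    case (Suc j)
    have "lam ! j - lam ! Suc j \<in> \<nat>" using Suc.prems assms by (auto simp: dominant_def)
    then have "lam ! Suc j \<le> lam ! j" by (auto elim!: Nats_cases)
    moreover have "rho n (Suc j) < rho n j" using Suc.prems by (auto simp: rho_def)
    ultimately have "add_rho n lam ! Suc j < add_rho n lam ! j"
      using Suc.prems by (auto simp: add_rho_def)
    with Suc show ?case by (cases "i = j") auto
  qed simp
  then show ?thesis by (auto simp: sorted_wrt_iff_nth_less)
qed

lemma ch_conv_tableaux:
  assumes "dominant n lam" "length mu = n"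
  shows "ch n lam mu = int (card {T \<in> tableaux n (rowlen n lam).
    \<forall>a<n. of_nat (card {x \<in> shape n (rowlen n lam). T x = a}) = mu ! a - lam ! (n - 1)})"
proof -
  have "diagram n lam = shape n (rowlen n lam)"
    by (simp add: diagram_def shape_def)
  then show ?thesis
    using assms unfolding ch_def ssyt_count_def tableaux_def
    by (auto intro!: arg_cong[of _ _ card])
qed

text \<open>Weyl's character formula. Subtracting the last entry of \<open>lam\<close> turns the
  weights into exponent vectors, where \<open>schur_coefficients\<close> applies; if an entry of
  \<open>v\<close> does not become a natural number, both sides are zero.\<close>

lemma denom_conv_ch:
  assumes dom: "dominant n lam" and v: "length v = n"
  shows "denom_conv n (ch n lam) v = alternant n (add_rho n lam) v"
proof -
  let ?sh = "rowlen n lam"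
  define d where "d = lam ! (n - 1)"
  let ?C = "\<lambda>T a. card {x \<in> shape n ?sh. T x = a}"
  have lam: "lam ! i = d + of_nat (?sh i)" if "i < n" for i
    using dominant_rowlen[OF dom that] by (simp add: d_def)
  have ch: "ch n lam (map (\<lambda>a. v ! a - rho n (p a)) [0..<n]) =
      int (card {T \<in> tableaux n ?sh. \<forall>a<n. of_nat (?C T a) = v ! a - rho n (p a) - d})" for p
    using ch_conv_tableaux[OF dom, of "map (\<lambda>a. v ! a - rho n (p a)) [0..<n]"] by (simp add: d_def)
  have alt: "alternant n (add_rho n lam) v = (\<Sum>p | p permutes {0..<n}. sign p *
      of_bool (\<forall>a<n. v ! a = d + of_nat (?sh (p a)) + rho n (p a)))"
  proof -
    have iff: "(\<forall>a<n. v ! a = add_rho n lam ! p a) \<longleftrightarrow> (\<forall>a<n. v ! a = d + of_nat (?sh (p a)) + rho n (p a))"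
      if p: "p permutes {0..<n}" for p
    proof -
      have "p a < n" if "a < n" for a using permutes_in_image[OF p, of a] that by simp
      then have "add_rho n lam ! p a = d + of_nat (?sh (p a)) + rho n (p a)" if "a < n" for a
        using that lam by (simp add: add_rho_def)
      then show ?thesis by auto
    qed
    show ?thesis
      unfolding alternant_def if_P[OF v] by (intro sum.cong refl) (simp only: mem_Collect_eq iff)
  qed
  show ?thesis
  proof (cases "\<forall>a<n. v ! a - d \<in> \<nat>")
    case True
    then have "\<forall>a. \<exists>b. a < n \<longrightarrow> v ! a - d = of_nat b" by (metis Nats_cases)
    then obtain \<beta> where "\<And>a. a < n \<Longrightarrow> v ! a - d = of_nat (\<beta> a)" by metis
    then have \<beta>: "v ! a = d + of_nat (\<beta> a)" if "a < n" for a
      using that by (simp add: algebra_simps)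
    have 1: "(of_nat x = v ! a - rho n b - d) \<longleftrightarrow> x + (n - 1 - b) = \<beta> a" if "a < n" for a b x
    proof -
      have "(of_nat x = v ! a - rho n b - d) \<longleftrightarrow> (of_nat (x + (n - 1 - b)) :: rat) = of_nat (\<beta> a)"
        unfolding \<beta>[OF that] rho_def of_nat_add by linarith
      then show ?thesis by (simp only: of_nat_eq_iff)
    qed
    have 2: "(v ! a = d + of_nat x + rho n b) \<longleftrightarrow> x + (n - 1 - b) = \<beta> a" if "a < n" for a b x
    proof -
      have "(v ! a = d + of_nat x + rho n b) \<longleftrightarrow> (of_nat (x + (n - 1 - b)) :: rat) = of_nat (\<beta> a)"
        unfolding \<beta>[OF that] rho_def of_nat_add by linarith
      then show ?thesis by (simp only: of_nat_eq_iff)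
    qed
    have "denom_conv n (ch n lam) v = (\<Sum>p | p permutes {0..<n}. sign p *
       int (card {T \<in> tableaux n ?sh. \<forall>a<n. ?C T a + (n - 1 - p a) = \<beta> a}))"
      unfolding denom_conv_def ch by (simp add: 1 cong: conj_cong)
    also have "\<dots> = (\<Sum>p | p permutes {0..<n}. sign p * of_bool (\<forall>a<n. ?sh (p a) + (n - 1 - p a) = \<beta> a))"
      by (rule schur_coefficients) (use dominant_rowlen_mono[OF dom] in auto)
    also have "\<dots> = alternant n (add_rho n lam) v"
      unfolding alt by (simp add: 2)
    finally show ?thesis .
  next
    case False
    then obtain a where a: "a < n" "v ! a - d \<notin> \<nat>" by auto
    have 1: "of_nat x \<noteq> v ! a - rho n b - d" for x b
    proof
      assume "of_nat x = v ! a - rho n b - d"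
      then have "v ! a - d = of_nat (x + (n - 1 - b))" by (simp add: rho_def algebra_simps)
      with a show False by (simp del: of_nat_add)
    qed
    have 2: "v ! a \<noteq> d + of_nat x + rho n b" for x b
    proof
      assume "v ! a = d + of_nat x + rho n b"
      then have "v ! a - d = of_nat (x + (n - 1 - b))" by (simp add: rho_def algebra_simps)
      with a show False by (simp del: of_nat_add)
    qed
    have "denom_conv n (ch n lam) v = 0"
    proof -
      have "{T \<in> tableaux n ?sh. \<forall>a<n. of_nat (?C T a) = v ! a - rho n (p a) - d} = {}" for p
        using a(1) 1 by blast
      then show ?thesis unfolding denom_conv_def ch by (simp only: card.empty of_nat_0 mult_zero_right sum.neutral_const)
    qed
    moreover have "alternant n (add_rho n lam) v = 0"
    proof -
      have "\<not> (\<forall>a<n. v ! a = d + of_nat (?sh (p a)) + rho n (p a))" for p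
        using a(1) 2 by blast
      then show ?thesis unfolding alt by (simp only: of_bool_def if_False mult_zero_right sum.neutral_const)
    qed
    ultimately show ?thesis by simp
  qed
qed

section \<open>Adjacent transpositions and alternants\<close>

definition swap_at :: "nat \<Rightarrow> 'a list \<Rightarrow> 'a list" where
  "swap_at i u = u[i := u ! Suc i, Suc i := u ! i]"

lemma length_swap_at [simp]: "length (swap_at i u) = length u"
  by (simp add: swap_at_def)

lemma nth_swap_at: "Suc i < length u \<Longrightarrow> c < length u \<Longrightarrow> swap_at i u ! c = u ! transpose i (Suc i) c"
  by (auto simp: swap_at_def nth_list_update transpose_def)

lemma swap_at_append: "swap_at (length xs) (xs @ a # b # ys) = xs @ b # a # ys"
  by (simp add: swap_at_def list_update_append nth_append)

text \<open>The indexed form of alternation, suited to reindexing sums over permutations or over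
  sets of roots.\<close>

lemma alternating_iff_swap_at:
  fixes f :: "'a list \<Rightarrow> int"
  shows "alternating f \<longleftrightarrow> (\<forall>u i. Suc i < length u \<longrightarrow> f (swap_at i u) = - f u)"
proof safe
  fix u :: "'a list" and i assume f: "alternating f" and i: "Suc i < length u"
  have u: "u = take i u @ u ! i # u ! Suc i # drop (Suc (Suc i)) u"
    using i by (metis Cons_nth_drop_Suc Suc_lessD append_take_drop_id)
  have "swap_at (length (take i u)) (take i u @ u ! i # u ! Suc i # drop (Suc (Suc i)) u) =
      take i u @ u ! Suc i # u ! i # drop (Suc (Suc i)) u"
    by (rule swap_at_append)
  then have "swap_at i u = take i u @ u ! Suc i # u ! i # drop (Suc (Suc i)) u"
    using i by (simp flip: u)
  then show "f (swap_at i u) = - f u"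
    using alternatingD[OF f, of "take i u" "u ! Suc i" "u ! i" "drop (Suc (Suc i)) u"] u by simp
next
  assume *: "\<forall>u i. Suc i < length u \<longrightarrow> f (swap_at i u) = - f u"
  show "alternating f"
    unfolding alternating_def
  proof (intro allI)
    fix xs a b ys
    show "f (xs @ a # b # ys) = - f (xs @ b # a # ys)"
      using *[rule_format, of "length xs" "xs @ b # a # ys"] by (simp add: swap_at_append)
  qed
qed

lemma alternating_map: "alternating f \<Longrightarrow> alternating (\<lambda>v. f (map h v))"
  unfolding alternating_def map_append list.map by blast

lemma alternating_sum:
  "(\<And>i. i \<in> I \<Longrightarrow> alternating (f i)) \<Longrightarrow> alternating (\<lambda>v. \<Sum>i\<in>I. f i v)"
  unfolding alternating_iff_swap_at by (simp add: sum_negf)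

lemma alternating_alternant: "alternating (alternant n u)"
  unfolding alternating_iff_swap_at
proof (intro allI impI)
  fix v :: wt and i assume i: "Suc i < length v"
  show "alternant n u (swap_at i v) = - alternant n u v"
  proof (cases "length v = n")
    case True
    let ?t = "transpose i (Suc i)"
    have t: "?t permutes {0..<n}" using i True by (intro permutes_swap_id) auto
    have tt: "?t a < n" if "a < n" for a using permutes_in_image[OF t, of a] that by simp
    have "alternant n u (swap_at i v) =
        (\<Sum>p | p permutes {0..<n}. sign p * of_bool (\<forall>a<n. v ! ?t a = u ! p a))"
      using True i by (simp add: alternant_def nth_swap_at cong: all_cong)
    also have "\<dots> = (\<Sum>p | p permutes {0..<n}. sign (p \<circ> ?t) * of_bool (\<forall>a<n. v ! ?t a = u ! (p \<circ> ?t) a))"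
      by (rule sum_permutations_compose_right[OF t])
    also have "\<dots> = (\<Sum>p | p permutes {0..<n}. - (sign p * of_bool (\<forall>a<n. v ! a = u ! p a)))"
    proof (intro sum.cong refl)
      fix p assume "p \<in> {p. p permutes {0..<n}}"
      then have p: "p permutes {0..<n}" by simp
      have "sign (p \<circ> ?t) = - sign p"
        using p by (simp add: sign_compose permutes_imp_permutation[OF _ p] permutation_swap_id sign_swap_id)
      moreover have "(\<forall>a<n. v ! ?t a = u ! (p \<circ> ?t) a) \<longleftrightarrow> (\<forall>a<n. v ! a = u ! p a)"
      proof safe
        fix a assume *: "\<forall>a<n. v ! ?t a = u ! (p \<circ> ?t) a" "a < n"
        from *(1)[rule_format, OF tt[OF *(2)]] show "v ! a = u ! p a" by simp
      next
        fix a assume "\<forall>a<n. v ! a = u ! p a" "a < n"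
        then show "v ! ?t a = u ! (p \<circ> ?t) a" using tt by simp
      qed
      ultimately show "sign (p \<circ> ?t) * of_bool (\<forall>a<n. v ! ?t a = u ! (p \<circ> ?t) a) =
          - (sign p * of_bool (\<forall>a<n. v ! a = u ! p a))" by simp
    qed
    finally show ?thesis using True by (simp add: alternant_def sum_negf)
  qed (simp add: alternant_def)
qed

text \<open>The entries of \<open>u\<close> are distinct and decreasing, so at a decreasing
  \<open>v\<close> only the identity permutation can contribute, and only for \<open>v = u\<close>;
  alternation does the rest.\<close>

lemma alternant_eq_alt_ext:
  assumes u: "length u = n" "sorted_wrt (>) u" and v: "length v = n"
  shows "alternant n u v = alt_ext (\<lambda>l. of_bool (l = u)) v"
proof (rule alternating_eqI[OF alternating_alternant alternating_alt_ext _ v])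
  fix v :: wt assume v: "length v = n" "sorted_wrt (>) v"
  have id: "p = id \<and> v = u" if p: "p permutes {0..<n}" and *: "\<forall>a<n. v ! a = u ! p a" for p
  proof -
    have p': "p permutes {..<length u}" using p u by (simp add: lessThan_atLeast0)
    have "v = permute_list p u"
      using * v u by (intro nth_equalityI) (auto simp: permute_list_nth[OF p'])
    then have "mset v = mset u" using mset_permute_list[OF p'] by simp
    then have "sort v = sort u" by (intro properties_for_sort) auto
    with rev_sort_decr[OF u(2)] rev_sort_decr[OF v(2)] have "v = u" by simp
    have "distinct u" using u(2) by (simp add: sorted_wrt_iff_nth_less distinct_conv_nth) (metis linorder_neqE_nat order.irrefl)
    have "p a = a" for a
    proof (cases "a < n")
      case True
      then have "u ! p a = u ! a" "p a < n" using * \<open>v = u\<close> permutes_in_image[OF p, of a] by auto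
      then show ?thesis using \<open>distinct u\<close> True u(1) by (simp add: nth_eq_iff_index_eq)
    next
      case False
      then show ?thesis using p by (simp add: permutes_def)
    qed
    with \<open>v = u\<close> show ?thesis by auto
  qed
  have "alternant n u v = (\<Sum>p | p permutes {0..<n}. if p = id then of_bool (v = u) else 0)"
    unfolding alternant_def if_P[OF v(1)]
  proof (intro sum.cong refl)
    fix p assume "p \<in> {p. p permutes {0..<n}}"
    then have "\<not> (\<forall>a<n. v ! a = u ! p a)" if "\<not> (p = id \<and> v = u)" using id[of p] that by auto
    then show "sign p * of_bool (\<forall>a<n. v ! a = u ! p a) = (if p = id then of_bool (v = u) else 0)"
      by (cases "p = id \<and> v = u") (auto simp: sign_id)
  qed
  also have "\<dots> = of_bool (v = u)"
    by (simp add: permutes_id finite_permutations)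
  also have "\<dots> = alt_ext (\<lambda>l. of_bool (l = u)) v"
    using v by (simp add: alt_ext_decr)
  finally show "alternant n u v = alt_ext (\<lambda>l. of_bool (l = u)) v" .
qed

text \<open>Pairing with \<open>\<rho>\<close> is strictly larger at \<open>\<rho>\<close> than at its other permutations, so a weight of \<open>f\<close> that
  maximises this pairing survives in the product with the Weyl denominator.\<close>
lemma denom_conv_cancel:
  assumes fin: "finite {t. f t \<noteq> 0}" and len: "\<And>t. f t \<noteq> 0 \<Longrightarrow> length t = n"
    and zero: "\<And>v. length v = n \<Longrightarrow> denom_conv n f v = 0"
  shows "f = (\<lambda>_. 0)"
proof (rule ccontr)
  assume "f \<noteq> (\<lambda>_. 0)"
  then have ne: "{t. f t \<noteq> 0} \<noteq> {}" by auto
  define h where "h = (\<lambda>t::wt. \<Sum>a<n. rho n a * t ! a)"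
  obtain t where t: "f t \<noteq> 0" "\<And>t'. f t' \<noteq> 0 \<Longrightarrow> h t' \<le> h t"
  proof -
    have "Max (h ` {t. f t \<noteq> 0}) \<in> h ` {t. f t \<noteq> 0}" using fin ne by (intro Max_in) auto
    then obtain t where "f t \<noteq> 0" "h t = Max (h ` {t. f t \<noteq> 0})" by auto
    then show ?thesis using that[of t] fin by simp
  qed
  have lt: "length t = n" using len t(1) .
  define v where "v = add_rho n t"
  have *: "f (map (\<lambda>a. v ! a - rho n (p a)) [0..<n]) = (if p = id then f t else 0)"
    if p: "p permutes {0..<n}" for p
  proof (cases "p = id")
    case True
    have "map (\<lambda>a. v ! a - rho n a) [0..<n] = t"
      using lt by (auto simp: v_def add_rho_def intro!: nth_equalityI)
    with True show ?thesis by simp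
  next
    case False
    let ?t = "map (\<lambda>a. v ! a - rho n (p a)) [0..<n]"
    have "(\<Sum>a<n. rho n (p a) * rho n (p a)) = (\<Sum>a<n. rho n a * rho n a)"
      using sum.permute[OF p, of "\<lambda>a. rho n a * rho n a"] by (simp add: o_def atLeast0LessThan)
    then have "2 * (h ?t - h t) = (\<Sum>a<n. (rho n a - rho n (p a)) ^ 2)"
      unfolding h_def v_def
      by (simp add: add_rho_def power2_eq_square algebra_simps sum.distrib sum_subtractf sum_negf flip: sum_distrib_left)
    moreover have "(\<Sum>a<n. (rho n a - rho n (p a)) ^ 2) > 0"
    proof -
      from False obtain a where a: "p a \<noteq> a" by (metis eq_id_iff)
      then have "a < n" using p by (auto simp: permutes_def)
      moreover have "p a < n" using permutes_in_image[OF p, of a] \<open>a < n\<close> by simp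
      ultimately have "rho n a \<noteq> rho n (p a)" using a by (auto simp: rho_def)
      with \<open>a < n\<close> show ?thesis by (intro sum_pos2[of _ a]) auto
    qed
    ultimately have "h t < h ?t" by simp
    then have "f ?t = 0" using t(2)[of ?t] by force
    with False show ?thesis by simp
  qed
  have "denom_conv n f v = (\<Sum>p | p permutes {0..<n}. if p = id then f t else 0)"
    unfolding denom_conv_def using * by (auto intro!: sum.cong)
  also have "\<dots> = f t" by (simp add: permutes_id finite_permutations)
  finally show False using zero[of v] t(1) by (simp add: v_def)
qed

section \<open>Reading multiplicities off the product with the Weyl denominator\<close>

lemma finite_ch_support: "finite {mu. ch n lam mu \<noteq> 0}"
proof (cases "dominant n lam")
  case True
  let ?g = "\<lambda>T. map (\<lambda>a. of_nat (card {x \<in> shape n (rowlen n lam). T x = a}) + lam ! (n - 1)) [0..<n]"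
  have "{mu. ch n lam mu \<noteq> 0} \<subseteq> ?g ` tableaux n (rowlen n lam)"
  proof
    fix mu assume "mu \<in> {mu. ch n lam mu \<noteq> 0}"
    then have mu: "length mu = n" "ch n lam mu \<noteq> 0" by (auto simp: ch_def split: if_splits)
    then have "{T \<in> tableaux n (rowlen n lam). \<forall>a<n. of_nat (card {x \<in> shape n (rowlen n lam). T x = a}) =
        mu ! a - lam ! (n - 1)} \<noteq> {}"
      using ch_conv_tableaux[OF True mu(1)] by (metis card.empty of_nat_0)
    then obtain T where T: "T \<in> tableaux n (rowlen n lam)"
      "\<forall>a<n. of_nat (card {x \<in> shape n (rowlen n lam). T x = a}) = mu ! a - lam ! (n - 1)"
      by blast
    then have "mu = ?g T" using mu(1) by (intro nth_equalityI) auto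
    with T(1) show "mu \<in> ?g ` tableaux n (rowlen n lam)" by blast
  qed
  then show ?thesis by (rule finite_subset) (simp add: finite_tableaux)
qed (simp add: ch_def)

lemma ch_length: "ch n lam mu \<noteq> 0 \<Longrightarrow> length mu = n"
  by (auto simp: ch_def split: if_splits)

lemma denom_conv_ch_add_rho:
  assumes "dominant n t" "length v = n"
  shows "denom_conv n (ch n t) v = alt_ext (\<lambda>l. of_bool (l = add_rho n t)) v"
  using denom_conv_ch[OF assms] alternant_eq_alt_ext[OF _ add_rho_dominant_decr[OF assms(1)] assms(2)] by simp

lemma denom_conv_sum:
  "denom_conv n (\<lambda>mu. \<Sum>t\<in>I. c t * F t mu) v = (\<Sum>t\<in>I. c t * denom_conv n (F t) v)"
  unfolding denom_conv_def sum_distrib_left by (subst sum.swap) (simp add: mult_ac)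

text \<open>The coefficients are the values of \<open>g\<close> at the shifted dominant weights.
  Existence: this combination and \<open>chi\<close> have the same product with the Weyl
  denominator, which \<open>denom_conv_cancel\<close> removes. Uniqueness: at a decreasing list
  exactly one coefficient is visible. The last assumption ensures that every nonzero value of
  \<open>g\<close> at a decreasing list belongs to a dominant weight.\<close>

lemma irr_mult_eq:
  assumes fin: "finite {t. chi t \<noteq> 0}" and len: "\<And>t. chi t \<noteq> 0 \<Longrightarrow> length t = n"
    and alt: "alternating g" and g: "\<And>v. length v = n \<Longrightarrow> denom_conv n chi v = g v"
    and dom: "\<And>v. length v = n \<Longrightarrow> g v \<noteq> 0 \<Longrightarrow> sorted_wrt (>) v \<Longrightarrow> dominant n (sub_rho n v)"
  shows "irr_mult n chi tau = (if dominant n tau then g (add_rho n tau) else 0)"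
proof -
  let ?P = "\<lambda>c :: wt \<Rightarrow> int. finite {t. c t \<noteq> 0} \<and> (\<forall>t. c t \<noteq> 0 \<longrightarrow> dominant n t) \<and>
      chi = (\<lambda>mu. \<Sum>t\<in>{t. c t \<noteq> 0}. c t * ch n t mu)"
  define c0 where "c0 = (\<lambda>t. if dominant n t then g (add_rho n t) else 0)"
  have dc: "denom_conv n (\<lambda>mu. \<Sum>t\<in>{t. c t \<noteq> 0}. c t * ch n t mu) v =
      (\<Sum>t\<in>{t. c t \<noteq> 0}. c t * alt_ext (\<lambda>l. of_bool (l = add_rho n t)) v)"
    if "\<forall>t. c t \<noteq> 0 \<longrightarrow> dominant n t" "length v = n" for c v
    unfolding denom_conv_sum using that by (intro sum.cong) (auto simp: denom_conv_ch_add_rho)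
  have ev: "(\<Sum>t\<in>{t. c t \<noteq> 0}. c t * alt_ext (\<lambda>l. of_bool (l = add_rho n t)) v) = c (sub_rho n v)"
    if c: "\<forall>t. c t \<noteq> 0 \<longrightarrow> dominant n t" "finite {t. c t \<noteq> 0}" and v: "length v = n" "sorted_wrt (>) v" for c v
  proof -
    have "v = add_rho n t \<longleftrightarrow> t = sub_rho n v" if "c t \<noteq> 0" for t
      using dominant_length[of n t] c(1) that add_sub_rho[OF v(1)] sub_add_rho[of t n] by metis
    then have "(\<Sum>t\<in>{t. c t \<noteq> 0}. c t * alt_ext (\<lambda>l. of_bool (l = add_rho n t)) v) =
        (\<Sum>t\<in>{t. c t \<noteq> 0}. if t = sub_rho n v then c t else 0)"
      using v(2) by (intro sum.cong) (auto simp: alt_ext_decr)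
    also have "\<dots> = c (sub_rho n v)" using c(2) by (simp add: sum.delta')
    finally show ?thesis .
  qed
  have dom0: "\<forall>t. c0 t \<noteq> 0 \<longrightarrow> dominant n t" by (simp add: c0_def)
  have fin0: "finite {t. c0 t \<noteq> 0}"
  proof (rule finite_subset)
    \<comment> \<open>A nonzero coefficient at \<open>t\<close> forces a weight of
      \<open>chi\<close> that differs from \<open>t\<close> by \<open>rho\<close> minus one of its
      finitely many permutations.\<close>
    show "{t. c0 t \<noteq> 0} \<subseteq> (\<Union>p\<in>{p. p permutes {0..<n}}. (\<lambda>t. map (\<lambda>a. t ! a + rho n (p a) - rho n a) [0..<n]) ` {t. chi t \<noteq> 0})"
    proof
      fix t assume "t \<in> {t. c0 t \<noteq> 0}"
      then have t: "dominant n t" "denom_conv n chi (add_rho n t) \<noteq> 0"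
        by (auto simp: c0_def g split: if_splits)
      from t(2) obtain p where p: "p permutes {0..<n}"
        "chi (map (\<lambda>a. add_rho n t ! a - rho n (p a)) [0..<n]) \<noteq> 0"
        unfolding denom_conv_def by (metis (mono_tags, lifting) mem_Collect_eq mult_zero_right sum.neutral)
      let ?u = "map (\<lambda>a. add_rho n t ! a - rho n (p a)) [0..<n]"
      have "t = map (\<lambda>a. ?u ! a + rho n (p a) - rho n a) [0..<n]"
        using dominant_length[OF t(1)] by (intro nth_equalityI) (auto simp: add_rho_def)
      with p show "t \<in> (\<Union>p\<in>{p. p permutes {0..<n}}. (\<lambda>t. map (\<lambda>a. t ! a + rho n (p a) - rho n a) [0..<n]) ` {t. chi t \<noteq> 0})"
        by blast
    qed
  qed (use fin finite_permutations in auto)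
  have eq0: "chi = (\<lambda>mu. \<Sum>t\<in>{t. c0 t \<noteq> 0}. c0 t * ch n t mu)"
  proof -
    let ?S = "\<lambda>mu. \<Sum>t\<in>{t. c0 t \<noteq> 0}. c0 t * ch n t mu"
    have "(\<lambda>mu. chi mu - ?S mu) = (\<lambda>_. 0)"
    proof (rule denom_conv_cancel)
      have "{mu. chi mu - ?S mu \<noteq> 0} \<subseteq> {t. chi t \<noteq> 0} \<union> (\<Union>t\<in>{t. c0 t \<noteq> 0}. {mu. ch n t mu \<noteq> 0})"
        by (force intro: sum.neutral)
      then show "finite {mu. chi mu - ?S mu \<noteq> 0}"
        by (rule finite_subset) (use fin fin0 finite_ch_support in auto)
    next
      fix mu assume "chi mu - ?S mu \<noteq> 0"
      then have "chi mu \<noteq> 0 \<or> ?S mu \<noteq> 0" by auto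
      then show "length mu = n"
        using len ch_length by (metis (mono_tags, lifting) mult_zero_right sum.neutral)
    next
      fix v :: wt assume v: "length v = n"
      have "denom_conv n (\<lambda>mu. chi mu - ?S mu) v = denom_conv n chi v - denom_conv n ?S v"
        unfolding denom_conv_def by (simp add: right_diff_distrib sum_subtractf)
      also have "\<dots> = g v - (\<Sum>t\<in>{t. c0 t \<noteq> 0}. c0 t * alt_ext (\<lambda>l. of_bool (l = add_rho n t)) v)"
        using g[OF v] dc[OF dom0 v] by simp
      also have "g v = (\<Sum>t\<in>{t. c0 t \<noteq> 0}. c0 t * alt_ext (\<lambda>l. of_bool (l = add_rho n t)) v)"
      proof (rule alternating_eqI[OF alt _ _ v])
        show "alternating (\<lambda>v. \<Sum>t\<in>{t. c0 t \<noteq> 0}. c0 t * alt_ext (\<lambda>l. of_bool (l = add_rho n t)) v)"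
          by (intro alternating_sum alternating_cmult alternating_alt_ext)
        fix v :: wt assume v: "length v = n" "sorted_wrt (>) v"
        have "g v = c0 (sub_rho n v)"
          using dom[OF v(1) _ v(2)] v(1) by (auto simp: c0_def)
        with ev[OF dom0 fin0 v] show "g v = (\<Sum>t\<in>{t. c0 t \<noteq> 0}. c0 t * alt_ext (\<lambda>l. of_bool (l = add_rho n t)) v)"
          by simp
      qed
      finally show "denom_conv n (\<lambda>mu. chi mu - ?S mu) v = 0" by simp
    qed
    then show ?thesis by (simp add: fun_eq_iff)
  qed
  have uniq: "c = c0" if c: "?P c" for c
  proof
    fix t
    show "c t = c0 t"
    proof (cases "dominant n t")
      case True
      have "g (add_rho n t) = denom_conv n (\<lambda>mu. \<Sum>t\<in>{t. c t \<noteq> 0}. c t * ch n t mu) (add_rho n t)"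
        using g[of "add_rho n t"] c by simp
      also have "\<dots> = c (sub_rho n (add_rho n t))"
        using c dc[of c "add_rho n t"] ev[of c "add_rho n t"] add_rho_dominant_decr[OF True] by simp
      finally show ?thesis using True dominant_length[OF True] by (simp add: c0_def)
    next
      case False
      with c show ?thesis by (auto simp: c0_def)
    qed
  qed
  have "(THE c. ?P c) = c0"
    using dom0 fin0 eq0 by (intro the_equality uniq) auto
  then show ?thesis
    unfolding irr_mult_def by (simp add: c0_def)
qed

section \<open>The Dirac index of a virtual module\<close>

definition spin_sets :: "nat \<Rightarrow> bool \<Rightarrow> (nat \<times> nat) set set" where
  "spin_sets n ev = {S. S \<subseteq> pplus n \<and> (even (card S) \<longleftrightarrow> ev)}"

text \<open>The common value of all entries of \<open>rho_n n\<close>: each coordinate occurs once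
  in \<open>n - 1\<close> roots and twice in one root, and the total is halved.\<close>

definition rho_n_entry :: "nat \<Rightarrow> rat" where
  "rho_n_entry n = (of_nat n + 1) / 2"

definition spin_wt :: "nat \<Rightarrow> (nat \<times> nat) set \<Rightarrow> wt" where
  "spin_wt n S = vadd (rootsum n S) (map uminus (rho_n n))"

lemma finite_spin_sets [simp]: "finite (spin_sets n ev)"
  unfolding spin_sets_def by (rule finite_subset[of _ "Pow (pplus n)"]) auto

lemma length_rootsum [simp]: "length (rootsum n S) = n"
  by (simp add: rootsum_def)

lemma rho_n_nth:
  assumes "m < n"
  shows "rho_n n ! m = rho_n_entry n"
proof -
  have "pplus n = Sigma {..<n} (\<lambda>i. {i..<n})"
    by (auto simp: pplus_def)
  then have "rootsum n (pplus n) ! m =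
      (\<Sum>i<n. \<Sum>j=i..<n. (if m = i then 1 else 0) + (if m = j then 1 else 0))"
    using assms by (simp add: rootsum_def sum.Sigma)
  also have "\<dots> = (\<Sum>i<n. (if i = m then of_nat (n - m) else 0) + (if i \<le> m then 1 else 0))"
    using assms by (intro sum.cong) (auto simp: sum.distrib)
  also have "\<dots> = of_nat (n - m) + (\<Sum>i\<in>{..<n} \<inter> {..m}. 1)"
    using assms by (simp add: sum.distrib sum.If_cases flip: atMost_def)
  also have "{..<n} \<inter> {..m} = {..m}" using assms by auto
  finally show ?thesis
    using assms by (simp add: rho_n_def rho_n_entry_def of_nat_diff)
qed

lemma length_spin_wt [simp]: "length (spin_wt n S) = n"
  by (simp add: spin_wt_def vadd_def rho_n_def)

lemma spin_wt_nth: "m < n \<Longrightarrow> spin_wt n S ! m = rootsum n S ! m - rho_n_entry n"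
  using rho_n_nth[of m n] by (simp add: spin_wt_def vadd_def rho_n_def)

lemma vadd_spin_wt:
  assumes "length mu = n" "length nu = n"
  shows "vadd mu (spin_wt n S) = nu \<longleftrightarrow> mu = sub_roots n S (map (\<lambda>x. x + rho_n_entry n) nu)"
proof -
  have "vadd mu (spin_wt n S) = nu \<longleftrightarrow> (\<forall>a<n. mu ! a + spin_wt n S ! a = nu ! a)"
    using assms by (auto simp: vadd_def list_eq_iff_nth_eq)
  also have "\<dots> \<longleftrightarrow> (\<forall>a<n. mu ! a = sub_roots n S (map (\<lambda>x. x + rho_n_entry n) nu) ! a)"
    using assms by (auto simp: spin_wt_nth sub_roots_def rootsum_def algebra_simps)
  also have "\<dots> \<longleftrightarrow> mu = sub_roots n S (map (\<lambda>x. x + rho_n_entry n) nu)"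
    using assms by (auto simp: list_eq_iff_nth_eq)
  finally show ?thesis .
qed

lemma spin_char_conv_card: "spin_char n ev mu = int (card {S \<in> spin_sets n ev. spin_wt n S = mu})"
  unfolding spin_char_def spin_sets_def spin_wt_def by (rule arg_cong[of _ _ int], rule arg_cong[of _ _ card]) auto

lemma spin_char_nonzero_iff: "spin_char n ev mu \<noteq> 0 \<longleftrightarrow> mu \<in> spin_wt n ` spin_sets n ev"
  unfolding spin_char_conv_card by auto

lemma conv_spin_support:
  assumes "conv (ch n lam) (spin_char n ev) nu \<noteq> 0"
  shows "length nu = n" "nu \<in> (\<lambda>(mu, mu'). vadd mu mu') ` ({mu. ch n lam mu \<noteq> 0} \<times> spin_wt n ` spin_sets n ev)"
proof -
  from assms have "{(mu, mu'). ch n lam mu \<noteq> 0 \<and> spin_char n ev mu' \<noteq> 0 \<and> length mu = length mu' \<and> vadd mu mu' = nu} \<noteq> {}"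
    unfolding conv_def by (metis (lifting) sum.empty)
  then obtain mu mu' where *: "ch n lam mu \<noteq> 0" "spin_char n ev mu' \<noteq> 0" "length mu = length mu'" "vadd mu mu' = nu"
    by blast
  then show "length nu = n" using ch_length[OF *(1)] by (auto simp: vadd_def)
  show "nu \<in> (\<lambda>(mu, mu'). vadd mu mu') ` ({mu. ch n lam mu \<noteq> 0} \<times> spin_wt n ` spin_sets n ev)"
    using * unfolding spin_char_nonzero_iff by force
qed

text \<open>In a pair of weights with sum \<open>nu\<close> the spin weight determines the other
  one, and its multiplicity counts the sets of roots that produce it.\<close>

lemma conv_spin:
  assumes nu: "length nu = n"
  shows "conv (ch n lam) (spin_char n ev) nu =
    (\<Sum>S\<in>spin_sets n ev. ch n lam (sub_roots n S (map (\<lambda>x. x + rho_n_entry n) nu)))"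
proof -
  define D where "D = (\<lambda>mu'. map (\<lambda>a. nu ! a - mu' ! a :: rat) [0..<n])"
  let ?W = "spin_wt n ` spin_sets n ev"
  have D: "vadd mu mu' = nu \<longleftrightarrow> mu = D mu'" if "length mu = n" "length mu' = n" for mu mu'
  proof -
    have "vadd mu mu' = nu \<longleftrightarrow> (\<forall>a<n. mu ! a + mu' ! a = nu ! a)"
      using that nu by (auto simp: vadd_def list_eq_iff_nth_eq)
    also have "\<dots> \<longleftrightarrow> mu = D mu'"
      using that by (auto simp: D_def list_eq_iff_nth_eq algebra_simps)
    finally show ?thesis .
  qed
  have len: "length mu' = n" if "mu' \<in> ?W" for mu' using that by auto
  have lenD: "length (D mu') = n" for mu' by (simp add: D_def)
  have DS: "sub_roots n S (map (\<lambda>x. x + rho_n_entry n) nu) = D (spin_wt n S)" for S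
    using vadd_spin_wt[of "D (spin_wt n S)" n nu S] D[of "D (spin_wt n S)" "spin_wt n S"] nu lenD by simp
  have "(\<Sum>S\<in>spin_sets n ev. ch n lam (sub_roots n S (map (\<lambda>x. x + rho_n_entry n) nu))) =
      (\<Sum>mu'\<in>?W. \<Sum>S\<in>{S \<in> spin_sets n ev. spin_wt n S = mu'}. ch n lam (D (spin_wt n S)))"
    unfolding DS by (rule sum.image_gen) simp
  also have "\<dots> = (\<Sum>mu'\<in>?W. ch n lam (D mu') * spin_char n ev mu')"
    by (intro sum.cong refl) (simp add: spin_char_conv_card)
  also have "\<dots> = (\<Sum>mu'\<in>{mu' \<in> ?W. ch n lam (D mu') \<noteq> 0}. ch n lam (D mu') * spin_char n ev mu')"
    by (intro sum.mono_neutral_right) auto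
  also have "\<dots> = conv (ch n lam) (spin_char n ev) nu"
    unfolding conv_def spin_char_nonzero_iff
  proof (rule sum.reindex_bij_witness[where i = snd and j = "\<lambda>mu'. (D mu', mu')"], goal_cases)
    case (2 mu')
    then show ?case using D[OF lenD len, of mu' mu'] len[of mu'] lenD[of mu'] by auto
  next
    case (3 p)
    then obtain mu mu' where p: "p = (mu, mu')" "ch n lam mu \<noteq> 0" "mu' \<in> ?W" "vadd mu mu' = nu" by auto
    then show ?case using D[OF ch_length len] by auto
  next
    case (4 p)
    then obtain mu mu' where p: "p = (mu, mu')" "ch n lam mu \<noteq> 0" "mu' \<in> ?W" "vadd mu mu' = nu" by auto
    then show ?case using D[OF ch_length len] by auto
  qed auto
  finally show ?thesis by simp
qed

text \<open>Action of an adjacent transposition on the positive noncompact roots; \<open>min\<close>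
  and \<open>max\<close> restore the order within the pair.\<close>

definition transpose_root :: "nat \<Rightarrow> nat \<times> nat \<Rightarrow> nat \<times> nat" where
  "transpose_root i = (\<lambda>(a, b). let a' = transpose i (Suc i) a; b' = transpose i (Suc i) b in (min a' b', max a' b'))"

lemma transpose_root_pair:
  "transpose_root i (a, b) = (if transpose i (Suc i) a \<le> transpose i (Suc i) b
     then (transpose i (Suc i) a, transpose i (Suc i) b) else (transpose i (Suc i) b, transpose i (Suc i) a))"
  by (simp add: transpose_root_def Let_def)

lemma transpose_root_pplus:
  assumes "Suc i < n" "x \<in> pplus n"
  shows "transpose_root i x \<in> pplus n"
proof -
  obtain a b where x: "x = (a, b)" "a < n" "b < n" using assms(2) by (cases x) (auto simp: pplus_def)
  have "transpose i (Suc i) c < n" if "c < n" for c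
    using that assms(1) by (auto simp: transpose_def)
  with x show ?thesis by (auto simp: transpose_root_pair pplus_def)
qed

lemma transpose_root_involution:
  assumes "x \<in> pplus n"
  shows "transpose_root i (transpose_root i x) = x"
proof -
  obtain a b where "x = (a, b)" "a \<le> b" using assms by (cases x) (auto simp: pplus_def)
  then show ?thesis by (cases "a = b") (simp_all add: transpose_root_pair)
qed

lemma sub_roots_transpose:
  fixes v :: "'a::ring_1 list"
  assumes "Suc i < n" "S \<subseteq> pplus n" "length v = n"
  shows "sub_roots n (transpose_root i ` S) (swap_at i v) = swap_at i (sub_roots n S v)"
proof (rule nth_equalityI)
  fix c assume "c < length (sub_roots n (transpose_root i ` S) (swap_at i v))"
  then have c: "c < n" by simp
  let ?t = "transpose i (Suc i)"
  have tc: "?t c < n" using c assms(1) by (auto simp: transpose_def)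
  have inj: "inj_on (transpose_root i) S"
    by (rule inj_on_inverseI[of _ "transpose_root i"]) (use assms(2) transpose_root_involution in blast)
  have "(\<Sum>(a, b)\<in>transpose_root i ` S. (if c = a then 1 else 0) + (if c = b then 1 else (0::'a))) =
      (\<Sum>(a, b)\<in>S. (if ?t c = a then 1 else 0) + (if ?t c = b then 1 else 0))"
    unfolding sum.reindex[OF inj]
  proof (intro sum.cong refl)
    fix x assume "x \<in> S"
    obtain a b where x: "x = (a, b)" by (cases x)
    have t: "?t c = d \<longleftrightarrow> c = ?t d" for d by auto
    have "transpose_root i x = (if ?t a \<le> ?t b then (?t a, ?t b) else (?t b, ?t a))"
      by (simp add: x transpose_root_pair)
    then show "((\<lambda>(a, b). (if c = a then 1 else 0) + (if c = b then 1 else (0::'a))) \<circ> transpose_root i) x =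
        (case x of (a, b) \<Rightarrow> (if ?t c = a then 1 else 0) + (if ?t c = b then 1 else 0))"
      unfolding x t by (simp add: add.commute)
  qed
  then show "sub_roots n (transpose_root i ` S) (swap_at i v) ! c = swap_at i (sub_roots n S v) ! c"
    using c tc assms by (simp add: sub_roots_def nth_swap_at)
qed simp

text \<open>Permuting coordinates permutes the positive noncompact roots and keeps the sizes of sets
  of roots. The spin sum is thus symmetric and preserves alternation.\<close>

lemma alternating_sum_sub_roots:
  fixes H :: "rat list \<Rightarrow> int"
  assumes "alternating H"
  shows "alternating (\<lambda>v. if length v = n then \<Sum>S\<in>spin_sets n ev. H (sub_roots n S v) else 0)"
  unfolding alternating_iff_swap_at
proof (intro allI impI)
  fix v :: "rat list" and i assume i: "Suc i < length v"
  show "(if length (swap_at i v) = n then \<Sum>S\<in>spin_sets n ev. H (sub_roots n S (swap_at i v)) else 0) =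
     - (if length v = n then \<Sum>S\<in>spin_sets n ev. H (sub_roots n S v) else 0)"
  proof (cases "length v = n")
    case True
    let ?t = "transpose_root i"
    have tt: "?t ` ?t ` S = S" if "S \<subseteq> pplus n" for S
    proof -
      have "(\<lambda>x. ?t (?t x)) ` S = (\<lambda>x. x) ` S"
        by (rule image_cong) (use that transpose_root_involution in blast)+
      then show ?thesis by (simp add: image_image)
    qed
    have sub: "?t ` S \<subseteq> pplus n" if "S \<subseteq> pplus n" for S
      using that transpose_root_pplus[of i n] i True by auto
    have card: "card (?t ` S) = card S" if "S \<subseteq> pplus n" for S
      by (rule card_image, rule inj_on_inverseI[of _ ?t]) (use that transpose_root_involution in blast)
    have "(\<Sum>S\<in>spin_sets n ev. H (sub_roots n S (swap_at i v))) = (\<Sum>S\<in>spin_sets n ev. H (swap_at i (sub_roots n S v)))"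
    proof (rule sum.reindex_bij_witness[where i = "image ?t" and j = "image ?t"])
      fix S assume "S \<in> spin_sets n ev"
      then have S: "S \<subseteq> pplus n" and ev: "even (card S) \<longleftrightarrow> ev" by (auto simp: spin_sets_def)
      show "?t ` ?t ` S = S" "?t ` S \<in> spin_sets n ev" using tt[OF S] sub[OF S] card[OF S] ev by (auto simp: spin_sets_def)
      then show "?t ` ?t ` S = S" "?t ` S \<in> spin_sets n ev" .
      show "H (swap_at i (sub_roots n (?t ` S) v)) = H (sub_roots n S (swap_at i v))"
        using sub_roots_transpose[OF _ sub[OF S] True, of i] i True tt[OF S] by simp
    qed
    also have "\<dots> = (\<Sum>S\<in>spin_sets n ev. - H (sub_roots n S v))"
      using assms i True unfolding alternating_iff_swap_at by (intro sum.cong) auto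
    finally show ?thesis using True by (simp add: sum_negf)
  qed simp
qed

section \<open>The Dirac index as a signed sum over sets of noncompact roots\<close>

lemma alt_ext_indicator_nonzero:
  assumes "alt_ext (\<lambda>l. of_bool (l = u)) v \<noteq> 0"
  shows "set v = set u"
proof -
  from assms have "rev (sort v) = u" by (auto simp: alt_ext_def of_bool_def split: if_splits)
  then show ?thesis by auto
qed

lemma dominant_integral:
  assumes "dominant n lam" "x \<in> set (add_rho n lam)"
  shows "2 * x \<in> \<int>" "\<And>y. y \<in> set (add_rho n lam) \<Longrightarrow> x - y \<in> \<int>"
proof -
  have z: "\<exists>k. y = lam ! (n - 1) + of_int k" if "y \<in> set (add_rho n lam)" for y
  proof -
    from that obtain a where a: "a < n" "y = lam ! a + rho n a" by (auto simp: add_rho_def)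
    then have "y = lam ! (n - 1) + of_int (int (rowlen n lam a + (n - 1 - a)))"
      using dominant_rowlen[OF assms(1) a(1)] by (simp add: rho_def)
    then show ?thesis by blast
  qed
  have n: "0 < n" using assms(1) by (simp add: dominant_def)
  then have "lam ! 0 = lam ! (n - 1) + of_nat (rowlen n lam 0)"
    using dominant_rowlen[OF assms(1), of 0] by simp
  moreover have "2 * lam ! 0 \<in> \<int>" using assms(1) by (simp add: dominant_def)
  ultimately have "2 * lam ! 0 - 2 * of_nat (rowlen n lam 0) \<in> \<int>" "2 * lam ! (n - 1) = 2 * lam ! 0 - 2 * of_nat (rowlen n lam 0)"
    by (auto intro: Ints_diff)
  then have "2 * lam ! (n - 1) \<in> \<int>" by simp
  then obtain d where d: "2 * lam ! (n - 1) = of_int d" by (auto elim: Ints_cases)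
  from z[OF assms(2)] obtain k where k: "x = lam ! (n - 1) + of_int k" by auto
  then have "2 * x = of_int (d + 2 * k)" using d by simp
  then show "2 * x \<in> \<int>" by (metis Ints_of_int)
  show "x - y \<in> \<int>" if "y \<in> set (add_rho n lam)" for y
    using z[OF that] k by auto
qed

lemma sub_roots_nth_int:
  fixes u :: "rat list"
  assumes "a < n" "finite S"
  shows "\<exists>k. sub_roots n S u ! a = u ! a - of_int k"
proof -
  have "(\<Sum>(i, j)\<in>S. (if a = i then 1 else 0) + (if a = j then 1 else 0)) =
      (of_int (\<Sum>(i, j)\<in>S. (if a = i then 1 else 0) + (if a = j then 1 else 0)) :: rat)"
    by (auto simp: case_prod_beta intro!: sum.cong)
  moreover have "sub_roots n S u ! a = u ! a - (\<Sum>(i, j)\<in>S. (if a = i then 1 else 0) + (if a = j then 1 else 0))"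
    using assms(1) by (simp add: sub_roots_def)
  ultimately show ?thesis by metis
qed

text \<open>Multiplication by the Weyl denominator commutes with the spin sum and turns
  \<open>ch n lam\<close> into the alternating indicator of \<open>add_rho n lam\<close>, so
  \<open>irr_mult_eq\<close> applies.\<close>

lemma irr_mult_conv_spin:
  assumes lam: "dominant n lam"
  shows "irr_mult n (conv (ch n lam) (spin_char n ev)) tau =
    (if dominant n tau then \<Sum>S\<in>spin_sets n ev.
       alt_ext (\<lambda>l. of_bool (l = add_rho n lam)) (sub_roots n S (map (\<lambda>x. x + rho_n_entry n) (add_rho n tau))) else 0)"
proof -
  let ?chi = "conv (ch n lam) (spin_char n ev)" and ?H = "alt_ext (\<lambda>l. of_bool (l = add_rho n lam))"
  define g where "g = (\<lambda>v. if length (map (\<lambda>x. x + rho_n_entry n) v) = n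
      then \<Sum>S\<in>spin_sets n ev. ?H (sub_roots n S (map (\<lambda>x. x + rho_n_entry n) v)) else 0)"
  have "irr_mult n ?chi tau = (if dominant n tau then g (add_rho n tau) else 0)"
  proof (rule irr_mult_eq)
    have "{t. ?chi t \<noteq> 0} \<subseteq> (\<lambda>(mu, mu'). vadd mu mu') ` ({mu. ch n lam mu \<noteq> 0} \<times> spin_wt n ` spin_sets n ev)"
      using conv_spin_support(2) by blast
    then show "finite {t. ?chi t \<noteq> 0}"
      by (rule finite_subset) (simp add: finite_ch_support)
    show "length t = n" if "?chi t \<noteq> 0" for t using conv_spin_support(1)[OF that] .
    show "alternating g"
      unfolding g_def by (rule alternating_map[OF alternating_sum_sub_roots[OF alternating_alt_ext]])
  next
    fix v :: wt assume v: "length v = n"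
    have *: "sub_roots n S (map (\<lambda>x. x + rho_n_entry n) (map (\<lambda>a. v ! a - rho n (p a)) [0..<n])) =
        map (\<lambda>a. sub_roots n S (map (\<lambda>x. x + rho_n_entry n) v) ! a - rho n (p a)) [0..<n]" for S p
      using v by (auto simp: sub_roots_def)
    have "denom_conv n ?chi v = (\<Sum>p | p permutes {0..<n}. sign p *
        (\<Sum>S\<in>spin_sets n ev. ch n lam (map (\<lambda>a. sub_roots n S (map (\<lambda>x. x + rho_n_entry n) v) ! a - rho n (p a)) [0..<n])))"
      unfolding denom_conv_def by (subst conv_spin) (simp_all only: * length_map length_upt minus_nat.diff_0)
    also have "\<dots> = (\<Sum>S\<in>spin_sets n ev. denom_conv n (ch n lam) (sub_roots n S (map (\<lambda>x. x + rho_n_entry n) v)))"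
      unfolding denom_conv_def sum_distrib_left by (rule sum.swap)
    also have "\<dots> = g v"
      using v by (simp add: g_def denom_conv_ch_add_rho[OF lam])
    finally show "denom_conv n ?chi v = g v" .
  next
    \<comment> \<open>A contributing \<open>v\<close> differs from a rearrangement of
      \<open>add_rho n lam\<close> by integers and the common shift \<open>rho_n_entry n\<close>.
      Twice that shift is \<open>n + 1\<close>, so half-integrality and integral differences
      survive.\<close>
    fix v :: wt assume v: "length v = n" "g v \<noteq> 0" "sorted_wrt (>) v"
    then obtain S where S: "S \<in> spin_sets n ev" "?H (sub_roots n S (map (\<lambda>x. x + rho_n_entry n) v)) \<noteq> 0"
      unfolding g_def by (metis (no_types, lifting) length_map sum.neutral)
    define u where "u = sub_roots n S (map (\<lambda>x. x + rho_n_entry n) v)"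
    have set: "set u = set (add_rho n lam)"
      unfolding u_def by (rule alt_ext_indicator_nonzero[OF S(2)])
    have finS: "finite S" using S(1) finite_subset[OF _ finite_pplus] by (auto simp: spin_sets_def)
    have u: "u ! a \<in> set (add_rho n lam)" if "a < n" for a
      using that set by (metis length_sub_roots nth_mem u_def)
    have vu: "\<exists>k. v ! a = u ! a - rho_n_entry n + of_int k" if "a < n" for a
      using sub_roots_nth_int[OF that finS, of "map (\<lambda>x. x + rho_n_entry n) v"] that v(1) by (auto simp: u_def)
    have d: "v ! a - v ! b \<in> \<int>" if "a < n" "b < n" for a b
    proof -
      from vu[OF that(1)] obtain k where "v ! a = u ! a - rho_n_entry n + of_int k" by auto
      moreover from vu[OF that(2)] obtain l where "v ! b = u ! b - rho_n_entry n + of_int l" by auto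
      ultimately have "v ! a - v ! b = (u ! a - u ! b) + of_int (k - l)" by simp
      then show ?thesis using dominant_integral(2)[OF lam u[OF that(1)] u[OF that(2)]] by (metis Ints_add Ints_of_int)
    qed
    have n: "0 < n" using lam by (simp add: dominant_def)
    have 0: "2 * v ! 0 \<in> \<int>"
    proof -
      obtain k where "v ! 0 = u ! 0 - rho_n_entry n + of_int k" using vu[OF n] by auto
      then have "2 * v ! 0 = 2 * u ! 0 + of_int (2 * k - int n - 1)" by (simp add: rho_n_entry_def field_simps)
      then show ?thesis using dominant_integral(1)[OF lam u[OF n]] by (metis Ints_add Ints_of_int)
    qed
    show "dominant n (sub_rho n v)"
      unfolding dominant_def
    proof (intro conjI allI impI)
      have "2 * sub_rho n v ! 0 = 2 * v ! 0 - of_int (2 * int (n - 1))"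
        using n by (simp add: sub_rho_def rho_def)
      then show "2 * sub_rho n v ! 0 \<in> \<int>" using 0 by (metis Ints_diff Ints_of_int)
    next
      fix i assume i: "Suc i < n"
      then obtain k where k: "v ! i - v ! Suc i = of_int k" using d[of i "Suc i"] by (auto elim: Ints_cases)
      have "v ! Suc i < v ! i" using v i by (simp add: sorted_wrt_iff_nth_less)
      then have "(0::rat) < of_int k" using k by simp
      then have "0 < k" by simp
      have "rho n i = rho n (Suc i) + 1"
        using i by (simp add: rho_def of_nat_diff)
      then have "sub_rho n v ! i - sub_rho n v ! Suc i = of_int (k - 1)"
        using i k by (simp add: sub_rho_def)
      also have "\<dots> = of_nat (nat (k - 1))" using \<open>0 < k\<close> by simp
      finally show "sub_rho n v ! i - sub_rho n v ! Suc i \<in> \<nat>" by simp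
    qed (use n in auto)
  qed
  then show ?thesis by (simp add: g_def)
qed

text \<open>For each set \<open>S\<close> of roots, sorting the shifted weight leaves at most one
  contributing highest weight. The finite set \<open>L\<close> of these candidates replaces the
  support of \<open>m\<close>, which may be infinite.\<close>

lemma dirac_index_eq:
  assumes m: "\<And>lam. m lam \<noteq> 0 \<Longrightarrow> dominant n lam"
  shows "dirac_index n m tau = (if dominant n tau then
    \<Sum>S\<in>Pow (pplus n). (- 1) ^ card S * alt_ext (\<lambda>l. m (sub_rho n l)) (sub_roots n S (map (\<lambda>x. x + rho_n_entry n) (add_rho n tau)))
    else 0)"
proof -
  define w where "w = map (\<lambda>x. x + rho_n_entry n) (add_rho n tau)"
  have tsm: "tensor_spin_mult n ev m tau =
      (if dominant n tau then \<Sum>S\<in>spin_sets n ev. alt_ext (\<lambda>l. m (sub_rho n l)) (sub_roots n S w) else 0)" for ev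
  proof (cases "dominant n tau")
    case True
    let ?I = "\<lambda>lam. irr_mult n (conv (ch n lam) (spin_char n ev)) tau"
    let ?E = "\<lambda>lam S. alt_ext (\<lambda>l. of_bool (l = add_rho n lam)) (sub_roots n S w)"
    define L where "L = (\<lambda>S. sub_rho n (rev (sort (sub_roots n S w)))) ` spin_sets n ev"
    have I: "?I lam = (\<Sum>S\<in>spin_sets n ev. ?E lam S)" if "m lam \<noteq> 0" for lam
      using irr_mult_conv_spin[OF m[OF that]] True by (simp add: w_def)
    have L: "lam \<in> L" if lam: "m lam \<noteq> 0" "?I lam \<noteq> 0" for lam
    proof -
      from lam obtain S where S: "S \<in> spin_sets n ev" "?E lam S \<noteq> 0"
        unfolding I[OF lam(1)] by (metis (no_types, lifting) sum.neutral)
      then have "rev (sort (sub_roots n S w)) = add_rho n lam"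
        by (auto simp: alt_ext_def of_bool_def split: if_splits)
      then have "lam = sub_rho n (rev (sort (sub_roots n S w)))"
        using dominant_length[OF m[OF lam(1)]] by simp
      with S(1) show ?thesis by (auto simp: L_def)
    qed
    have "tensor_spin_mult n ev m tau = (\<Sum>lam\<in>L. m lam * ?I lam)"
      unfolding tensor_spin_mult_def
      by (rule sum.mono_neutral_left) (use L in \<open>auto simp: L_def\<close>)
    also have "\<dots> = (\<Sum>lam\<in>L. m lam * (\<Sum>S\<in>spin_sets n ev. ?E lam S))"
      using I by (intro sum.cong refl) auto
    also have "\<dots> = (\<Sum>S\<in>spin_sets n ev. \<Sum>lam\<in>L. m lam * ?E lam S)"
      unfolding sum_distrib_left by (rule sum.swap)
    also have "\<dots> = (\<Sum>S\<in>spin_sets n ev. alt_ext (\<lambda>l. m (sub_rho n l)) (sub_roots n S w))"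
    proof (intro sum.cong refl)
      fix S assume S: "S \<in> spin_sets n ev"
      define t where "t = rev (sort (sub_roots n S w))"
      have lt: "length t = n" by (simp add: t_def)
      have "(\<Sum>lam\<in>L. m lam * ?E lam S) = (\<Sum>lam\<in>L. if lam = sub_rho n t then vsgn (sub_roots n S w) * m lam else 0)"
      proof (intro sum.cong refl)
        fix lam
        have "t = add_rho n lam \<longleftrightarrow> lam = sub_rho n t" if "m lam \<noteq> 0"
          using dominant_length[OF m[OF that]] lt add_sub_rho[OF lt] sub_add_rho[of lam n] by metis
        then show "m lam * ?E lam S = (if lam = sub_rho n t then vsgn (sub_roots n S w) * m lam else 0)"
          by (cases "m lam = 0") (auto simp: alt_ext_def t_def)
      qed
      also have "\<dots> = vsgn (sub_roots n S w) * m (sub_rho n t)"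
        using S by (simp add: L_def t_def)
      finally show "(\<Sum>lam\<in>L. m lam * ?E lam S) = alt_ext (\<lambda>l. m (sub_rho n l)) (sub_roots n S w)"
        by (simp add: alt_ext_def t_def)
    qed
    finally show ?thesis using True by simp
  next
    case False
    have "irr_mult n (conv (ch n lam) (spin_char n ev)) tau = 0" if "m lam \<noteq> 0" for lam
      using irr_mult_conv_spin[OF m[OF that]] False by simp
    then show ?thesis
      using False unfolding tensor_spin_mult_def by (auto intro!: sum.neutral)
  qed
  have "(\<Sum>S\<in>Pow (pplus n). (- 1) ^ card S * f S) = (\<Sum>S\<in>spin_sets n True. f S) - (\<Sum>S\<in>spin_sets n False. f S)" for f :: "_ \<Rightarrow> int"
  proof -
    have "Pow (pplus n) = spin_sets n True \<union> spin_sets n False" by (auto simp: spin_sets_def)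
    then have "(\<Sum>S\<in>Pow (pplus n). (- 1) ^ card S * f S) =
        (\<Sum>S\<in>spin_sets n True. (- 1) ^ card S * f S) + (\<Sum>S\<in>spin_sets n False. (- 1) ^ card S * f S)"
      by (simp only:) (rule sum.union_disjoint, auto simp: spin_sets_def)
    also have "(\<Sum>S\<in>spin_sets n True. (- 1) ^ card S * f S) = (\<Sum>S\<in>spin_sets n True. f S)"
      by (intro sum.cong) (auto simp: spin_sets_def)
    also have "(\<Sum>S\<in>spin_sets n False. (- 1) ^ card S * f S) = (\<Sum>S\<in>spin_sets n False. - f S)"
      by (intro sum.cong) (auto simp: spin_sets_def)
    finally show ?thesis by (simp add: sum_negf)
  qed
  then show ?thesis
    unfolding dirac_index_def tsm w_def by simp
qed

lemma alt_ext_of_int: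
  "alt_ext g (map of_int z :: rat list) = alt_ext (\<lambda>l. g (map of_int l)) z"
proof -
  have "sort (map of_int z :: rat list) = map of_int (sort z)"
    by (rule properties_for_sort) (auto simp: sorted_map)
  moreover have "vsgn (map of_int z :: rat list) = vsgn z"
  proof (induction z)
    case (Cons a z)
    have "map (sg (of_int a :: rat)) (map of_int z) = map (sg a) z" by (simp add: sg_def)
    with Cons show ?case by (simp only: list.map vsgn.simps)
  qed simp
  ultimately show ?thesis by (simp add: alt_ext_def rev_map)
qed

text \<open>Shifts by roots keep each entry modulo the integers. If the weight has a nonintegral
  entry, no term survives; otherwise all terms live on integer lists, where \<open>G\<close>
  coincides with the alternating extension of \<open>m\<close>.\<close>

lemma dirac_index_zeroI:
  fixes G :: "int list \<Rightarrow> int"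
  assumes m: "\<And>lam. m lam \<noteq> 0 \<Longrightarrow> dominant n lam"
    and int: "\<And>l. length l = n \<Longrightarrow> m (sub_rho n l) \<noteq> 0 \<Longrightarrow> set l \<subseteq> \<int>"
    and G: "alternating G" "annihilated n G"
    and eq: "\<And>z. length z = n \<Longrightarrow> sorted_wrt (>) z \<Longrightarrow> m (sub_rho n (map of_int z)) = G z"
  shows "dirac_index n m = (\<lambda>_. 0)"
proof
  fix tau
  define w where "w = map (\<lambda>x. x + rho_n_entry n) (add_rho n tau)"
  let ?A = "alt_ext (\<lambda>l. m (sub_rho n l))"
  have "(\<Sum>S\<in>Pow (pplus n). (- 1) ^ card S * ?A (sub_roots n S w)) = 0"
  proof (cases "set w \<subseteq> \<int>")
    case True
    then have "\<forall>x\<in>set w. \<exists>k. x = of_int k" by (auto elim!: Ints_cases)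
    then obtain f where f: "\<And>x. x \<in> set w \<Longrightarrow> x = of_int (f x)" by metis
    define z where "z = map f w"
    have w: "w = map of_int z" using f by (auto simp: z_def intro!: nth_equalityI)
    have lz: "length z = n" by (simp add: z_def w_def)
    have "sub_roots n S w = map of_int (sub_roots n S z)" for S
      using lz by (auto simp: sub_roots_def w case_prod_beta intro!: sum.cong)
    then have "?A (sub_roots n S w) = G (sub_roots n S z)" for S
      using alternating_eqI[OF alternating_alt_ext G(1), of n "\<lambda>l. m (sub_rho n (map of_int l))" "sub_roots n S z"] eq
      by (simp add: alt_ext_of_int alt_ext_decr)
    then show ?thesis using G(2) lz by (simp add: annihilated_def)
  next
    case False
    then obtain a where a: "a < n" "w ! a \<notin> \<int>"
      by (metis in_set_conv_nth length_add_rho length_map subsetI w_def)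
    have "?A (sub_roots n S w) = 0" if "S \<in> Pow (pplus n)" for S
    proof (rule ccontr)
      assume "?A (sub_roots n S w) \<noteq> 0"
      then have "m (sub_rho n (rev (sort (sub_roots n S w)))) \<noteq> 0" by (auto simp: alt_ext_def)
      from int[OF _ this] have "set (sub_roots n S w) \<subseteq> \<int>" by simp
      then have "sub_roots n S w ! a \<in> \<int>" using a(1) by (metis length_sub_roots nth_mem subsetD)
      moreover have "finite S" using that finite_subset[OF _ finite_pplus] by auto
      from sub_roots_nth_int[OF a(1) this] obtain k where "sub_roots n S w ! a = w ! a - of_int k" by auto
      ultimately have "w ! a - of_int k + of_int k \<in> \<int>" by (metis Ints_add Ints_of_int)
      with a(2) show False by simp
    qed
    then show ?thesis by simp
  qed
  then show "dirac_index n m tau = 0"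
    using dirac_index_eq[of m n tau, OF m] by (simp add: w_def)
qed

section \<open>The unipotent representations\<close>

lemma alternates_iff_nth: "alternates c l \<longleftrightarrow> (\<forall>m<length l. l ! m = (c = even m))"
proof (induction l arbitrary: c)
  case (Cons x l)
  then show ?case by (auto simp: All_less_Suc2)
qed simp

lemma nbig_swap: "nbig K (xs @ a # b # ys) = nbig K (xs @ b # a # ys)"
  by (induction xs) auto

lemma alternating_nbig:
  assumes "alternating f"
  shows "alternating (\<lambda>v. h (nbig K v) * f v)"
  unfolding alternating_def
proof (intro allI)
  fix xs a b ys
  show "h (nbig K (xs @ a # b # ys)) * f (xs @ a # b # ys) = - (h (nbig K (xs @ b # a # ys)) * f (xs @ b # a # ys))"
    using alternatingD[OF assms, of xs a b ys] nbig_swap[of K xs a b ys] by simp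
qed

lemma decr_lower_bound:
  fixes xs :: "int list"
  assumes "sorted_wrt (>) xs" "\<And>x. x \<in> set xs \<Longrightarrow> L \<le> x" "m < length xs"
  shows "L + int (length xs - 1 - m) \<le> xs ! m"
  using assms
proof (induction xs arbitrary: m)
  case (Cons x xs)
  show ?case
  proof (cases m)
    case 0
    show ?thesis
    proof (cases "xs = []")
      case False
      have "L + int (length xs - 1 - 0) \<le> xs ! 0"
        by (rule Cons.IH) (use Cons.prems False in auto)
      moreover have "xs ! 0 < x" using Cons.prems(1) False by simp
      ultimately show ?thesis using 0 False by (simp add: of_nat_diff Suc_leI)
    qed (use Cons 0 in auto)
  next
    case (Suc m')
    then show ?thesis using Cons by auto
  qed
qed simp

lemma decr_upper_bound:
  fixes ys :: "int list"
  assumes "sorted_wrt (>) ys" "\<And>y. y \<in> set ys \<Longrightarrow> y < K" "m < length ys"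
  shows "ys ! m \<le> K - 1 - int m"
  using assms(3)
proof (induction m)
  case 0
  then show ?case using assms(2)[of "ys ! 0"] by simp
next
  case (Suc m)
  then have "ys ! Suc m < ys ! m" using assms(1) by (simp add: sorted_wrt_iff_nth_less)
  with Suc show ?case by simp
qed

lemma decr_unique:
  fixes xs ys :: "int list"
  assumes "sorted_wrt (>) xs" "sorted_wrt (>) ys" "set xs = set ys"
  shows "xs = ys"
proof -
  have "distinct xs \<and> sorted (rev xs)" if "sorted_wrt (>) xs" for xs :: "int list"
    using that by (induction xs) (auto simp: sorted_append intro: less_imp_le)
  with assms have "rev xs = rev ys" by (intro sorted_distinct_set_unique) auto
  then show ?thesis by simp
qed

section \<open>Shifted K-types as decreasing lists around the fixed block\<close>

definition midblock :: "nat \<Rightarrow> nat \<Rightarrow> int list" where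
  "midblock k p = rev [int k..int k + int p - 1]"

lemma length_midblock [simp]: "length (midblock k p) = p"
  by (simp add: midblock_def)

lemma set_midblock [simp]: "set (midblock k p) = {int k..<int k + int p}"
  by (auto simp: midblock_def)

lemma midblock_nth: "i < p \<Longrightarrow> midblock k p ! i = int k + int p - 1 - int i"
  by (simp add: midblock_def rev_nth nth_upto of_nat_diff)

lemma midblock_decr: "sorted_wrt (>) (midblock k p)"
  by (simp add: sorted_wrt_iff_nth_less midblock_nth)

lemma decr_split_midblock:
  assumes "sorted_wrt (>) z" "{int k..<int k + int p} \<subseteq> set z"
  shows "z = filter (\<lambda>x. int k + int p \<le> x) z @ midblock k p @ filter (\<lambda>x. x < int k) z"
proof (rule decr_unique)
  show "sorted_wrt (>) (filter (\<lambda>x. int k + int p \<le> x) z @ midblock k p @ filter (\<lambda>x. x < int k) z)"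
    using assms(1) midblock_decr by (auto simp: sorted_wrt_append sorted_wrt_filter)
  show "set z = set (filter (\<lambda>x. int k + int p \<le> x) z @ midblock k p @ filter (\<lambda>x. x < int k) z)"
    using assms(2) by auto
qed fact

lemma split_midblock_filters:
  assumes "z = xs @ midblock k p @ ys" "\<And>x. x \<in> set xs \<Longrightarrow> int k + int p \<le> x" "\<And>y. y \<in> set ys \<Longrightarrow> y < int k"
  shows "filter (\<lambda>x. int k + int p \<le> x) z = xs" "filter (\<lambda>x. x < int k) z = ys"
    "filter (\<lambda>x. x \<notin> {int k..<int k + int p}) z = xs @ ys"
proof -
  have "filter (\<lambda>x. int k + int p \<le> x) xs = xs" "filter (\<lambda>x. int k + int p \<le> x) (midblock k p) = []"
    "filter (\<lambda>x. int k + int p \<le> x) ys = []" "filter (\<lambda>x. x < int k) xs = []" "filter (\<lambda>x. x < int k) (midblock k p) = []"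
    "filter (\<lambda>x. x < int k) ys = ys" "filter (\<lambda>x. x \<notin> {int k..<int k + int p}) xs = xs"
    "filter (\<lambda>x. x \<notin> {int k..<int k + int p}) (midblock k p) = []" "filter (\<lambda>x. x \<notin> {int k..<int k + int p}) ys = ys"
    using assms(2,3) by (fastforce simp: filter_id_conv filter_empty_conv)+
  then show "filter (\<lambda>x. int k + int p \<le> x) z = xs" "filter (\<lambda>x. x < int k) z = ys"
    "filter (\<lambda>x. x \<notin> {int k..<int k + int p}) z = xs @ ys"
    by (simp_all only: assms(1) filter_append append_Nil append_Nil2)
qed

text \<open>The subtracted term is the least possible entry at position \<open>m\<close> of a
  decreasing list above the block; \<open>small_ok\<close> compares with the greatest possible entry
  below it.\<close>

definition big_ok :: "nat \<Rightarrow> nat \<Rightarrow> nat \<Rightarrow> int list \<Rightarrow> bool" where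
  "big_ok k p e xs \<longleftrightarrow> (\<forall>m<length xs. even (xs ! m - (int k + int p + int (length xs - 1 - m)) - int e))"

definition small_ok :: "nat \<Rightarrow> nat \<Rightarrow> int list \<Rightarrow> bool" where
  "small_ok k e ys \<longleftrightarrow> (\<forall>m<length ys. even (int k - 1 - int m - ys ! m - int e))"

lemma Ktypes_sub_rho_iff:
  assumes "r + s = 2 * k" and n: "n = 2 * k + p" and z: "length z = n"
  shows "sub_rho n (map of_int z) \<in> Ktypes n r s e e' \<longleftrightarrow>
    (\<exists>a b :: nat list. length a = r \<and> length b = s \<and> sorted (rev a) \<and> sorted (rev b) \<and>
      (\<forall>m<n. z ! m = int r - int k + int (n - 1 - m) +
         (if m < r then int (2 * a ! m + e) else if n - s \<le> m then - int (2 * b ! (n - 1 - m) + e') else 0)))"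
proof -
  have c: "(of_nat r - of_nat s) / 2 = (of_int (int r - int k) :: rat)"
  proof -
    have "(of_nat (r + s) :: rat) = of_nat (2 * k)" by (simp only: assms(1))
    then show ?thesis by simp
  qed
  have "sub_rho n (map of_int z) = map (\<lambda>m. (of_nat r - of_nat s) / 2 +
               (if m < r then of_nat (2 * a ! m + e)
                else if n - s \<le> m then - of_nat (2 * b ! (n - 1 - m) + e')
                else 0)) [0..<n] \<longleftrightarrow>
      (\<forall>m<n. z ! m = int r - int k + int (n - 1 - m) +
         (if m < r then int (2 * a ! m + e) else if n - s \<le> m then - int (2 * b ! (n - 1 - m) + e') else 0))" for a b
  proof -
    have "(of_int (z ! m) - rho n m = of_int (int r - int k) +
               (if m < r then of_nat (2 * a ! m + e) else if n - s \<le> m then - of_nat (2 * b ! (n - 1 - m) + e') else 0))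
        \<longleftrightarrow> z ! m = int r - int k + int (n - 1 - m) +
         (if m < r then int (2 * a ! m + e) else if n - s \<le> m then - int (2 * b ! (n - 1 - m) + e') else 0)" (is "?L \<longleftrightarrow> ?R") for m
    proof -
      have "?L \<longleftrightarrow> (of_int (z ! m) :: rat) = of_int (int r - int k + int (n - 1 - m) +
         (if m < r then int (2 * a ! m + e) else if n - s \<le> m then - int (2 * b ! (n - 1 - m) + e') else 0))"
        unfolding rho_def by (auto simp: algebra_simps)
      then show ?thesis by (simp only: of_int_eq_iff)
    qed
    moreover have "sub_rho n (map of_int z) = map F [0..<n] \<longleftrightarrow> (\<forall>m<n. of_int (z ! m) - rho n m = F m)" for F
      using z by (simp add: list_eq_iff_nth_eq sub_rho_def)
    ultimately show ?thesis by (simp only: c)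
  qed
  then show ?thesis unfolding Ktypes_def by simp
qed

text \<open>Since \<open>(r - s) / 2 = r - k\<close>, adding \<open>rho\<close> turns the
  \<open>p\<close> zeros of a K-type into the block. Strict decrease on either side of the block
  amounts to weak decrease of \<open>a\<close> and \<open>b\<close>.\<close>

lemma Ktypes_decr_iff:
  assumes rs: "r + s = 2 * k" and n: "n = 2 * k + p" and z: "length z = n" "sorted_wrt (>) z"
    and e: "e < 2" "e' < 2"
  shows "sub_rho n (map of_int z) \<in> Ktypes n r s e e' \<longleftrightarrow>
    (\<exists>xs ys. z = xs @ midblock k p @ ys \<and> length xs = r \<and> length ys = s \<and>
       (\<forall>x\<in>set xs. int k + int p \<le> x) \<and> (\<forall>y\<in>set ys. y < int k) \<and> big_ok k p e xs \<and> small_ok k e' ys)"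
    (is "_ \<longleftrightarrow> ?R")
proof -
  have ns: "n - s = r + p" using rs n by simp
  show ?thesis
    unfolding Ktypes_sub_rho_iff[OF rs n z(1)]
  proof
    assume "\<exists>a b :: nat list. length a = r \<and> length b = s \<and> sorted (rev a) \<and> sorted (rev b) \<and>
      (\<forall>m<n. z ! m = int r - int k + int (n - 1 - m) +
         (if m < r then int (2 * a ! m + e) else if n - s \<le> m then - int (2 * b ! (n - 1 - m) + e') else 0))"
    then obtain a b :: "nat list" where ab: "\<And>m. m < n \<Longrightarrow> z ! m = int r - int k + int (n - 1 - m) +
         (if m < r then int (2 * a ! m + e) else if r + p \<le> m then - int (2 * b ! (n - 1 - m) + e') else 0)"
      unfolding ns by blast
    define xs where "xs = take r z"
    define ys where "ys = drop (r + p) z"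
    have lx: "length xs = r" and ly: "length ys = s"
      using z rs n by (auto simp: xs_def ys_def)
    have x: "xs ! m = int k + int p + int (r - 1 - m) + int (2 * a ! m + e)" if "m < r" for m
      using ab[of m] that rs n by (simp add: xs_def of_nat_diff)
    have y: "ys ! m = int k - 1 - int m - int (2 * b ! (s - 1 - m) + e')" if "m < s" for m
    proof -
      have "n - 1 - (r + p + m) = s - 1 - m" using rs n by simp
      then show ?thesis using ab[of "r + p + m"] that rs n z by (simp add: ys_def of_nat_diff)
    qed
    have m: "take p (drop r z) = midblock k p"
      by (rule nth_equalityI) (use ab rs n z in \<open>auto simp: midblock_nth of_nat_diff\<close>)
    have "z = xs @ midblock k p @ ys"
      unfolding xs_def ys_def m[symmetric]
      by (metis add.commute append_take_drop_id drop_drop)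
    moreover have "\<forall>w\<in>set xs. int k + int p \<le> w"
      using x lx by (auto simp: in_set_conv_nth)
    moreover have "\<forall>w\<in>set ys. w < int k"
      using y ly by (auto simp: in_set_conv_nth)
    moreover have "big_ok k p e xs" using x lx by (simp add: big_ok_def)
    moreover have "small_ok k e' ys" using y ly by (simp add: small_ok_def)
    ultimately show ?R using lx ly by blast
  next
    assume ?R
    then obtain xs ys where zs: "z = xs @ midblock k p @ ys" and l: "length xs = r" "length ys = s"
      and xs: "\<forall>x\<in>set xs. int k + int p \<le> x" "big_ok k p e xs"
      and ys: "\<forall>y\<in>set ys. y < int k" "small_ok k e' ys" by blast
    have dx: "sorted_wrt (>) xs" and dy: "sorted_wrt (>) ys"
      using z(2) by (auto simp: zs sorted_wrt_append)
    define A where "A = (\<lambda>m. xs ! m - (int k + int p + int (r - 1 - m)) - int e)"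
    define B where "B = (\<lambda>m. int k - 1 - int m - ys ! m - int e')"
    have A: "even (A m) \<and> 0 \<le> A m" if "m < r" for m
    proof -
      have ev: "even (A m)" using xs(2) that by (simp add: big_ok_def A_def l)
      \<comment> \<open>Subtracting \<open>e\<close>, which may be 1, weakens the bound from 0 to
        -1; evenness restores it.\<close>
      moreover have "- 1 \<le> A m"
        using decr_lower_bound[OF dx, of "int k + int p" m] xs(1) that e(1) by (simp add: A_def l)
      moreover have "A m \<noteq> - 1" using ev by auto
      ultimately show ?thesis by linarith
    qed
    have B: "even (B m) \<and> 0 \<le> B m" if "m < s" for m
    proof -
      have ev: "even (B m)" using ys(2) that by (simp add: small_ok_def B_def l)
      moreover have "- 1 \<le> B m"
        using decr_upper_bound[OF dy, of "int k" m] ys(1) that e(2) by (simp add: B_def l)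
      moreover have "B m \<noteq> - 1" using ev by auto
      ultimately show ?thesis by linarith
    qed
    define a where "a = map (\<lambda>m. nat (A m div 2)) [0..<r]"
    \<comment> \<open>\<open>Ktypes\<close> reads \<open>b\<close> from the last coordinate
      backwards, hence the reversed index.\<close>
    define b where "b = map (\<lambda>j. nat (B (s - 1 - j) div 2)) [0..<s]"
    have "sorted (rev a)"
    proof -
      have "A j \<le> A i" if "i < j" "j < r" for i j
        using that
      proof (induction j)
        case (Suc j)
        have "xs ! Suc j < xs ! j" using Suc.prems dx l by (simp add: sorted_wrt_iff_nth_less)
        then have "A (Suc j) \<le> A j" using Suc.prems by (simp add: A_def of_nat_diff)
        with Suc show ?case by (cases "i = j") auto
      qed simp
      then show ?thesis
        unfolding sorted_wrt_rev by (auto simp: sorted_wrt_iff_nth_less a_def intro!: nat_mono zdiv_mono1)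
    qed
    moreover have "sorted (rev b)"
    proof -
      have "B i \<le> B j" if "i < j" "j < s" for i j
        using that
      proof (induction j)
        case (Suc j)
        have "ys ! Suc j < ys ! j" using Suc.prems dy l by (simp add: sorted_wrt_iff_nth_less)
        then have "B j \<le> B (Suc j)" by (simp add: B_def)
        with Suc show ?case by (cases "i = j") auto
      qed simp
      then show ?thesis
        unfolding sorted_wrt_rev by (auto simp: sorted_wrt_iff_nth_less b_def intro!: nat_mono zdiv_mono1)
    qed
    moreover have "z ! m = int r - int k + int (n - 1 - m) +
         (if m < r then int (2 * a ! m + e) else if n - s \<le> m then - int (2 * b ! (n - 1 - m) + e') else 0)"
      if m: "m < n" for m
    proof -
      consider "m < r" | "r \<le> m" "m < r + p" | "r + p \<le> m" by linarith
      then show ?thesis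
      proof cases
        case 1
        then have "int (2 * a ! m) = A m" using A[OF 1] by (simp add: a_def)
        moreover have "z ! m = xs ! m" using 1 l by (simp add: zs nth_append)
        ultimately show ?thesis using 1 rs n by (simp add: A_def of_nat_diff)
      next
        case 2
        moreover from 2 have "m - r < p" by linarith
        ultimately have "z ! m = midblock k p ! (m - r)" using l by (simp add: zs nth_append)
        then show ?thesis using 2 rs n ns by (simp add: midblock_nth of_nat_diff)
      next
        case 3
        define j where "j = m - (r + p)"
        have j: "j < s" "m = r + p + j" "n - 1 - m = s - 1 - j" using 3 m rs n by (auto simp: j_def)
        have "s - 1 - (s - 1 - j) = j" using j(1) by simp
        then have "int (2 * b ! (s - 1 - j)) = B j" using B[OF j(1)] j(1) by (simp add: b_def)
        moreover have "z ! m = ys ! j" using j l by (simp add: zs nth_append)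
        ultimately show ?thesis using j rs n ns by (simp add: B_def of_nat_diff)
      qed
    qed
    ultimately show "\<exists>a b :: nat list. length a = r \<and> length b = s \<and> sorted (rev a) \<and> sorted (rev b) \<and>
      (\<forall>m<n. z ! m = int r - int k + int (n - 1 - m) +
         (if m < r then int (2 * a ! m + e) else if n - s \<le> m then - int (2 * b ! (n - 1 - m) + e') else 0))"
      by (intro exI[of _ a] exI[of _ b]) (simp add: a_def b_def)
  qed
qed

text \<open>The first colour is the parity of the first large entry of a K-type. Continuing the
  alternation to the small entries predicts parities that are off by \<open>p + e + e'\<close>, that
  is by \<open>p + \<delta>\<close> modulo 2, and the twist corrects exactly this.\<close>

lemma alternates_colours_iff:
  assumes rs: "length xs + length ys = 2 * k" and d: "(e + e') mod 2 = \<delta>"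
    and xs: "\<And>x. x \<in> set xs \<Longrightarrow> int k \<le> x" and ys: "\<And>y. y \<in> set ys \<Longrightarrow> y < int k"
  shows "alternates (even (p + k + length xs + 1 + e)) (map (colour (int k) (odd (p + \<delta>))) (xs @ ys)) \<longleftrightarrow>
    big_ok k p e xs \<and> small_ok k e' ys"
proof -
  let ?c = "even (p + k + length xs + 1 + e)" and ?f = "colour (int k) (odd (p + \<delta>))"
  let ?r = "length xs" and ?s = "length ys"
  have split: "(\<forall>m<a + b. P m) \<longleftrightarrow> (\<forall>m<a. P m) \<and> (\<forall>m<b. P (a + m))" for a b :: nat and P
    by (metis add_less_cancel_left le_add_diff_inverse not_le trans_less_add1)
  have "alternates ?c (map ?f (xs @ ys)) \<longleftrightarrow>
      (\<forall>m<?r. ?f (xs ! m) = (?c = even m)) \<and> (\<forall>m<?s. ?f (ys ! m) = (?c = even (?r + m)))"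
    unfolding alternates_iff_nth length_map length_append split by (simp add: nth_append)
  also have "(\<forall>m<?r. ?f (xs ! m) = (?c = even m)) \<longleftrightarrow> big_ok k p e xs"
  proof -
    have "?f (xs ! m) = (?c = even m) \<longleftrightarrow> even (xs ! m - (int k + int p + int (?r - 1 - m)) - int e)" if "m < ?r" for m
    proof -
      have "?f (xs ! m) = even (xs ! m)" using xs that by (simp add: colour_def)
      moreover have "(even X = (?c = even m)) \<longleftrightarrow> even (X - (int k + int p + int (?r - 1 - m)) - int e)" for X :: int
        using that by presburger
      ultimately show ?thesis by simp
    qed
    then show ?thesis unfolding big_ok_def by blast
  qed
  also have "(\<forall>m<?s. ?f (ys ! m) = (?c = even (?r + m))) \<longleftrightarrow> small_ok k e' ys"
  proof -
    have "?f (ys ! m) = (?c = even (?r + m)) \<longleftrightarrow> even (int k - 1 - int m - ys ! m - int e')" if "m < ?s" for m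
    proof -
      have "ys ! m < int k" using ys that by simp
      then have "?f (ys ! m) = (even (ys ! m) \<noteq> odd (p + \<delta>))" by (simp add: colour_def)
      moreover have "((even Y \<noteq> odd (p + \<delta>)) = (?c = even (?r + m))) \<longleftrightarrow> even (int k - 1 - int m - Y - int e')" for Y :: int
        using d by presburger
      ultimately show ?thesis by simp
    qed
    then show ?thesis unfolding small_ok_def by blast
  qed
  finally show ?thesis .
qed

text \<open>Covers the extreme cases as well: for \<open>r = 2 * k\<close> or \<open>r = 0\<close>
  the K-types depend on one sign only, and each value of that sign occurs in exactly one pair with
  the given \<open>\<delta>\<close>.\<close>

definition Xsum :: "nat \<Rightarrow> nat \<Rightarrow> nat \<Rightarrow> nat \<Rightarrow> wt \<Rightarrow> int" where
  "Xsum n k \<delta> r lam = (\<Sum>eps<2. \<Sum>eta<2. if (eps + eta) mod 2 = \<delta> then Xmod n r (2 * k - r) eps eta lam else 0)"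

text \<open>The sign comes from moving the \<open>p\<close> entries of the block past the \<open>r\<close> large ones.\<close>
lemma Xsum_decr:
  assumes n: "n = 2 * k + p" and r: "r \<le> 2 * k" and d: "\<delta> < 2"
    and z: "length z = n" "sorted_wrt (>) z"
  shows "Xsum n k \<delta> r (sub_rho n (map of_int z)) = (- 1) ^ (p * r) *
    wedge_block (int k) p (\<lambda>v. of_bool (nbig (int k) v = int r) * chain (int k) (odd (p + \<delta>)) v) z"
proof -
  define s where "s = 2 * k - r"
  have rs: "r + s = 2 * k" using r by (simp add: s_def)
  note iff = Ktypes_decr_iff[OF rs n z]
  show ?thesis
  proof (cases "{int k..<int k + int p} \<subseteq> set z")
    case False
    have "sub_rho n (map of_int z) \<notin> Ktypes n r s e e'" if "e < 2" "e' < 2" for e e'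
      unfolding iff[OF that] using False by auto
    then have "Xsum n k \<delta> r (sub_rho n (map of_int z)) = 0"
      unfolding Xsum_def Xmod_def s_def[symmetric] by (intro sum.neutral ballI) auto
    then show ?thesis using False by (simp add: wedge_block_decr[OF z(2)])
  next
    case True
    define xs where "xs = filter (\<lambda>x. int k + int p \<le> x) z"
    define ys where "ys = filter (\<lambda>x. x < int k) z"
    have zs: "z = xs @ midblock k p @ ys"
      using decr_split_midblock[OF z(2) True] by (simp add: xs_def ys_def)
    have x: "int k + int p \<le> x" if "x \<in> set xs" for x using that by (simp add: xs_def)
    have y: "x < int k" if "x \<in> set ys" for x using that by (simp add: ys_def)
    have dec: "sorted_wrt (>) (xs @ ys)"
      using z(2) by (auto simp: zs sorted_wrt_append)
    have len: "length xs + length ys = 2 * k" using z(1) n by (simp add: zs)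
    have X: "Xmod n r s e e' (sub_rho n (map of_int z)) =
        of_bool (length xs = r \<and> big_ok k p e xs \<and> small_ok k e' ys)" if "e < 2" "e' < 2" for e e'
    proof -
      have "sub_rho n (map of_int z) \<in> Ktypes n r s e e' \<longleftrightarrow> length xs = r \<and> big_ok k p e xs \<and> small_ok k e' ys"
        unfolding iff[OF that]
      proof safe
        fix xs' ys' assume *: "z = xs' @ midblock k p @ ys'" "\<forall>x\<in>set xs'. int k + int p \<le> x" "\<forall>y\<in>set ys'. y < int k"
        have "xs = xs'" "ys = ys'"
          using split_midblock_filters[OF *(1)] *(2,3) by (simp_all add: xs_def ys_def)
        moreover assume "big_ok k p e xs'" "small_ok k e' ys'"
        ultimately show "length xs = length xs'" "big_ok k p e xs" "small_ok k e' ys" by simp_all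
      next
        assume "big_ok k p e xs" "small_ok k e' ys" "r = length xs"
        then show "\<exists>xs' ys'. z = xs' @ midblock k p @ ys' \<and> length xs' = length xs \<and> length ys' = s \<and>
           (\<forall>x\<in>set xs'. int k + int p \<le> x) \<and> (\<forall>y\<in>set ys'. y < int k) \<and> big_ok k p e xs' \<and> small_ok k e' ys'"
          using zs x y len rs by (intro exI[of _ xs] exI[of _ ys]) auto
      qed
      then show ?thesis by (simp add: Xmod_def)
    qed
    have nb: "nbig (int k) (xs @ ys) = int (length xs)"
    proof -
      have "filter (\<lambda>x. int k \<le> x) xs = xs" "filter (\<lambda>x. int k \<le> x) ys = []"
        using x y by (fastforce simp: filter_id_conv filter_empty_conv)+
      then show ?thesis by (simp add: nbig_def)
    qed
    have rhs: "wedge_block (int k) p (\<lambda>v. of_bool (nbig (int k) v = int r) * chain (int k) (odd (p + \<delta>)) v) z =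
        (- 1) ^ (p * length xs) * (of_bool (length xs = r) * chain (int k) (odd (p + \<delta>)) (xs @ ys))"
      using True split_midblock_filters(3)[OF zs x y] unfolding wedge_block_decr[OF z(2)] xs_def[symmetric]
      by (simp add: nb)
    show ?thesis
    proof (cases "length xs = r")
      case False
      then have "Xsum n k \<delta> r (sub_rho n (map of_int z)) = 0"
        unfolding Xsum_def s_def[symmetric] by (intro sum.neutral ballI) (simp add: X)
      with False show ?thesis unfolding rhs by simp
    next
      case r: True
      let ?alternates = "\<lambda>c. alternates c (map (colour (int k) (odd (p + \<delta>))) (xs @ ys))"
      have X': "Xmod n r s e e' (sub_rho n (map of_int z)) = of_bool (?alternates (even (p + k + length xs + 1 + e)))"
        if "e < 2" "e' < 2" "(e + e') mod 2 = \<delta>" for e e'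
        using alternates_colours_iff[OF len that(3), of p] x y X[OF that(1,2)] r by force
      have "Xsum n k \<delta> r (sub_rho n (map of_int z)) =
          of_bool (?alternates (even (p + k + length xs + 1))) + of_bool (?alternates (even (p + k + length xs + 2)))"
        unfolding Xsum_def s_def[symmetric] using d X'[of 0 0] X'[of 0 1] X'[of 1 0] X'[of 1 1]
        by (cases "\<delta> = 0") (auto simp: numeral_2_eq_2)
      also have "\<dots> = chain (int k) (odd (p + \<delta>)) (xs @ ys)"
        unfolding chain_decr[OF dec] by (cases "even (p + k + length xs)") auto
      finally show ?thesis
        unfolding rhs r by (simp add: mult.assoc[symmetric] flip: power_add)
    qed
  qed
qed

section \<open>Dominance and integrality of the K-types, and the vanishing theorems\<close>

lemma Ktypes_nth:
  assumes "lam \<in> Ktypes n r s e e'"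
  obtains f :: "nat \<Rightarrow> int" where "length lam = n" "\<And>m. m < n \<Longrightarrow> lam ! m = (of_nat r - of_nat s) / 2 + of_int (f m)"
    "\<And>m. Suc m < n \<Longrightarrow> f (Suc m) \<le> f m"
proof -
  from assms obtain a b :: "nat list" where ab: "length a = r" "length b = s" "sorted (rev a)" "sorted (rev b)"
    and lam: "lam = map (\<lambda>m. (of_nat r - of_nat s) / 2 +
               (if m < r then of_nat (2 * a ! m + e)
                else if n - s \<le> m then - of_nat (2 * b ! (n - 1 - m) + e')
                else 0)) [0..<n]"
    by (auto simp: Ktypes_def)
  define f where "f = (\<lambda>m. if m < r then int (2 * a ! m + e) else if n - s \<le> m then - int (2 * b ! (n - 1 - m) + e') else 0)"
  show ?thesis
  proof (rule that[of f])
    fix m assume m: "Suc m < n"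
    have "a ! Suc m \<le> a ! m" if "Suc m < r"
      using sorted_rev_nth_mono[OF ab(3), of m "Suc m"] that ab(1) by simp
    moreover have "b ! (n - 1 - m) \<le> b ! (n - 1 - Suc m)" if "n - s \<le> m"
      using sorted_rev_nth_mono[OF ab(4), of "n - 1 - Suc m" "n - 1 - m"] that ab(2) m by simp
    ultimately show "f (Suc m) \<le> f m"
      unfolding f_def by auto
  qed (auto simp: lam f_def)
qed

lemma Xsum_Ktypes:
  assumes "Xsum n k \<delta> r lam \<noteq> 0"
  obtains e e' where "lam \<in> Ktypes n r (2 * k - r) e e'"
proof -
  have "\<exists>e e'. lam \<in> Ktypes n r (2 * k - r) e e'"
  proof (rule ccontr)
    assume "\<nexists>e e'. lam \<in> Ktypes n r (2 * k - r) e e'"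
    then have "Xsum n k \<delta> r lam = 0"
      unfolding Xsum_def Xmod_def by (intro sum.neutral ballI) auto
    with assms show False by simp
  qed
  with that show ?thesis by blast
qed

lemma Xsum_dominant:
  assumes "0 < n" "Xsum n k \<delta> r lam \<noteq> 0"
  shows "dominant n lam"
proof -
  obtain e e' where "lam \<in> Ktypes n r (2 * k - r) e e'" using Xsum_Ktypes[OF assms(2)] .
  then obtain f where f: "length lam = n"
    "\<And>m. m < n \<Longrightarrow> lam ! m = (of_nat r - of_nat (2 * k - r)) / 2 + of_int (f m)"
    "\<And>m. Suc m < n \<Longrightarrow> f (Suc m) \<le> f m"
    using Ktypes_nth by metis
  show ?thesis
    unfolding dominant_def
  proof (intro conjI allI impI)
    have "2 * lam ! 0 = of_int (int r - int (2 * k - r) + 2 * f 0)"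
      using f(2)[of 0] assms(1) by (simp add: field_simps)
    then show "2 * lam ! 0 \<in> \<int>" by (metis Ints_of_int)
    fix i assume i: "Suc i < n"
    then have "lam ! i - lam ! Suc i = of_nat (nat (f i - f (Suc i)))"
      using f(2)[of i] f(2)[of "Suc i"] f(3)[of i] by simp
    then show "lam ! i - lam ! Suc i \<in> \<nat>" by (metis of_nat_in_Nats)
  qed (use f assms in auto)
qed

lemma Xsum_integral:
  assumes "r \<le> 2 * k" "length l = n" "Xsum n k \<delta> r (sub_rho n l) \<noteq> 0"
  shows "set l \<subseteq> \<int>"
proof
  fix x assume "x \<in> set l"
  then obtain m where m: "m < n" "x = l ! m" using assms(2) by (auto simp: in_set_conv_nth)
  obtain e e' where "sub_rho n l \<in> Ktypes n r (2 * k - r) e e'" using Xsum_Ktypes[OF assms(3)] .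
  then obtain f where "sub_rho n l ! m = (of_nat r - of_nat (2 * k - r)) / 2 + of_int (f m)"
    using Ktypes_nth m(1) by metis
  then have "x = of_int (int r - int k + f m + int (n - 1 - m))"
    using m assms(1) by (simp add: sub_rho_def rho_def of_nat_diff field_simps)
  then show "x \<in> \<int>" by (metis Ints_of_int)
qed

lemma alternating_chain: "alternating (chain K tw)"
  unfolding chain_def by (rule alternating_alt_ext)

lemma Xmod_no_small: "Xmod n r 0 e e' = Xmod n r 0 e 0"
proof -
  have "Ktypes n r 0 e e' = Ktypes n r 0 e 0"
    unfolding Ktypes_def by (intro Collect_cong ex_cong1 conj_cong refl arg_cong2[of _ _ _ _ "(=)"] map_cong) auto
  then show ?thesis by (auto simp: Xmod_def fun_eq_iff)
qed

lemma Xmod_no_big: "Xmod n 0 s e e' = Xmod n 0 s 0 e'"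
  unfolding Xmod_def Ktypes_def by simp

text \<open>For a single \<open>r\<close> the sign in \<open>Xsum_decr\<close> is a constant factor,
  so annihilation passes from \<open>annihilated_chain_odd\<close> through the block.\<close>

theorem dirac_index_Xsum_odd:
  assumes "0 < k" "2 * k \<le> n" "r \<le> 2 * k" "odd r" "\<delta> < 2"
  shows "dirac_index n (Xsum n k \<delta> r) = (\<lambda>_. 0)"
proof -
  obtain p where n: "n = 2 * k + p" using assms(2) le_Suc_ex by blast
  let ?F = "\<lambda>v. of_bool (nbig (int k) v = int r) * chain (int k) (odd (p + \<delta>)) v"
  show ?thesis
  proof (rule dirac_index_zeroI[where G = "\<lambda>z. (- 1) ^ (p * r) * wedge_block (int k) p ?F z"])
    show "alternating (\<lambda>z. (- 1) ^ (p * r) * wedge_block (int k) p ?F z)"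
      by (intro alternating_cmult alternating_wedge_block alternating_nbig alternating_chain)
    show "annihilated n (\<lambda>z. (- 1) ^ (p * r) * wedge_block (int k) p ?F z)"
      unfolding n using assms(4) by (intro annihilated_cmult annihilated_wedge_block annihilated_chain_odd) simp
  qed (use Xsum_dominant Xsum_integral Xsum_decr n assms in auto)
qed

text \<open>For even \<open>r\<close> the sign in \<open>Xsum_decr\<close> is 1. The summands
  therefore add up, without relative signs, to the part of \<open>chain\<close> with an even number
  of large entries.\<close>

theorem dirac_index_Xsum_even:
  assumes "0 < k" "2 * k \<le> n" "\<delta> < 2"
  shows "dirac_index n (\<lambda>lam. \<Sum>j\<le>k. Xsum n k \<delta> (2 * j) lam) = (\<lambda>_. 0)"
proof -
  obtain p where n: "n = 2 * k + p" using assms(2) le_Suc_ex by blast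
  let ?F = "\<lambda>v. of_bool (even (nbig (int k) v)) * chain (int k) (odd (p + \<delta>)) v"
  show ?thesis
  proof (rule dirac_index_zeroI[where G = "wedge_block (int k) p ?F"])
    fix lam assume "(\<Sum>j\<le>k. Xsum n k \<delta> (2 * j) lam) \<noteq> 0"
    then obtain j where "Xsum n k \<delta> (2 * j) lam \<noteq> 0" by (metis (no_types, lifting) sum.neutral)
    then show "dominant n lam" using Xsum_dominant assms by simp
  next
    fix l :: wt assume l: "length l = n" "(\<Sum>j\<le>k. Xsum n k \<delta> (2 * j) (sub_rho n l)) \<noteq> 0"
    from l(2) obtain j where j: "j \<le> k" "Xsum n k \<delta> (2 * j) (sub_rho n l) \<noteq> 0"
      by (metis (no_types, lifting) atMost_iff sum.neutral)
    show "set l \<subseteq> \<int>" by (rule Xsum_integral[OF _ l(1) j(2)]) (use j in simp)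
  next
    show "alternating (wedge_block (int k) p ?F)"
      by (intro alternating_wedge_block alternating_nbig alternating_chain)
    show "annihilated n (wedge_block (int k) p ?F)"
      unfolding n using assms by (intro annihilated_wedge_block annihilated_chain_even) auto
  next
    fix z :: "int list" assume z: "length z = n" "sorted_wrt (>) z"
    let ?M = "{int k..<int k + int p}" and ?v = "filter (\<lambda>x. x \<notin> {int k..<int k + int p}) z"
    let ?q = "nbig (int k) ?v" and ?c = "chain (int k) (odd (p + \<delta>)) ?v"
    let ?sg = "(- 1 :: int) ^ (p * length (filter (\<lambda>x. int k + int p \<le> x) z))"
    have "(\<Sum>j\<le>k. Xsum n k \<delta> (2 * j) (sub_rho n (map of_int z))) =
        (\<Sum>j\<le>k. if ?M \<subseteq> set z then ?sg * (of_bool (?q = int (2 * j)) * ?c) else 0)"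
      by (intro sum.cong refl) (simp add: Xsum_decr[OF n _ assms(3) z] wedge_block_decr[OF z(2)])
    also have "\<dots> = (if ?M \<subseteq> set z then ?sg * ((\<Sum>j\<le>k. of_bool (?q = int (2 * j))) * ?c) else 0)"
      by (cases "?M \<subseteq> set z") (simp_all only: if_True if_False sum_distrib_left sum_distrib_right sum.neutral_const)
    also have "\<dots> = (if ?M \<subseteq> set z then ?sg * (of_bool (even ?q) * ?c) else 0)"
    proof (cases "?M \<subseteq> set z")
      case True
      have "length ?v = 2 * k"
      proof -
        have "?v = filter (\<lambda>x. int k + int p \<le> x) z @ filter (\<lambda>x. x < int k) z"
          by (rule split_midblock_filters(3)[OF decr_split_midblock[OF z(2) True]]) auto
        moreover have "length z = length (filter (\<lambda>x. int k + int p \<le> x) z) + p + length (filter (\<lambda>x. x < int k) z)"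
          by (subst decr_split_midblock[OF z(2) True]) simp
        ultimately show ?thesis using z(1) n by simp
      qed
      then have q: "0 \<le> ?q" "?q \<le> 2 * int k"
        using length_filter_le[of "\<lambda>x. int k \<le> x" ?v] by (auto simp: nbig_def)
      \<comment> \<open>Outside the block there are \<open>2 * k\<close> entries, so an even number
        of large ones is \<open>2 * j\<close> for exactly one \<open>j \<le> k\<close>.\<close>
      have "(\<Sum>j\<le>k. of_bool (?q = int (2 * j))) = (of_bool (even ?q) :: int)"
      proof (cases "even ?q")
        case True
        then obtain i where i: "?q = 2 * i" by (auto elim: evenE)
        have "(\<Sum>j\<le>k. of_bool (?q = int (2 * j))) = (\<Sum>j\<le>k. if j = nat i then 1 else 0 :: int)"
          using i q(1) by (intro sum.cong) auto
        also have "\<dots> = 1" using i q by simp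
        finally show ?thesis using True by simp
      next
        case False
        then have "?q \<noteq> int (2 * j)" for j by auto
        then show ?thesis using False by simp
      qed
      then show ?thesis by (simp only:)
    qed simp
    finally show "(\<Sum>j\<le>k. Xsum n k \<delta> (2 * j) (sub_rho n (map of_int z))) = wedge_block (int k) p ?F z"
      unfolding wedge_block_decr[OF z(2)] .
  qed
qed

theorem mainTheorem3:
  fixes n k :: nat
  assumes "0 < k" and "2 * k \<le> n"
  shows "(\<forall>j \<delta>. 1 \<le> j \<and> j \<le> k - 1 \<and> \<delta> < 2 \<longrightarrow>
            dirac_index n (\<lambda>lam. \<Sum>eps<2. \<Sum>eta<2.
                if (eps + eta) mod 2 = \<delta>
                then Xmod n (2 * j - 1) (2 * k + 1 - 2 * j) eps eta lam else 0) = (\<lambda>_. 0))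
       \<and> (\<forall>\<delta>::nat. \<delta> < 2 \<longrightarrow>
            dirac_index n (\<lambda>lam. (\<Sum>eps<2. Xmod n (2 * k) 0 eps 0 lam)
                + (\<Sum>eta<2. Xmod n 0 (2 * k) 0 eta lam)
                + (\<Sum>j\<in>{1..k - 1}. \<Sum>eps<2. \<Sum>eta<2.
                     if (eps + eta) mod 2 = \<delta>
                     then Xmod n (2 * j) (2 * k - 2 * j) eps eta lam else 0)) = (\<lambda>_. 0))"
proof (intro conjI allI impI)
  fix j \<delta> :: nat assume j: "1 \<le> j \<and> j \<le> k - 1 \<and> \<delta> < 2"
  then have e: "2 * k - (2 * j - 1) = 2 * k + 1 - 2 * j" by auto
  have "dirac_index n (\<lambda>lam. Xsum n k \<delta> (2 * j - 1) lam) = (\<lambda>_. 0)"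
    by (rule dirac_index_Xsum_odd[OF assms]) (use j in auto)
  then show "dirac_index n (\<lambda>lam. \<Sum>eps<2. \<Sum>eta<2. if (eps + eta) mod 2 = \<delta>
      then Xmod n (2 * j - 1) (2 * k + 1 - 2 * j) eps eta lam else 0) = (\<lambda>_. 0)"
    unfolding Xsum_def e .
next
  fix \<delta> :: nat assume d: "\<delta> < 2"
  \<comment> \<open>For \<open>s = 0\<close> the K-types with \<open>eta = 1\<close> are those with
    \<open>eta = 0\<close>, so the pairs of signs with sum \<open>\<delta>\<close> modulo 2 run once
    through both values of \<open>eps\<close>.\<close>
  have big: "(\<Sum>eps<2. Xmod n (2 * k) 0 eps 0 lam) = Xsum n k \<delta> (2 * k) lam" for lam
    unfolding Xsum_def using d Xmod_no_small[of n "2 * k" _ 1]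
    by (cases "\<delta> = 0") (auto simp: numeral_2_eq_2)
  have small: "(\<Sum>eta<2. Xmod n 0 (2 * k) 0 eta lam) = Xsum n k \<delta> (2 * 0) lam" for lam
    unfolding Xsum_def using d Xmod_no_big[of n "2 * k" 1]
    by (cases "\<delta> = 0") (auto simp: numeral_2_eq_2)
  have "(\<Sum>eps<2. Xmod n (2 * k) 0 eps 0 lam) + (\<Sum>eta<2. Xmod n 0 (2 * k) 0 eta lam)
      + (\<Sum>j\<in>{1..k - 1}. \<Sum>eps<2. \<Sum>eta<2. if (eps + eta) mod 2 = \<delta>
           then Xmod n (2 * j) (2 * k - 2 * j) eps eta lam else 0) = (\<Sum>j\<le>k. Xsum n k \<delta> (2 * j) lam)" for lam
  proof -
    have "{..k} = insert k (insert 0 {1..k - 1})" using assms(1) by auto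
    then have "(\<Sum>j\<le>k. Xsum n k \<delta> (2 * j) lam) =
        Xsum n k \<delta> (2 * k) lam + (Xsum n k \<delta> (2 * 0) lam + (\<Sum>j\<in>{1..k - 1}. Xsum n k \<delta> (2 * j) lam))"
      using assms(1) by (simp only:) (subst sum.insert; force)+
    then show ?thesis unfolding big small by (simp only: Xsum_def add.assoc)
  qed
  then show "dirac_index n (\<lambda>lam. (\<Sum>eps<2. Xmod n (2 * k) 0 eps 0 lam)
      + (\<Sum>eta<2. Xmod n 0 (2 * k) 0 eta lam)
      + (\<Sum>j\<in>{1..k - 1}. \<Sum>eps<2. \<Sum>eta<2. if (eps + eta) mod 2 = \<delta>
           then Xmod n (2 * j) (2 * k - 2 * j) eps eta lam else 0)) = (\<lambda>_. 0)"
    using dirac_index_Xsum_even[OF assms d] by simp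
qed

end
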